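(* Let $n\ge4$ be even and let $(M,g)$ be an $n$-dimensional Einstein manifold (any signature, not necessarily compact) which is not Ricci flat, with Einstein scale $\sigma$. Let $k\in\{0,\dots,\frac n2\}$ and $p=\frac{n-2k}{2}$. The conformally invariant space $\mathcal H^k_G=\mathcal N(G_k:\mathcal C^k\to\mathcal E_{k-1})$ is given by the direct sum $$\mathcal H^k_G=\mathcal H^k_\sigma\oplus\bigoplus_{i=1}^{p}\overline{\mathcal H}^k_{\sigma,\lambda_i^k}.$$
   Context: $J=\mathrm{Sc}/(2(n-1))$ is the trace of the Schouten tensor of $g$; it is constant, and nonzero as $g$ is not Ricci flat. $\sigma$ is the density with $g=\sigma^{-2}\boldsymbol g$ ($\boldsymbol g$ the conformal metric); it is used to trivialise density bundles, so that $\mathcal E^k$ (smooth $k$-forms) and $\mathcal E_k=\mathcal E^k[2k-n]$ (density-weighted $k$-forms) are both identified with the space of smooth $k$-forms; $\mathcal E_{-1}:=0$. $d$ is the exterior derivative, $\delta$ its formal adjoint with respect to $g$, $\mathcal C^k$ the space of closed $k$-forms, $\mathcal N$ denotes null space. $G_k$ is the restriction to $\mathcal C^k$ of $$G_k^\sigma=\delta\prod_{i=1}^{\frac{n-2k}{2}}\Big(d\delta+\frac{2i(n-2k-i+1)}{n}J\Big)\qquad(G^\sigma_{n/2}=\delta).$$ Further $$\mathcal H^k_\sigma=\mathcal N(d)\cap\mathcal N(\delta)\subset\mathcal E^k,\quad \overline{\mathcal H}^k_{\sigma,\lambda}=\{f\in\mathcal E^k\mid d\delta f=\lambda f\},\quad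 \lambda_i^k=-\frac{2i(n-2k-i+1)}{n}J .$$ *)

theory Defs
  imports "HOL-Analysis.Analysis" "HOL-Library.Function_Algebras"
begin

section \<open>Smooth functions on open subsets of coordinate space\<close>

definition partial :: "'n::finite \<Rightarrow> (real^'n \<Rightarrow> real) \<Rightarrow> real^'n \<Rightarrow> real" where
  "partial i f x = frechet_derivative f (at x) (axis i 1)"

primrec Ck_on :: "nat \<Rightarrow> (real^'n::finite) set \<Rightarrow> (real^'n \<Rightarrow> real) \<Rightarrow> bool" where
  "Ck_on 0 V f \<longleftrightarrow> continuous_on V f"
| "Ck_on (Suc m) V f \<longleftrightarrow> (\<forall>x\<in>V. f differentiable (at x)) \<and> (\<forall>i. Ck_on m V (partial i f))"

definition smooth_on :: "(real^'n::finite) set \<Rightarrow> (real^'n \<Rightarrow> real) \<Rightarrow> bool" where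
  "smooth_on V f \<longleftrightarrow> (\<forall>m. Ck_on m V f)"


section \<open>Smooth manifolds\<close>

type_synonym ('a, 'n) chart = "'a set \<times> ('a \<Rightarrow> real^'n)"

definition chart_dom :: "('a, 'n::finite) chart \<Rightarrow> 'a set" where
  "chart_dom c = fst c"

definition chart_map :: "('a, 'n::finite) chart \<Rightarrow> 'a \<Rightarrow> real^'n" where
  "chart_map c = snd c"

definition chart_ran :: "('a, 'n::finite) chart \<Rightarrow> (real^'n) set" where
  "chart_ran c = chart_map c ` chart_dom c"

definition is_chart :: "'a topology \<Rightarrow> ('a, 'n::finite) chart \<Rightarrow> bool" where
  "is_chart X c \<longleftrightarrow> openin X (chart_dom c) \<and> open (chart_ran c) \<and>
     homeomorphic_map (subtopology X (chart_dom c)) (top_of_set (chart_ran c)) (chart_map c)"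

definition overlap :: "('a, 'n::finite) chart \<Rightarrow> ('a, 'n) chart \<Rightarrow> (real^'n) set" where
  "overlap c c' = chart_map c ` (chart_dom c \<inter> chart_dom c')"

definition transition :: "('a, 'n::finite) chart \<Rightarrow> ('a, 'n) chart \<Rightarrow> real^'n \<Rightarrow> real^'n" where
  "transition c c' x = chart_map c' (inv_into (chart_dom c) (chart_map c) x)"

text \<open>\<open>jac c c' x a i\<close> is the derivative of the \<open>a\<close>-th \<open>c'\<close>-coordinate in the direction of the
  \<open>i\<close>-th \<open>c\<close>-coordinate.\<close>

definition jac :: "('a, 'n::finite) chart \<Rightarrow> ('a, 'n) chart \<Rightarrow> real^'n \<Rightarrow> 'n \<Rightarrow> 'n \<Rightarrow> real" where
  "jac c c' x a i = partial i (\<lambda>y. transition c c' y $ a) x"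

text \<open>A manifold of dimension \<open>CARD('n)\<close>; the atlas need not be maximal.\<close>

definition smooth_manifold :: "'a topology \<Rightarrow> ('a, 'n::finite) chart set \<Rightarrow> bool" where
  "smooth_manifold X A \<longleftrightarrow>
     Hausdorff_space X \<and> second_countable X \<and>
     (\<forall>c\<in>A. is_chart X c) \<and> (\<Union>c\<in>A. chart_dom c) = topspace X \<and>
     (\<forall>c\<in>A. \<forall>c'\<in>A. \<forall>a. smooth_on (overlap c c') (\<lambda>x. transition c c' x $ a))"


section \<open>Pseudo-Riemannian metrics and curvature\<close>

text \<open>A metric is given by its coefficient matrix in every chart of the atlas. The signature is
  unrestricted.\<close>

type_synonym ('a, 'n) metric = "('a, 'n) chart \<Rightarrow> real^'n \<Rightarrow> real^'n^'n"

definition pseudo_riemannian :: "('a, 'n::finite) chart set \<Rightarrow> ('a, 'n) metric \<Rightarrow> bool" where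
  "pseudo_riemannian A g \<longleftrightarrow>
     (\<forall>c\<in>A. (\<forall>i j. smooth_on (chart_ran c) (\<lambda>x. g c x $ i $ j)) \<and>
            (\<forall>x\<in>chart_ran c. transpose (g c x) = g c x \<and> invertible (g c x))) \<and>
     (\<forall>c\<in>A. \<forall>c'\<in>A. \<forall>x\<in>overlap c c'. \<forall>i j.
        g c x $ i $ j =
          (\<Sum>a\<in>UNIV. \<Sum>b\<in>UNIV. jac c c' x a i * jac c c' x b j * g c' (transition c c' x) $ a $ b))"

text \<open>The next four are coordinate expressions; \<open>G\<close> is the coefficient matrix in one chart.
  \<open>christoffel G l i j\<close> has upper index \<open>l\<close>, and \<open>riemann G l k i j\<close> is the \<open>l\<close>-component of
  \<open>R(e\<^sub>i, e\<^sub>j) e\<^sub>k\<close>, so that round spheres have positive Ricci curvature.\<close>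

definition christoffel ::
  "(real^'n \<Rightarrow> real^'n^'n) \<Rightarrow> 'n::finite \<Rightarrow> 'n \<Rightarrow> 'n \<Rightarrow> real^'n \<Rightarrow> real" where
  "christoffel G l i j x = (\<Sum>m\<in>UNIV. matrix_inv (G x) $ l $ m *
     (partial i (\<lambda>y. G y $ m $ j) x + partial j (\<lambda>y. G y $ m $ i) x
        - partial m (\<lambda>y. G y $ i $ j) x)) / 2"

definition riemann ::
  "(real^'n \<Rightarrow> real^'n^'n) \<Rightarrow> 'n::finite \<Rightarrow> 'n \<Rightarrow> 'n \<Rightarrow> 'n \<Rightarrow> real^'n \<Rightarrow> real" where
  "riemann G l k i j x =
     partial i (christoffel G l j k) x - partial j (christoffel G l i k) x
     + (\<Sum>m\<in>UNIV. christoffel G l i m x * christoffel G m j k x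
                  - christoffel G l j m x * christoffel G m i k x)"

definition ricci :: "(real^'n \<Rightarrow> real^'n^'n) \<Rightarrow> 'n::finite \<Rightarrow> 'n \<Rightarrow> real^'n \<Rightarrow> real" where
  "ricci G k j x = (\<Sum>i\<in>UNIV. riemann G i k i j x)"

definition scalar_curvature :: "(real^'n \<Rightarrow> real^'n^'n) \<Rightarrow> real^'n::finite \<Rightarrow> real" where
  "scalar_curvature G x = (\<Sum>k\<in>UNIV. \<Sum>j\<in>UNIV. matrix_inv (G x) $ k $ j * ricci G k j x)"

definition einstein :: "('a, 'n::finite) chart set \<Rightarrow> ('a, 'n) metric \<Rightarrow> bool" where
  "einstein A g \<longleftrightarrow>
     (\<exists>r. \<forall>c\<in>A. \<forall>x\<in>chart_ran c. \<forall>k j. ricci (g c) k j x = r * g c x $ k $ j)"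

definition ricci_flat :: "('a, 'n::finite) chart set \<Rightarrow> ('a, 'n) metric \<Rightarrow> bool" where
  "ricci_flat A g \<longleftrightarrow> (\<forall>c\<in>A. \<forall>x\<in>chart_ran c. \<forall>k j. ricci (g c) k j x = 0)"

definition schouten_trace :: "(real^'n \<Rightarrow> real^'n^'n) \<Rightarrow> real^'n::finite \<Rightarrow> real" where
  "schouten_trace G x = scalar_curvature G x / (2 * (real CARD('n) - 1))"


section \<open>Differential forms\<close>

text \<open>A \<open>k\<close>-form on an open set of coordinate space is the family of its components
  \<open>\<omega>(e\<^bsub>I ! 0\<^esub>, \<dots>, e\<^bsub>I ! (k-1)\<^esub>)\<close>, indexed by all lists \<open>I\<close> of length \<open>k\<close>. Components at points
  outside the domain, or at lists of the wrong length, are set to \<open>0\<close>, so that equality of forms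
  is equality of functions.\<close>

type_synonym 'n lform = "real^'n \<Rightarrow> 'n list \<Rightarrow> real"

definition local_forms :: "(real^'n::finite) set \<Rightarrow> nat \<Rightarrow> 'n lform set" where
  "local_forms V k = {\<omega>.
     (\<forall>x I. x \<notin> V \<or> length I \<noteq> k \<longrightarrow> \<omega> x I = 0) \<and>
     (\<forall>I. smooth_on V (\<lambda>x. \<omega> x I)) \<and>
     (\<forall>x I i j. i < j \<and> j < length I \<longrightarrow> \<omega> x (I[i := I ! j, j := I ! i]) = - \<omega> x I)}"

definition local_d :: "'n::finite lform \<Rightarrow> 'n lform" where
  "local_d \<omega> x I =
     (\<Sum>j<length I. (-1) ^ j * partial (I ! j) (\<lambda>y. \<omega> y (take j I @ drop (Suc j) I)) x)"

text \<open>The pointwise pairing of \<open>k\<close>-forms induced by the metric; the factor \<open>1 / k!\<close> makes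
  \<open>dx\<^sup>I\<close>, \<open>I\<close> increasing, orthonormal up to sign in orthonormal coordinates.\<close>

definition form_pairing ::
  "real^'n^'n \<Rightarrow> nat \<Rightarrow> ('n::finite list \<Rightarrow> real) \<Rightarrow> ('n list \<Rightarrow> real) \<Rightarrow> real" where
  "form_pairing G k \<alpha> \<beta> =
     (\<Sum>I | length I = k. \<Sum>J | length J = k.
        (\<Prod>m<k. matrix_inv G $ (I ! m) $ (J ! m)) * \<alpha> I * \<beta> J) / fact k"

definition test_forms :: "(real^'n::finite) set \<Rightarrow> nat \<Rightarrow> 'n lform set" where
  "test_forms V k =
     {\<phi>\<in>local_forms V k. \<exists>K. compact K \<and> K \<subseteq> V \<and> (\<forall>x. x \<notin> K \<longrightarrow> \<phi> x = (\<lambda>I. 0))}"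

text \<open>A \<open>k\<close>-form on the manifold is a family of local \<open>k\<close>-forms, one for every chart of the atlas,
  that transforms covariantly on overlaps.\<close>

type_synonym ('a, 'n) mform = "('a, 'n) chart \<Rightarrow> 'n lform"

definition forms :: "('a, 'n::finite) chart set \<Rightarrow> nat \<Rightarrow> ('a, 'n) mform set" where
  "forms A k = {\<omega>.
     (\<forall>c. c \<notin> A \<longrightarrow> \<omega> c = (\<lambda>x I. 0)) \<and>
     (\<forall>c\<in>A. \<omega> c \<in> local_forms (chart_ran c) k) \<and>
     (\<forall>c\<in>A. \<forall>c'\<in>A. \<forall>x\<in>overlap c c'. \<forall>I. length I = k \<longrightarrow>
        \<omega> c x I = (\<Sum>J | length J = k.
          (\<Prod>m<k. jac c c' x (J ! m) (I ! m)) * \<omega> c' (transition c c' x) J))}"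

definition scale_form :: "real \<Rightarrow> ('a, 'n) mform \<Rightarrow> ('a, 'n) mform" where
  "scale_form r \<omega> = (\<lambda>c x I. r * \<omega> c x I)"

definition ext_d :: "('a, 'n::finite) mform \<Rightarrow> ('a, 'n) mform" where
  "ext_d \<omega> = (\<lambda>c x I. if x \<in> chart_ran c then local_d (\<omega> c) x I else 0)"

definition closed_forms :: "('a, 'n::finite) chart set \<Rightarrow> nat \<Rightarrow> ('a, 'n) mform set" where
  "closed_forms A k = {f\<in>forms A k. ext_d f = 0}"


section \<open>The codifferential\<close>

text \<open>\<open>h = \<delta> f\<close> for a \<open>(k+1)\<close>-form \<open>f\<close> and a \<open>k\<close>-form \<open>h\<close>: the integrals of \<open>\<langle>d\<phi>, f\<rangle>\<close> and \<open>\<langle>\<phi>, h\<rangle>\<close>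
  against the metric density agree for all compactly supported smooth \<open>k\<close>-forms \<open>\<phi>\<close>. By a partition
  of unity it is enough to take \<open>\<phi>\<close> with compact support in the domain of one chart. Such a form
  is the same as a compactly supported form on the range of the chart, and the integral over the
  manifold is the coordinate integral; no orientation is needed.\<close>

definition adjoint_pair ::
  "('a, 'n::finite) chart set \<Rightarrow> ('a, 'n) metric \<Rightarrow> nat \<Rightarrow> ('a, 'n) mform \<Rightarrow> ('a, 'n) mform \<Rightarrow> bool"
where
  "adjoint_pair A g k f h \<longleftrightarrow>
     (\<forall>c\<in>A. \<forall>\<phi>\<in>test_forms (chart_ran c) k.
        integral (chart_ran c)
          (\<lambda>x. form_pairing (g c x) (Suc k) (local_d \<phi> x) (f c x) * sqrt \<bar>det (g c x)\<bar>) =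
        integral (chart_ran c)
          (\<lambda>x. form_pairing (g c x) k (\<phi> x) (h c x) * sqrt \<bar>det (g c x)\<bar>))"

text \<open>\<open>codiff A g k\<close> is \<open>\<delta>\<close> on \<open>k\<close>-forms; there are no forms of degree \<open>-1\<close>, so it is \<open>0\<close> on functions.\<close>

definition codiff ::
  "('a, 'n::finite) chart set \<Rightarrow> ('a, 'n) metric \<Rightarrow> nat \<Rightarrow> ('a, 'n) mform \<Rightarrow> ('a, 'n) mform" where
  "codiff A g k f =
     (case k of 0 \<Rightarrow> 0 | Suc j \<Rightarrow> (THE h. h \<in> forms A j \<and> adjoint_pair A g j f h))"


section \<open>The operators and spaces of the decomposition\<close>

definition G_factor ::
  "('a, 'n::finite) chart set \<Rightarrow> ('a, 'n) metric \<Rightarrow> real \<Rightarrow> nat \<Rightarrow> nat \<Rightarrow> ('a, 'n) mform \<Rightarrow> ('a, 'n) mform"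
where
  "G_factor A g J k i f = ext_d (codiff A g k f) +
     scale_form (2 * real i * (real CARD('n) - 2 * real k - real i + 1) / real CARD('n) * J) f"

definition G_op ::
  "('a, 'n::finite) chart set \<Rightarrow> ('a, 'n) metric \<Rightarrow> real \<Rightarrow> nat \<Rightarrow> ('a, 'n) mform \<Rightarrow> ('a, 'n) mform"
where
  "G_op A g J k =
     codiff A g k \<circ> foldr (\<circ>) (map (G_factor A g J k) [1..<Suc ((CARD('n) - 2 * k) div 2)]) id"

definition H_G ::
  "('a, 'n::finite) chart set \<Rightarrow> ('a, 'n) metric \<Rightarrow> real \<Rightarrow> nat \<Rightarrow> ('a, 'n) mform set" where
  "H_G A g J k = {f\<in>closed_forms A k. G_op A g J k f = 0}"

definition H_sigma ::
  "('a, 'n::finite) chart set \<Rightarrow> ('a, 'n) metric \<Rightarrow> nat \<Rightarrow> ('a, 'n) mform set" where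
  "H_sigma A g k = {f\<in>forms A k. ext_d f = 0 \<and> codiff A g k f = 0}"

definition H_bar ::
  "('a, 'n::finite) chart set \<Rightarrow> ('a, 'n) metric \<Rightarrow> nat \<Rightarrow> real \<Rightarrow> ('a, 'n) mform set" where
  "H_bar A g k \<mu> = {f\<in>forms A k. ext_d (codiff A g k f) = scale_form \<mu> f}"

definition eigval :: "nat \<Rightarrow> nat \<Rightarrow> real \<Rightarrow> nat \<Rightarrow> real" where
  "eigval n k J i = - (2 * real i * (real n - 2 * real k - real i + 1) / real n * J)"

text \<open>\<open>V\<close> is the internal direct sum of the linear subspaces \<open>W i\<close>, \<open>i \<in> I\<close> (\<open>I\<close> finite): summation is a
  bijection from the product of the \<open>W i\<close> onto \<open>V\<close>.\<close>

definition internal_direct_sum ::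
  "'i set \<Rightarrow> ('i \<Rightarrow> ('a, 'n) mform set) \<Rightarrow> ('a, 'n) mform set \<Rightarrow> bool" where
  "internal_direct_sum I W V \<longleftrightarrow>
     (\<forall>i\<in>I. module.subspace scale_form (W i)) \<and>
     bij_betw (\<lambda>u. \<Sum>i\<in>I. u i) (Pi\<^sub>E I W) V"

end

theory Submission
  imports Defs
begin

text \<open>
  The operator \<open>D = d \<delta>\<close> maps \<open>k\<close>-forms to closed \<open>k\<close>-forms, and \<open>G\<^sub>k\<close> is the restriction to closed forms of \<open>\<delta> Q\<close> with
  \<open>Q = (D - \<lambda>\<^sub>1) \<dots> (D - \<lambda>\<^sub>p)\<close>. Since \<open>n - 2 k = 2 p\<close>, the eigenvalue \<open>\<lambda>\<^sub>i\<close> is a multiple of \<open>i (2 p - i + 1) J\<close>, and as the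
  manifold is not Ricci flat, \<open>J \<noteq> 0\<close>; hence \<open>0, \<lambda>\<^sub>1, \<dots>, \<lambda>\<^sub>p\<close> are pairwise distinct (\<open>eigval_inj\<close>,
  \<open>schouten_trace_nonzero\<close>). The theorem is then linear algebra in the spirit of the theorem on coprime factors.
  If \<open>f\<close> is closed with \<open>\<delta> Q f = 0\<close>, then \<open>h = Q f\<close> is closed and coclosed, so \<open>D h = 0\<close> and \<open>Q h = c h\<close> with \<open>c \<noteq> 0\<close>;
  thus \<open>f - h / c\<close> is killed by \<open>Q\<close> and splits further into eigenforms of \<open>D\<close>
  (\<open>split_off_eigenvector\<close>, \<open>eigenvector_decomposition\<close>). Conversely eigenforms for nonzero eigenvalues are closed, and sums of
  eigenforms for distinct eigenvalues are direct (\<open>eigenvectors_independent\<close>).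

  This argument presupposes that \<open>d\<close> and \<open>\<delta>\<close> are linear operators between spaces of forms with \<open>d d = 0\<close>, and
  most of the text establishes this. The codifferential is given only as the formal adjoint of \<open>d\<close>, so its existence,
  uniqueness and linearity have to be shown. In a chart, \<open>\<delta> \<omega>\<close> is minus the divergence of the
  raised form, lowered again; integration by parts shows that it is adjoint to \<open>d\<close> (\<open>local_codiff_adjoint\<close>), and bump functions show that
  the adjoint is unique (\<open>test_forms_separate\<close>).

  It remains to see that \<open>d\<close> and the coordinate formula for \<open>\<delta>\<close> are compatible with changes of coordinates. Both facts
  rest on one observation (\<open>pullback_pairing\<close>): the second derivatives of the coordinate change are symmetric and cancel
  when they are contracted with an alternating tensor. For \<open>d\<close> this gives naturality under pullback
  (\<open>local_d_pullback\<close>). For \<open>\<delta>\<close> it reduces the claim to the invariance of the divergence of a vector field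
  (\<open>divergence_coordinate_change\<close>), which follows from the formula of Jacobi for the derivative of a
  determinant; no change of variables in integrals is involved.
\<close>

section \<open>Partial derivatives and smooth functions\<close>

lemma partial_eq_derivative:
  "(f has_derivative f') (at x) \<Longrightarrow> partial i f x = f' (axis i 1)"
  unfolding partial_def using frechet_derivative_at by fastforce

lemma has_derivative_partials:
  fixes f :: "real^'n::finite \<Rightarrow> real"
  assumes "f differentiable (at x)"
  shows "(f has_derivative (\<lambda>v. \<Sum>a\<in>UNIV. v $ a * partial a f x)) (at x)"
proof -
  have d: "(f has_derivative frechet_derivative f (at x)) (at x)"
    using assms frechet_derivative_works by blast
  have "frechet_derivative f (at x) v = (\<Sum>a\<in>UNIV. v $ a * partial a f x)" for v
  proof -
    have l: "linear (frechet_derivative f (at x))"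
      using assms linear_frechet_derivative by blast
    have "v = (\<Sum>a\<in>UNIV. v $ a *\<^sub>R axis a 1)"
      by (simp add: vec_eq_iff axis_def if_distrib[where f="\<lambda>u. _ * u"] cong: if_cong)
    then have "frechet_derivative f (at x) v = frechet_derivative f (at x) (\<Sum>a\<in>UNIV. v $ a *\<^sub>R axis a 1)"
      by simp
    then show ?thesis
      using l by (simp add: linear_sum linear_cmul partial_def)
  qed
  then have "frechet_derivative f (at x) = (\<lambda>v. \<Sum>a\<in>UNIV. v $ a * partial a f x)"
    by blast
  then show ?thesis using d by simp
qed

lemma partial_const [simp]: "partial i (\<lambda>x. c) x = 0"
  by (rule partial_eq_derivative[where f'="\<lambda>v. 0", THEN trans]) auto

lemma partial_add:
  assumes "f differentiable (at x)" "g differentiable (at x)"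
  shows "partial i (\<lambda>y. f y + g y) x = partial i f x + partial i g x"
  using has_derivative_add[OF has_derivative_partials[OF assms(1)] has_derivative_partials[OF assms(2)]]
  by (subst partial_eq_derivative, assumption)
     (simp add: axis_def if_distrib[where f="\<lambda>u. u * _"] cong: if_cong)

lemma partial_mult:
  assumes "f differentiable (at x)" "g differentiable (at x)"
  shows "partial i (\<lambda>y. f y * g y) x = f x * partial i g x + partial i f x * g x"
  using has_derivative_mult[OF has_derivative_partials[OF assms(1)] has_derivative_partials[OF assms(2)]]
  by (subst partial_eq_derivative, assumption)
     (simp add: axis_def if_distrib[where f="\<lambda>u. u * _"] cong: if_cong)

lemma partial_cmult:
  assumes "f differentiable (at x)"
  shows "partial i (\<lambda>y. c * f y) x = c * partial i f x"
  using partial_mult[of "\<lambda>_. c", OF _ assms] by simp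

lemma partial_minus:
  assumes "f differentiable (at x)"
  shows "partial i (\<lambda>y. - f y) x = - partial i f x"
  using partial_cmult[OF assms, of i "-1"] by simp

lemma partial_diff:
  assumes "f differentiable (at x)" "g differentiable (at x)"
  shows "partial i (\<lambda>y. f y - g y) x = partial i f x - partial i g x"
  using partial_add[OF assms(1) differentiable_minus[OF assms(2)], of i] partial_minus[OF assms(2), of i]
  by simp

lemma partial_sum:
  assumes "finite S" "\<And>s. s \<in> S \<Longrightarrow> f s differentiable (at x)"
  shows "partial i (\<lambda>y. \<Sum>s\<in>S. f s y) x = (\<Sum>s\<in>S. partial i (f s) x)"
  using assms
proof (induction S rule: finite_induct)
  case (insert s S)
  have "(\<lambda>y. \<Sum>s\<in>S. f s y) differentiable (at x)"
    using insert by (intro differentiable_sum) auto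
  then show ?case using insert by (simp add: partial_add)
qed simp

text \<open>Charts only determine functions on open sets, so every pointwise identity has to be
  transported along local equality before it can be differentiated.\<close>

lemma partial_transfer:
  assumes "open V" "x \<in> V" "\<And>y. y \<in> V \<Longrightarrow> f y = g y"
  shows "partial i f x = partial i g x" and "f differentiable (at x) \<longleftrightarrow> g differentiable (at x)"
proof -
  have *: "(f has_derivative D) (at x) \<longleftrightarrow> (g has_derivative D) (at x)" for D
    using assms has_derivative_transform_within_open[of f D x UNIV V g]
      has_derivative_transform_within_open[of g D x UNIV V f] by auto
  then show "partial i f x = partial i g x"
    by (simp add: partial_def frechet_derivative_def)
  show "f differentiable (at x) \<longleftrightarrow> g differentiable (at x)"
    using * by (simp add: differentiable_def)
qed

lemma has_derivative_components:
  fixes T :: "real^'m::finite \<Rightarrow> real^'n::finite"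
  assumes "\<And>a. (\<lambda>x. T x $ a) differentiable (at x)"
  shows "(T has_derivative (\<lambda>v. \<chi> a. \<Sum>b\<in>UNIV. v $ b * partial b (\<lambda>x. T x $ a) x)) (at x)"
proof (subst has_derivative_componentwise_within, intro ballI)
  fix u :: "real^'n" assume "u \<in> Basis"
  then obtain a where u: "u = axis a 1" by (auto simp: Basis_vec_def)
  show "((\<lambda>x. T x \<bullet> u) has_derivative
      (\<lambda>v. (\<chi> a. \<Sum>b\<in>UNIV. v $ b * partial b (\<lambda>x. T x $ a) x) \<bullet> u)) (at x)"
    using has_derivative_partials[OF assms[of a]] by (simp add: u inner_axis)
qed

lemma partial_chain:
  fixes T :: "real^'m::finite \<Rightarrow> real^'n::finite"
  assumes "\<And>a. (\<lambda>x. T x $ a) differentiable (at x)" "f differentiable (at (T x))"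
  shows "partial i (\<lambda>x. f (T x)) x = (\<Sum>a\<in>UNIV. partial i (\<lambda>x. T x $ a) x * partial a f (T x))"
    and "(\<lambda>x. f (T x)) differentiable (at x)"
proof -
  have d: "((\<lambda>x. f (T x)) has_derivative (\<lambda>v. \<Sum>a\<in>UNIV. (\<chi> a. \<Sum>b\<in>UNIV. v $ b * partial b (\<lambda>x. T x $ a) x) $ a * partial a f (T x))) (at x)"
    using diff_chain_at[OF has_derivative_components[OF assms(1)] has_derivative_partials[OF assms(2)]]
    by (simp add: o_def)
  show "partial i (\<lambda>x. f (T x)) x = (\<Sum>a\<in>UNIV. partial i (\<lambda>x. T x $ a) x * partial a f (T x))"
    by (subst partial_eq_derivative[OF d])
       (simp add: axis_def if_distrib[where f="\<lambda>u. u * _"] cong: if_cong)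
  show "(\<lambda>x. f (T x)) differentiable (at x)" using d differentiableI by blast
qed

lemma partial_real_chain:
  fixes F :: "real \<Rightarrow> real"
  assumes "(F has_real_derivative F') (at (q x))" "q differentiable (at x)"
  shows "partial i (\<lambda>x. F (q x)) x = F' * partial i q x"
    and "(\<lambda>x. F (q x)) differentiable (at x)"
proof -
  have d: "((\<lambda>x. F (q x)) has_derivative (\<lambda>v. F' * (\<Sum>a\<in>UNIV. v $ a * partial a q x))) (at x)"
    using diff_chain_at[OF has_derivative_partials[OF assms(2)]] assms(1)
    by (simp add: o_def has_field_derivative_def)
  show "partial i (\<lambda>x. F (q x)) x = F' * partial i q x"
    by (subst partial_eq_derivative[OF d])
       (simp add: axis_def if_distrib[where f="\<lambda>u. u * _"] cong: if_cong)
  show "(\<lambda>x. F (q x)) differentiable (at x)" using d differentiableI by blast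
qed

lemma partial_coordinate: "partial i (\<lambda>x. x $ j) x = (if i = j then 1 else 0)"
  by (subst partial_eq_derivative[where f'="\<lambda>v. v $ j"])
     (auto intro: derivative_eq_intros bounded_linear.has_derivative bounded_linear_vec_nth simp: axis_def)

lemma Ck_on_cong:
  assumes "open V"
  shows "(\<And>x. x \<in> V \<Longrightarrow> f x = g x) \<Longrightarrow> Ck_on m V f \<longleftrightarrow> Ck_on m V g"
proof (induction m arbitrary: f g)
  case 0
  then show ?case by (simp cong: continuous_on_cong)
next
  case (Suc m)
  have "Ck_on m V (partial i f) \<longleftrightarrow> Ck_on m V (partial i g)" for i
    using assms Suc.prems by (intro Suc.IH) (auto intro: partial_transfer)
  moreover have "(\<forall>x\<in>V. f differentiable (at x)) \<longleftrightarrow> (\<forall>x\<in>V. g differentiable (at x))"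
    using partial_transfer(2)[OF assms] Suc.prems by (metis (no_types, lifting))
  ultimately show ?case by simp
qed

lemma Ck_on_SucD: "Ck_on (Suc m) V f \<Longrightarrow> Ck_on m V f"
proof (induction m arbitrary: f)
  case 0
  then show ?case
    by (auto intro!: continuous_at_imp_continuous_on differentiable_imp_continuous_within)
next
  case (Suc m)
  then show ?case by simp
qed

lemma Ck_on_const: "Ck_on m V (\<lambda>x. c)"
proof (induction m arbitrary: c)
  case (Suc m)
  moreover have "partial i (\<lambda>x. c) = (\<lambda>x. 0)" for i :: 'a by auto
  ultimately show ?case by simp
qed simp

lemma Ck_on_add:
  assumes "open V"
  shows "Ck_on m V f \<Longrightarrow> Ck_on m V g \<Longrightarrow> Ck_on m V (\<lambda>x. f x + g x)"
proof (induction m arbitrary: f g)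
  case 0
  then show ?case by (auto intro: continuous_on_add)
next
  case (Suc m)
  have "Ck_on m V (partial i (\<lambda>x. f x + g x))" for i
    by (subst Ck_on_cong[OF assms, where g="\<lambda>x. partial i f x + partial i g x"])
       (use Suc in \<open>auto simp: partial_add\<close>)
  then show ?case using Suc.prems by simp
qed

lemma Ck_on_mult:
  assumes "open V"
  shows "Ck_on m V f \<Longrightarrow> Ck_on m V g \<Longrightarrow> Ck_on m V (\<lambda>x. f x * g x)"
proof (induction m arbitrary: f g)
  case 0
  then show ?case by (auto intro: continuous_on_mult)
next
  case (Suc m)
  have "Ck_on m V (partial i (\<lambda>x. f x * g x))" for i
  proof (subst Ck_on_cong[OF assms, where g="\<lambda>x. f x * partial i g x + partial i f x * g x"])
    show "Ck_on m V (\<lambda>x. f x * partial i g x + partial i f x * g x)"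
      using Suc.prems Ck_on_SucD[of m V f] Ck_on_SucD[of m V g]
      by (auto intro!: Ck_on_add assms Suc.IH)
  qed (use Suc.prems in \<open>auto simp: partial_mult\<close>)
  then show ?case using Suc.prems by simp
qed

lemma Ck_on_inverse:
  assumes "open V" "\<And>x. x \<in> V \<Longrightarrow> f x \<noteq> 0"
  shows "Ck_on m V f \<Longrightarrow> Ck_on m V (\<lambda>x. inverse (f x))"
proof (induction m)
  case 0
  then show ?case using assms by (auto intro: continuous_on_inverse)
next
  case (Suc m)
  have d: "\<And>x. x \<in> V \<Longrightarrow> f differentiable (at x)" using Suc.prems by simp
  have D: "(inverse has_real_derivative - (inverse (f x) * inverse (f x))) (at (f x))" if "x \<in> V" for x
    using assms(2)[OF that] by (auto intro!: derivative_eq_intros)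
  have "Ck_on m V (partial i (\<lambda>x. inverse (f x)))" for i
  proof (subst Ck_on_cong[OF assms(1),
      where g="\<lambda>x. (-1) * (inverse (f x) * inverse (f x)) * partial i f x"])
    show "Ck_on m V (\<lambda>x. (-1) * (inverse (f x) * inverse (f x)) * partial i f x)"
      using Suc Ck_on_SucD[of m V f] by (intro Ck_on_mult assms(1) Ck_on_const) auto
  qed (use partial_real_chain(1)[OF D d] in \<open>auto\<close>)
  then show ?case using partial_real_chain(2)[OF D d] by auto
qed

lemma smooth_on_cong:
  assumes "open V" "\<And>x. x \<in> V \<Longrightarrow> f x = g x"
  shows "smooth_on V f \<longleftrightarrow> smooth_on V g"
  using Ck_on_cong[OF assms(1)] assms(2) unfolding smooth_on_def by blast

lemma smooth_on_differentiable: "smooth_on V f \<Longrightarrow> x \<in> V \<Longrightarrow> f differentiable (at x)"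
  unfolding smooth_on_def by (metis Ck_on.simps(2))

lemma smooth_on_partial: "smooth_on V f \<Longrightarrow> smooth_on V (partial i f)"
  unfolding smooth_on_def by (metis Ck_on.simps(2))

lemma smooth_on_continuous: "smooth_on V f \<Longrightarrow> continuous_on V f"
  unfolding smooth_on_def by (metis Ck_on.simps(1))

lemma smooth_on_const: "smooth_on V (\<lambda>x. c)"
  by (simp add: smooth_on_def Ck_on_const)

lemma smooth_on_add: "open V \<Longrightarrow> smooth_on V f \<Longrightarrow> smooth_on V g \<Longrightarrow> smooth_on V (\<lambda>x. f x + g x)"
  by (simp add: smooth_on_def Ck_on_add)

lemma smooth_on_mult: "open V \<Longrightarrow> smooth_on V f \<Longrightarrow> smooth_on V g \<Longrightarrow> smooth_on V (\<lambda>x. f x * g x)"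
  by (simp add: smooth_on_def Ck_on_mult)

lemma smooth_on_minus: "open V \<Longrightarrow> smooth_on V f \<Longrightarrow> smooth_on V (\<lambda>x. - f x)"
  using smooth_on_mult[OF _ smooth_on_const[of V "-1"]] by simp

lemma smooth_on_inverse:
  "open V \<Longrightarrow> (\<And>x. x \<in> V \<Longrightarrow> f x \<noteq> 0) \<Longrightarrow> smooth_on V f \<Longrightarrow> smooth_on V (\<lambda>x. inverse (f x))"
  by (simp add: smooth_on_def Ck_on_inverse)

lemma smooth_on_sum:
  assumes "open V"
  shows "(\<And>s. s \<in> S \<Longrightarrow> smooth_on V (f s)) \<Longrightarrow> smooth_on V (\<lambda>x. \<Sum>s\<in>S. f s x)"
proof (induction S rule: infinite_finite_induct)
  case (insert s S)
  then show ?case by (simp add: smooth_on_add[OF assms])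
qed (simp_all add: smooth_on_const)

lemma smooth_on_prod:
  assumes "open V"
  shows "(\<And>s. s \<in> S \<Longrightarrow> smooth_on V (f s)) \<Longrightarrow> smooth_on V (\<lambda>x. \<Prod>s\<in>S. f s x)"
proof (induction S rule: infinite_finite_induct)
  case (insert s S)
  then show ?case by (simp add: smooth_on_mult[OF assms])
qed (simp_all add: smooth_on_const)

lemma Ck_on_subset: "Ck_on m V f \<Longrightarrow> W \<subseteq> V \<Longrightarrow> Ck_on m W f"
  by (induction m arbitrary: f) (auto intro: continuous_on_subset)

lemma smooth_on_subset: "smooth_on V f \<Longrightarrow> W \<subseteq> V \<Longrightarrow> smooth_on W f"
  by (auto simp: smooth_on_def intro: Ck_on_subset)

lemma smooth_on_coordinate: "smooth_on V (\<lambda>x. x $ j)"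
proof -
  have p: "partial i (\<lambda>x. x $ j) = (\<lambda>x. if i = j then 1 else 0)" for i :: 'a
    by (auto simp: partial_coordinate)
  have "Ck_on m V (\<lambda>x. x $ j)" for m
  proof (cases m)
    case 0
    then show ?thesis by (auto intro!: continuous_intros)
  next
    case (Suc l)
    have "(\<lambda>x::real^'a. x $ j) differentiable (at x)" for x
      using bounded_linear.has_derivative[OF bounded_linear_vec_nth has_derivative_ident] differentiableI by blast
    then show ?thesis using Suc by (simp add: p Ck_on_const)
  qed
  then show ?thesis by (simp add: smooth_on_def)
qed

lemma axis_mvt:
  fixes f :: "real^'n::finite \<Rightarrow> real"
  assumes "0 < h" "\<And>t. 0 \<le> t \<Longrightarrow> t \<le> h \<Longrightarrow> f differentiable (at (x + t *\<^sub>R axis i 1))"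
  obtains t where "0 < t" "t < h" "f (x + h *\<^sub>R axis i 1) - f x = h * partial i f (x + t *\<^sub>R axis i 1)"
proof -
  have D: "((\<lambda>t. f (x + t *\<^sub>R axis i 1)) has_real_derivative partial i f (x + t *\<^sub>R axis i 1)) (at t)"
    if "0 \<le> t" "t \<le> h" for t
  proof -
    have "((\<lambda>t. x + t *\<^sub>R axis i 1) has_derivative (\<lambda>s. s *\<^sub>R axis i (1::real))) (at t)"
      by (auto intro!: derivative_eq_intros)
    from diff_chain_at[OF this has_derivative_partials[OF assms(2)[OF that]]]
    show ?thesis
      by (simp add: o_def has_field_derivative_def axis_def mult.commute
          if_distrib[where f="\<lambda>u. u * _"] if_distrib[where f="\<lambda>u. _ * u"] cong: if_cong)
         (simp add: mult_commute_abs)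
  qed
  obtain t where "0 < t" "t < h"
    "f (x + h *\<^sub>R axis i 1) - f (x + 0 *\<^sub>R axis i 1) = (h - 0) * partial i f (x + t *\<^sub>R axis i 1)"
    using MVT2[OF assms(1), of "\<lambda>t. f (x + t *\<^sub>R axis i 1)" "\<lambda>t. partial i f (x + t *\<^sub>R axis i 1)"] D
    by auto
  then show ?thesis using that by simp
qed

text \<open>Both mixed derivatives are limits of the same second difference \<open>f (x + h e\<^sub>i +
  h e\<^sub>j) - f (x + h e\<^sub>i) - f (x + h e\<^sub>j) + f x\<close> divided by
  \<open>h\<^sup>2\<close>: the mean value theorem, applied once in each direction, identifies the
  quotient with a mixed derivative at a point near \<open>x\<close>, and the order of the two
  applications decides which one.\<close>

lemma partial_commute:
  fixes f :: "real^'n::finite \<Rightarrow> real"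
  assumes V: "open V" and sm: "smooth_on V f" and x: "x \<in> V"
  shows "partial i (partial j f) x = partial j (partial i f) x"
proof -
  have second_difference:
    "\<exists>z. dist z x \<le> 2 * h \<and> f (x + h *\<^sub>R axis i 1 + h *\<^sub>R axis j 1) - f (x + h *\<^sub>R axis i 1)
          - f (x + h *\<^sub>R axis j 1) + f x = h * h * partial j (partial i f) z"
    if h: "0 < h" and b: "cball x (2 * h) \<subseteq> V" for h i j
  proof -
    have inV: "x + s *\<^sub>R axis i 1 + t *\<^sub>R axis j 1 \<in> V" if "0 \<le> s" "s \<le> h" "0 \<le> t" "t \<le> h" for s t
    proof -
      have "norm (s *\<^sub>R axis i 1 + t *\<^sub>R axis j 1 :: real^'n) \<le> \<bar>s\<bar> + \<bar>t\<bar>"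
        using norm_triangle_ineq[of "s *\<^sub>R axis i 1 :: real^'n" "t *\<^sub>R axis j 1"] by simp
      then have "dist (x + s *\<^sub>R axis i 1 + t *\<^sub>R axis j 1) x \<le> 2 * h"
        using that by (simp add: dist_norm add.assoc)
      then have "x + s *\<^sub>R axis i 1 + t *\<^sub>R axis j 1 \<in> cball x (2 * h)"
        by (simp add: dist_commute)
      then show ?thesis using b by blast
    qed
    have d: "y \<in> V \<Longrightarrow> f differentiable (at y)" for y using sm smooth_on_differentiable by blast
    have sh: "(\<lambda>x. x + h *\<^sub>R axis j 1) differentiable (at y)" for y :: "real^'n"
      by (auto intro!: derivative_intros)
    have comp: "(\<lambda>x. (x + h *\<^sub>R axis j 1) $ a) differentiable (at y)" for y :: "real^'n" and a
      by (simp, intro differentiable_add differentiable_const) 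
         (rule smooth_on_differentiable[OF smooth_on_coordinate UNIV_I])
    have cd: "(\<lambda>x. x $ a) differentiable (at y)" for y :: "real^'n" and a
      using smooth_on_differentiable[OF smooth_on_coordinate UNIV_I] .
    have p1: "partial b (\<lambda>x. (x + h *\<^sub>R axis j 1) $ a) y = (if b = a then 1 else 0)" for y :: "real^'n" and a b
      using partial_add[where f="\<lambda>x. x $ a" and g="\<lambda>x. (h *\<^sub>R axis j 1) $ a" and i=b, OF cd[of a y] differentiable_const]
      by (simp only: partial_coordinate partial_const vector_add_component add_0_right)
    have shift: "partial i (\<lambda>x. f (x + h *\<^sub>R axis j 1)) y = partial i f (y + h *\<^sub>R axis j 1)"
      "(\<lambda>x. f (x + h *\<^sub>R axis j 1)) differentiable (at y)" if "y + h *\<^sub>R axis j 1 \<in> V" for y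
      using partial_chain(1)[OF comp d[OF that], of i] partial_chain(2)[OF comp d[OF that]]
      unfolding p1 by (simp_all add: if_distrib[where f="\<lambda>u. u * _"] cong: if_cong)
    define F where "F = (\<lambda>y. f (y + h *\<^sub>R axis j 1) - f y)"
    have dF: "F differentiable (at y)" "partial i F y = partial i f (y + h *\<^sub>R axis j 1) - partial i f y"
      if "y \<in> V" "y + h *\<^sub>R axis j 1 \<in> V" for y
    proof -
      show "F differentiable (at y)" "partial i F y = partial i f (y + h *\<^sub>R axis j 1) - partial i f y"
        unfolding F_def using shift[OF that(2)] d[OF that(1)]
        by (auto intro: differentiable_diff simp: partial_diff)
    qed
    obtain s where s: "0 < s" "s < h" "F (x + h *\<^sub>R axis i 1) - F x = h * partial i F (x + s *\<^sub>R axis i 1)"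
    proof (rule axis_mvt[OF h, of F x i])
      fix t assume "0 \<le> t" "t \<le> h"
      then show "F differentiable (at (x + t *\<^sub>R axis i 1))"
        using inV[of t 0] inV[of t h] h by (intro dF) auto
    qed (use that in auto)
    have e1: "partial i F (x + s *\<^sub>R axis i 1) = partial i f (x + s *\<^sub>R axis i 1 + h *\<^sub>R axis j 1) - partial i f (x + s *\<^sub>R axis i 1)"
      using inV[of s 0] inV[of s h] h s by (intro dF) auto
    obtain t where t: "0 < t" "t < h" "partial i f (x + s *\<^sub>R axis i 1 + h *\<^sub>R axis j 1) - partial i f (x + s *\<^sub>R axis i 1)
       = h * partial j (partial i f) (x + s *\<^sub>R axis i 1 + t *\<^sub>R axis j 1)"
    proof (rule axis_mvt[OF h, of "partial i f" "x + s *\<^sub>R axis i 1" j])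
      fix t assume "0 \<le> t" "t \<le> h"
      then show "partial i f differentiable (at (x + s *\<^sub>R axis i 1 + t *\<^sub>R axis j 1))"
        using inV[of s t] s smooth_on_differentiable[OF smooth_on_partial[OF sm]] by simp
    qed (use that in auto)
    have "dist (x + s *\<^sub>R axis i 1 + t *\<^sub>R axis j 1) x \<le> 2 * h"
      using norm_triangle_ineq[of "s *\<^sub>R axis i 1 :: real^'n" "t *\<^sub>R axis j 1"] s t
      by (simp add: dist_norm add.assoc)
    moreover have "f (x + h *\<^sub>R axis i 1 + h *\<^sub>R axis j 1) - f (x + h *\<^sub>R axis i 1)
          - f (x + h *\<^sub>R axis j 1) + f x = F (x + h *\<^sub>R axis i 1) - F x" by (simp add: F_def)
    ultimately show ?thesis using s t e1 by auto
  qed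
  obtain r where r: "0 < r" "cball x r \<subseteq> V" using V x open_contains_cball by blast
  \<comment> \<open>A null sequence with \<open>2 h \<le> r\<close>, as the square with side \<open>h\<close> at \<open>x\<close> reaches up to distance \<open>2 h\<close>.\<close>
  define h where "h = (\<lambda>n::nat. r / (2 * real (Suc n)))"
  have h0: "h n > 0" for n using r by (simp add: h_def)
  have hb: "cball x (2 * h n) \<subseteq> V" for n
  proof -
    have "2 * h n \<le> r" using r by (simp add: h_def field_simps)
    then show ?thesis using r(2) subset_cball by blast
  qed
  have "\<exists>z. dist z x \<le> 2 * h n \<and> f (x + h n *\<^sub>R axis i 1 + h n *\<^sub>R axis j 1) - f (x + h n *\<^sub>R axis i 1)
          - f (x + h n *\<^sub>R axis j 1) + f x = h n * h n * partial j (partial i f) z" for n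
    by (rule second_difference[OF h0 hb])
  then obtain z where z: "\<And>n. dist (z n) x \<le> 2 * h n" "\<And>n. f (x + h n *\<^sub>R axis i 1 + h n *\<^sub>R axis j 1) - f (x + h n *\<^sub>R axis i 1)
          - f (x + h n *\<^sub>R axis j 1) + f x = h n * h n * partial j (partial i f) (z n)" by metis
  have "\<exists>z. dist z x \<le> 2 * h n \<and> f (x + h n *\<^sub>R axis j 1 + h n *\<^sub>R axis i 1) - f (x + h n *\<^sub>R axis j 1)
          - f (x + h n *\<^sub>R axis i 1) + f x = h n * h n * partial i (partial j f) z" for n
    by (rule second_difference[OF h0 hb])
  then obtain y where y: "\<And>n. dist (y n) x \<le> 2 * h n" "\<And>n. f (x + h n *\<^sub>R axis j 1 + h n *\<^sub>R axis i 1) - f (x + h n *\<^sub>R axis j 1)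
          - f (x + h n *\<^sub>R axis i 1) + f x = h n * h n * partial i (partial j f) (y n)" by metis
  have eq: "partial j (partial i f) (z n) = partial i (partial j f) (y n)" for n
  proof -
    have "h n * h n * partial j (partial i f) (z n) = h n * h n * partial i (partial j f) (y n)"
      using z(2)[of n] y(2)[of n] by (simp add: algebra_simps)
    then show ?thesis using h0[of n] by simp
  qed
  have h_lim: "(\<lambda>n. 2 * h n) \<longlonglongrightarrow> 0"
  proof -
    have "(\<lambda>n. r * inverse (real (Suc n))) \<longlonglongrightarrow> r * 0"
      by (intro tendsto_intros LIMSEQ_inverse_real_of_nat)
    moreover have "2 * h n = r * inverse (real (Suc n))" for n
      by (simp add: h_def field_simps)
    ultimately show ?thesis by simp
  qed
  have lim: "z \<longlonglongrightarrow> x" if "\<And>n. dist (z n) x \<le> 2 * h n" for z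
  proof (rule metric_tendsto_imp_tendsto[OF h_lim], intro always_eventually allI)
    show "dist (z n) x \<le> dist (2 * h n) 0" for n
      using that[of n] h0[of n] by (simp add: dist_real_def)
  qed
  have cont: "isCont (partial a (partial b f)) x" for a b
    using smooth_on_continuous[OF smooth_on_partial[OF smooth_on_partial[OF sm]]] V x
      continuous_on_eq_continuous_at by blast
  have "(\<lambda>n. partial j (partial i f) (z n)) \<longlonglongrightarrow> partial j (partial i f) x"
    using isCont_tendsto_compose[OF cont lim[OF z(1)]] .
  moreover have "(\<lambda>n. partial j (partial i f) (z n)) \<longlonglongrightarrow> partial i (partial j f) x"
    unfolding eq using isCont_tendsto_compose[OF cont lim[OF y(1)]] .
  ultimately show ?thesis using LIMSEQ_unique by blast
qed

section \<open>Alternating families indexed by lists\<close>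

lemma sum_lists_Suc:
  "(\<Sum>I | length I = Suc k. F I) = (\<Sum>i\<in>(UNIV::'n::finite set). \<Sum>I | length I = k. F (i # I))"
proof -
  have "{I::'n list. length I = Suc k} = (\<lambda>(i, I). i # I) ` (UNIV \<times> {I. length I = k})"
    by (auto simp: length_Suc_conv)
  moreover have "inj_on (\<lambda>(i, I). i # I) (UNIV \<times> {I::'n list. length I = k})"
    by (auto simp: inj_on_def)
  ultimately have "(\<Sum>I | length I = Suc k. F I) = (\<Sum>(i, I)\<in>UNIV \<times> {I. length I = k}. F (i # I))"
    by (simp add: sum.reindex case_prod_unfold)
  then show ?thesis by (simp add: sum.cartesian_product)
qed

lemma sum_lists_0: "(\<Sum>I | length I = 0. F I) = F ([]::'n::finite list)"
  by simp

lemma finite_lists [simp]: "finite {I::'n::finite list. length I = k}"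
  using finite_lists_length_eq[of "UNIV :: 'n set" k] by simp

text \<open>Only neighbouring entries are exchanged: in this form the property passes to the tail of a
  list, as inductions over index lists require. Arbitrary transpositions are recovered in
  \<open>alternating_iff_swap\<close>.\<close>

definition alternating :: "('n list \<Rightarrow> real) \<Rightarrow> bool" where
  "alternating F \<longleftrightarrow> (\<forall>xs x y zs. F (xs @ x # y # zs) = - F (xs @ y # x # zs))"

lemma alternatingD: "alternating F \<Longrightarrow> F (xs @ x # y # zs) = - F (xs @ y # x # zs)"
  unfolding alternating_def by blast

lemma alternating_Cons: "alternating F \<Longrightarrow> alternating (\<lambda>I. F (x # I))"
  unfolding alternating_def by (metis append_Cons)

lemma alternating_head: "alternating F \<Longrightarrow> F (x # y # zs) = - F (y # x # zs)"
  using alternatingD[of F "[]" x y zs] by simp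

lemma alternating_zero: "alternating (\<lambda>I. 0)"
  by (simp add: alternating_def)

lemma alternating_add_cmult:
  assumes "alternating F" "alternating G"
  shows "alternating (\<lambda>I. F I + c * G I)"
  unfolding alternating_def
proof (intro allI)
  show "F (xs @ x # y # zs) + c * G (xs @ x # y # zs) = - (F (xs @ y # x # zs) + c * G (xs @ y # x # zs))"
    for xs x y zs
    using alternatingD[OF assms(1), of xs x y zs] alternatingD[OF assms(2), of xs x y zs]
    by (simp add: algebra_simps)
qed

lemma alternating_cmult: "alternating F \<Longrightarrow> alternating (\<lambda>I. c * F I)"
  using alternating_add_cmult[OF alternating_zero, of F c] by simp

lemma alternating_minus: "alternating F \<Longrightarrow> alternating (\<lambda>I. - F I)"
  using alternating_cmult[of F "-1"] by simp

lemma alternating_move: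
  assumes "alternating F"
  shows "F (xs @ x # ms @ zs) = (-1) ^ length ms * F (xs @ ms @ x # zs)"
proof (induction ms arbitrary: xs)
  case (Cons m ms)
  have "F (xs @ x # m # ms @ zs) = - F ((xs @ [m]) @ x # ms @ zs)"
    using alternatingD[OF assms, of xs x m "ms @ zs"] by simp
  then show ?case using Cons[of "xs @ [m]"] by simp
qed simp

text \<open>A transposition is realised by moving the first entry to the right past everything up to and
  including the second, and then the second back to the left: an odd number of neighbour exchanges in
  total.\<close>

lemma alternating_iff_swap:
  "alternating F \<longleftrightarrow> (\<forall>I i j. i < j \<and> j < length I \<longrightarrow> F (I[i := I ! j, j := I ! i]) = - F I)"
proof
  assume a: "alternating F"
  show "\<forall>I i j. i < j \<and> j < length I \<longrightarrow> F (I[i := I ! j, j := I ! i]) = - F I"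
  proof (intro allI impI)
    fix I :: "'a list" and i j assume ij: "i < j \<and> j < length I"
    define xs where "xs = take i I"
    define ms where "ms = take (j - Suc i) (drop (Suc i) I)"
    define zs where "zs = drop (Suc j) I"
    have len: "length xs = i" "length ms = j - Suc i" using ij by (auto simp: xs_def ms_def)
    have I: "I = xs @ I ! i # ms @ I ! j # zs"
    proof -
      have "drop (j - Suc i) (drop (Suc i) I) = I ! j # zs"
        using ij by (simp add: zs_def Cons_nth_drop_Suc)
      then have "drop (Suc i) I = ms @ I ! j # zs"
        unfolding ms_def by (metis append_take_drop_id)
      then show ?thesis
        unfolding xs_def using ij by (metis id_take_nth_drop less_trans)
    qed
    define x y where xy: "x = I ! i" "y = I ! j"
    have I': "I = xs @ x # ms @ y # zs" using I xy by simp
    have j: "j = Suc (i + length ms)" using ij len by simp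
    have sw: "I[i := y, j := x] = xs @ y # ms @ x # zs"
      unfolding I' j by (simp add: list_update_append len(1))
    have "F (xs @ x # ms @ y # zs) = (-1) ^ Suc (length ms) * F (xs @ ms @ y # x # zs)"
      using alternating_move[OF a, of xs x "ms @ [y]" zs] by simp
    also have "F (xs @ ms @ y # x # zs) = (-1) ^ length ms * F (xs @ y # ms @ x # zs)"
      using alternating_move[OF a, of xs y ms "x # zs"] by simp
    finally have "F (xs @ x # ms @ y # zs) = - F (xs @ y # ms @ x # zs)"
      by simp
    then have "F (I[i := y, j := x]) = - F I"
      using arg_cong[OF sw, of F] arg_cong[OF I', of F] by linarith
    then show "F (I[i := I ! j, j := I ! i]) = - F I"
      unfolding xy .
  qed
next
  assume s: "\<forall>I i j. i < j \<and> j < length I \<longrightarrow> F (I[i := I ! j, j := I ! i]) = - F I"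
  show "alternating F" unfolding alternating_def
  proof (intro allI)
    fix xs zs :: "'a list" and x y
    let ?I = "xs @ y # x # zs" and ?i = "length xs"
    have "?I[?i := ?I ! Suc ?i, Suc ?i := ?I ! ?i] = xs @ x # y # zs"
      by (simp add: list_update_append nth_append)
    moreover have "F (?I[?i := ?I ! Suc ?i, Suc ?i := ?I ! ?i]) = - F ?I"
      by (rule s[rule_format]) simp
    ultimately show "F (xs @ x # y # zs) = - F (xs @ y # x # zs)" by metis
  qed
qed

text \<open>Every index is contracted with the matrix \<open>M\<close>. With a Jacobian this is the
  pullback of covariant tensors, with a metric or its inverse it lowers or raises all indices. The
  recursion unfolds the sum over index lists one index at a time.\<close>

primrec transform :: "('n::finite \<Rightarrow> 'n \<Rightarrow> real) \<Rightarrow> ('n list \<Rightarrow> real) \<Rightarrow> 'n list \<Rightarrow> real" where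
  "transform M F [] = F []"
| "transform M F (i # I) = (\<Sum>a\<in>UNIV. M i a * transform M (\<lambda>J. F (a # J)) I)"

lemma transform_eq_sum:
  "length I = k \<Longrightarrow> (\<Sum>J | length J = k. (\<Prod>m<k. M (I ! m) (J ! m)) * F J) = transform M F I"
proof (induction I arbitrary: k F)
  case (Cons i I)
  then obtain l where l: "k = Suc l" "length I = l" by auto
  show ?case
    using Cons.IH[OF l(2)] l
    by (simp add: sum_lists_Suc prod.lessThan_Suc_shift mult.assoc flip: sum_distrib_left del: prod.lessThan_Suc)
qed simp

lemma transform_cong: "(\<And>J. length J = length I \<Longrightarrow> F J = G J) \<Longrightarrow> transform M F I = transform M G I"
proof (induction I arbitrary: F G)
  case (Cons i I)
  have "transform M (\<lambda>J. F (a # J)) I = transform M (\<lambda>J. G (a # J)) I" for a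
    by (rule Cons.IH) (simp add: Cons.prems)
  then show ?case by simp
qed simp

lemma transform_add: "transform M (\<lambda>J. F J + G J) I = transform M F I + transform M G I"
  by (induction I arbitrary: F G) (auto simp: algebra_simps sum.distrib)

lemma transform_cmult: "transform M (\<lambda>J. c * F J) I = c * transform M F I"
  by (induction I arbitrary: F) (auto simp: algebra_simps sum_distrib_left)

lemma transform_minus: "transform M (\<lambda>J. - F J) I = - transform M F I"
  using transform_cmult[of M "-1" F I] by simp

lemma transform_zero: "transform M (\<lambda>J. 0) I = 0"
  using transform_cmult[of M 0 "\<lambda>_. 0" I] by simp

lemma transform_sum: "finite S \<Longrightarrow> transform M (\<lambda>J. \<Sum>s\<in>S. F s J) I = (\<Sum>s\<in>S. transform M (F s) I)"
proof (induction S rule: finite_induct)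
  case empty
  then show ?case by (simp add: transform_zero)
qed (simp add: transform_add)

lemma transform_compose:
  "transform M (transform N F) I = transform (\<lambda>i b. \<Sum>a\<in>UNIV. M i a * N a b) F I"
proof (induction I arbitrary: F)
  case (Cons i I)
  have "transform M (transform N F) (i # I) =
      (\<Sum>a\<in>UNIV. M i a * (\<Sum>b\<in>UNIV. N a b * transform M (transform N (\<lambda>J. F (b # J))) I))"
    by (simp add: transform_sum transform_cmult)
  also have "\<dots> = (\<Sum>b\<in>UNIV. (\<Sum>a\<in>UNIV. M i a * N a b) * transform M (transform N (\<lambda>J. F (b # J))) I)"
    by (simp add: sum_distrib_left sum_distrib_right mult.assoc) (rule sum.swap)
  finally show ?case by (simp add: Cons)
qed simp

lemma transform_id: "transform (\<lambda>i a. if i = a then 1 else 0) F I = F I"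
  by (induction I arbitrary: F) (simp_all add: if_distrib[where f="\<lambda>u. u * _"] cong: if_cong)

lemma transform_pairing:
  "(\<Sum>I | length I = k. transform M F I * P I) =
   (\<Sum>I | length I = k. F I * transform (\<lambda>a i. M i a) P I)"
proof (induction k arbitrary: F P)
  case (Suc k)
  have "(\<Sum>I | length I = Suc k. transform M F I * P I) =
      (\<Sum>i\<in>UNIV. \<Sum>a\<in>UNIV. M i a * (\<Sum>I | length I = k. transform M (\<lambda>J. F (a # J)) I * P (i # I)))"
    by (simp add: sum_lists_Suc sum_distrib_left sum_distrib_right mult.assoc)
       (rule sum.cong[OF refl], rule sum.swap)
  also have "\<dots> = (\<Sum>a\<in>UNIV. \<Sum>i\<in>UNIV. M i a *
      (\<Sum>I | length I = k. F (a # I) * transform (\<lambda>a i. M i a) (\<lambda>J. P (i # J)) I))"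
    unfolding Suc by (rule sum.swap)
  also have "\<dots> = (\<Sum>I | length I = Suc k. F I * transform (\<lambda>a i. M i a) P I)"
    by (simp add: sum_lists_Suc sum_distrib_left ac_simps)
       (rule sum.cong[OF refl], rule sum.swap)
  finally show ?case .
qed simp

lemma alternating_transform:
  assumes "alternating F" shows "alternating (transform M F)"
proof -
  have "transform M F (xs @ x # y # zs) = - transform M F (xs @ y # x # zs)" for xs x y zs
    using assms
  proof (induction xs arbitrary: F)
    case Nil
    have n: "transform M (\<lambda>J. F (a # b # J)) zs = - transform M (\<lambda>J. F (b # a # J)) zs" for a b
      by (subst transform_minus[symmetric]) (rule transform_cong, rule alternating_head[OF Nil])
    have "transform M F (x # y # zs) =
        (\<Sum>a\<in>UNIV. \<Sum>b\<in>UNIV. M x a * M y b * transform M (\<lambda>J. F (a # b # J)) zs)"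
      by (simp add: sum_distrib_left mult.assoc)
    also have "\<dots> = (\<Sum>b\<in>UNIV. \<Sum>a\<in>UNIV. - (M y b * M x a * transform M (\<lambda>J. F (b # a # J)) zs))"
      by (subst sum.swap, intro sum.cong refl, subst n) simp
    also have "\<dots> = - transform M F (y # x # zs)"
      by (simp add: sum_negf sum_distrib_left mult.assoc)
    finally show ?case by simp
  next
    case (Cons i xs)
    show ?case using Cons.IH[OF alternating_Cons[OF Cons.prems]] by (simp add: sum_negf)
  qed
  then show ?thesis unfolding alternating_def by blast
qed

text \<open>The sum over the slots into which the first index of \<open>B\<close> can be moved, with
  alternating signs; applied to partial derivatives this is the exterior derivative.\<close>

primrec skew :: "('n \<Rightarrow> 'n list \<Rightarrow> real) \<Rightarrow> 'n list \<Rightarrow> real" where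
  "skew B [] = 0"
| "skew B (i # I) = B i I - skew (\<lambda>j J. B j (i # J)) I"

lemma skew_eq_sum:
  "(\<Sum>j<length I. (-1) ^ j * B (I ! j) (take j I @ drop (Suc j) I)) = skew B I"
proof (induction I arbitrary: B)
  case (Cons i I)
  show ?case
    unfolding skew.simps length_Cons sum.lessThan_Suc_shift Cons[symmetric]
    by (simp add: sum_negf)
qed simp

lemma skew_cong:
  "(\<And>j J. Suc (length J) = length I \<Longrightarrow> B j J = C j J) \<Longrightarrow> skew B I = skew C I"
proof (induction I arbitrary: B C)
  case (Cons i I)
  have "skew (\<lambda>j J. B j (i # J)) I = skew (\<lambda>j J. C j (i # J)) I"
    by (rule Cons.IH) (simp add: Cons.prems)
  then show ?case by (simp add: Cons.prems)
qed simp

lemma skew_add: "skew (\<lambda>j J. B j J + C j J) I = skew B I + skew C I"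
  by (induction I arbitrary: B C) auto

lemma skew_cmult: "skew (\<lambda>j J. c * B j J) I = c * skew B I"
  by (induction I arbitrary: B) (auto simp: algebra_simps)

lemma alternating_skew:
  assumes "\<And>i. alternating (B i)" shows "alternating (skew B)"
proof -
  have "skew B (xs @ x # y # zs) = - skew B (xs @ y # x # zs)" for xs x y zs
    using assms
  proof (induction xs arbitrary: B)
    case Nil
    have "skew (\<lambda>j J. B j (x # y # J)) zs = (-1) * skew (\<lambda>j J. B j (y # x # J)) zs"
      by (subst skew_cmult[symmetric], rule skew_cong, subst alternating_head[OF Nil]) simp
    then show ?case by simp
  next
    case (Cons i xs)
    have "skew (\<lambda>j J. B j (i # J)) (xs @ x # y # zs) = - skew (\<lambda>j J. B j (i # J)) (xs @ y # x # zs)"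
      by (rule Cons.IH[OF alternating_Cons[OF Cons.prems]])
    moreover have "B i (xs @ x # y # zs) = - B i (xs @ y # x # zs)"
      by (rule alternatingD[OF Cons.prems])
    ultimately show ?case by simp
  qed
  then show ?thesis unfolding alternating_def by blast
qed

text \<open>Against an alternating \<open>P\<close> each of the \<open>k + 1\<close> terms of
  \<open>skew B\<close> contributes the same amount, since moving an index of \<open>P\<close> to the
  front produces exactly the sign in front of the term. All identities for the exterior derivative below
  are checked after such a pairing, where the signs have disappeared.\<close>

lemma skew_pairing:
  fixes B :: "'n::finite \<Rightarrow> 'n list \<Rightarrow> real"
  assumes "alternating P"
  shows "(\<Sum>I | length I = Suc k. skew B I * P I) =
    real (Suc k) * (\<Sum>i\<in>UNIV. \<Sum>I | length I = k. B i I * P (i # I))"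
  using assms
proof (induction k arbitrary: B P)
  case 0
  show ?case unfolding sum_lists_Suc sum_lists_0 by simp
next
  case (Suc k)
  have "(\<Sum>I | length I = Suc (Suc k). skew B I * P I) =
      (\<Sum>i\<in>UNIV. \<Sum>I | length I = Suc k. B i I * P (i # I)) -
      (\<Sum>x\<in>UNIV. \<Sum>I | length I = Suc k. skew (\<lambda>j J. B j (x # J)) I * P (x # I))"
    by (subst sum_lists_Suc) (simp add: left_diff_distrib sum_subtractf)
  also have "(\<Sum>x\<in>UNIV. \<Sum>I | length I = Suc k. skew (\<lambda>j J. B j (x # J)) I * P (x # I)) =
      real (Suc k) * (\<Sum>x\<in>UNIV. \<Sum>i\<in>UNIV. \<Sum>I | length I = k. B i (x # I) * P (x # i # I))"
    using Suc.IH[OF alternating_Cons[OF Suc.prems]] by (simp add: sum_distrib_left)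
  also have "\<dots> = - (real (Suc k) * (\<Sum>i\<in>UNIV. \<Sum>x\<in>UNIV. \<Sum>I | length I = k. B i (x # I) * P (i # x # I)))"
  proof -
    have "(\<Sum>x\<in>UNIV. \<Sum>i\<in>UNIV. \<Sum>I | length I = k. B i (x # I) * P (x # i # I)) =
        (\<Sum>i\<in>UNIV. \<Sum>x\<in>UNIV. \<Sum>I | length I = k. - (B i (x # I) * P (i # x # I)))"
      by (subst sum.swap, intro sum.cong refl, subst alternating_head[OF Suc.prems]) simp
    then show ?thesis by (simp add: sum_negf)
  qed
  finally show ?case by (simp add: sum_lists_Suc algebra_simps)
qed

text \<open>Taking \<open>P = F - G\<close> in the hypothesis yields a vanishing sum of squares.\<close>

lemma alternating_eqI:
  assumes "alternating F" "alternating (G :: 'n::finite list \<Rightarrow> real)"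
    and "\<And>P. alternating P \<Longrightarrow> (\<Sum>I | length I = k. F I * P I) = (\<Sum>I | length I = k. G I * P I)"
    and "length I = k"
  shows "F I = G I"
proof -
  have "alternating (\<lambda>I. F I - G I)"
    using alternating_add_cmult[OF assms(1,2), of "-1"] by simp
  from assms(3)[OF this] have "(\<Sum>I | length I = k. (F I - G I) * (F I - G I)) = 0"
    by (simp add: left_diff_distrib sum_subtractf)
  then have "\<forall>I\<in>{I. length I = k}. (F I - G I) * (F I - G I) = 0"
    by (subst (asm) sum_nonneg_eq_0_iff) auto
  then show ?thesis using assms(4) by simp
qed

lemma sum_sym_alternating:
  fixes S :: "'n::finite \<Rightarrow> 'n \<Rightarrow> real"
  assumes "alternating P" "\<And>i j. S i j = S j i"
  shows "(\<Sum>i\<in>UNIV. \<Sum>j\<in>UNIV. S i j * P (i # j # I)) = 0"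
proof -
  have "(\<Sum>i\<in>UNIV. \<Sum>j\<in>UNIV. S i j * P (i # j # I)) = (\<Sum>j\<in>UNIV. \<Sum>i\<in>UNIV. S i j * P (i # j # I))"
    by (rule sum.swap)
  also have "\<dots> = - (\<Sum>j\<in>UNIV. \<Sum>i\<in>UNIV. S j i * P (j # i # I))"
    unfolding sum_negf[symmetric]
    by (intro sum.cong refl, subst alternating_head[OF assms(1)], subst assms(2)) simp
  finally show ?thesis by simp
qed

section \<open>The exterior derivative in coordinates\<close>

lemma differentiable_transform:
  assumes "\<And>i a. (\<lambda>y. M y i a) differentiable (at x)"
  shows "(\<And>J. (\<lambda>y. F y J) differentiable (at x)) \<Longrightarrow> (\<lambda>y. transform (M y) (F y) I) differentiable (at x)"
proof (induction I arbitrary: F)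
  case (Cons i I)
  then show ?case using assms by (auto intro!: differentiable_sum differentiable_mult)
qed simp

lemma smooth_on_transform:
  assumes "open V" "\<And>i a. smooth_on V (\<lambda>y. M y i a)"
  shows "(\<And>J. smooth_on V (\<lambda>y. F y J)) \<Longrightarrow> smooth_on V (\<lambda>y. transform (M y) (F y) I)"
proof (induction I arbitrary: F)
  case (Cons i I)
  then show ?case using assms by (auto intro!: smooth_on_sum smooth_on_mult)
qed simp

text \<open>Differentiating the product of Jacobians in a pullback creates second derivatives of the
  coordinate change. They are symmetric in the index of differentiation and one of the form indices and
  therefore cancel against an alternating \<open>P\<close>. This is why the exterior derivative is
  natural, and, applied to constant \<open>F\<close>, why the codifferential is as well. The induction
  peels off the first index of the form; in the remaining terms the index of differentiation is moved
  past it, which turns \<open>P\<close> into \<open>- P\<close>.\<close>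

lemma pullback_pairing:
  fixes M :: "real^'n::finite \<Rightarrow> 'n \<Rightarrow> 'n \<Rightarrow> real"
  assumes dM: "\<And>i a. (\<lambda>y. M y i a) differentiable (at x)"
    and sym: "\<And>i j a. partial i (\<lambda>y. M y j a) x = partial j (\<lambda>y. M y i a) x"
  shows "alternating P \<Longrightarrow> (\<And>J. (\<lambda>y. F y J) differentiable (at x)) \<Longrightarrow>
    (\<Sum>i\<in>UNIV. \<Sum>I | length I = k. partial i (\<lambda>y. transform (M y) (F y) I) x * P (i # I)) =
    (\<Sum>i\<in>UNIV. \<Sum>I | length I = k. transform (M x) (\<lambda>J. partial i (\<lambda>y. F y J) x) I * P (i # I))"
proof (induction k arbitrary: F P)
  case 0
  then show ?case unfolding sum_lists_0 by simp
next
  case (Suc k)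
  define t where "t = (\<lambda>a y. transform (M y) (\<lambda>J. F y (a # J)))"
  have dt: "(\<lambda>y. t a y I) differentiable (at x)" for a I
    unfolding t_def by (intro differentiable_transform dM Suc.prems)
  have pd: "partial i (\<lambda>y. transform (M y) (F y) (j # I)) x =
      (\<Sum>a\<in>UNIV. M x j a * partial i (\<lambda>y. t a y I) x + partial i (\<lambda>y. M y j a) x * t a x I)" for i j I
  proof -
    have "(\<lambda>y. transform (M y) (F y) (j # I)) = (\<lambda>y. \<Sum>a\<in>UNIV. M y j a * t a y I)"
      by (simp add: t_def)
    then show ?thesis
      using dM dt by (simp add: partial_sum partial_mult differentiable_mult)
  qed
  \<comment> \<open>The second derivatives of the coordinate change, contracted with \<open>P\<close>.\<close>
  have vanish: "(\<Sum>i\<in>UNIV. \<Sum>j\<in>UNIV. partial i (\<lambda>y. M y j a) x * P (i # j # I)) = 0" for a I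
    by (rule sum_sym_alternating[OF Suc.prems(1) sym])
  have altP: "alternating (\<lambda>L. - P (j # L))" for j
    by (intro alternating_minus alternating_Cons Suc.prems(1))
  have flip: "P (i # j # I) = - P (j # i # I)" for i j I
    by (rule alternating_head[OF Suc.prems(1)])
  have "(\<Sum>i\<in>UNIV. \<Sum>I | length I = Suc k. partial i (\<lambda>y. transform (M y) (F y) I) x * P (i # I)) =
      (\<Sum>i\<in>UNIV. \<Sum>j\<in>UNIV. \<Sum>I | length I = k. \<Sum>a\<in>UNIV. M x j a * partial i (\<lambda>y. t a y I) x * P (i # j # I)) +
      (\<Sum>i\<in>UNIV. \<Sum>j\<in>UNIV. \<Sum>I | length I = k. \<Sum>a\<in>UNIV. t a x I * (partial i (\<lambda>y. M y j a) x * P (i # j # I)))"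
    unfolding sum_lists_Suc pd
    by (simp add: sum_distrib_right distrib_right sum.distrib mult.assoc mult.left_commute)
  also have "(\<Sum>i\<in>UNIV. \<Sum>j\<in>UNIV. \<Sum>I | length I = k. \<Sum>a\<in>UNIV. t a x I * (partial i (\<lambda>y. M y j a) x * P (i # j # I))) =
      (\<Sum>I | length I = k. \<Sum>a\<in>UNIV. t a x I * (\<Sum>i\<in>UNIV. \<Sum>j\<in>UNIV. partial i (\<lambda>y. M y j a) x * P (i # j # I)))"
  proof -
    have "(\<Sum>i\<in>UNIV. \<Sum>j\<in>UNIV. \<Sum>I | length I = k. \<Sum>a\<in>UNIV. h i j I a) =
        (\<Sum>I | length I = k. \<Sum>a\<in>UNIV. \<Sum>i\<in>UNIV. \<Sum>j\<in>UNIV. h i j I a)" for h :: "'n \<Rightarrow> 'n \<Rightarrow> 'n list \<Rightarrow> 'n \<Rightarrow> real"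
      by (subst (2) sum.swap, subst (3) sum.swap, subst sum.swap, rule sum.cong[OF refl], subst sum.swap, rule refl)
    then show ?thesis by (simp add: sum_distrib_left)
  qed
  also have "\<dots> = 0" unfolding vanish by simp
  also have "(\<Sum>i\<in>UNIV. \<Sum>j\<in>UNIV. \<Sum>I | length I = k. \<Sum>a\<in>UNIV. M x j a * partial i (\<lambda>y. t a y I) x * P (i # j # I)) =
      (\<Sum>j\<in>UNIV. \<Sum>a\<in>UNIV. M x j a * (\<Sum>i\<in>UNIV. \<Sum>I | length I = k. partial i (\<lambda>y. t a y I) x * - P (j # i # I)))"
  proof -
    have "(\<Sum>i\<in>UNIV. \<Sum>j\<in>UNIV. \<Sum>I | length I = k. \<Sum>a\<in>UNIV. h i j I a) =
        (\<Sum>j\<in>UNIV. \<Sum>a\<in>UNIV. \<Sum>i\<in>UNIV. \<Sum>I | length I = k. h i j I a)" for h :: "'n \<Rightarrow> 'n \<Rightarrow> 'n list \<Rightarrow> 'n \<Rightarrow> real"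
      by (subst (3) sum.swap, subst sum.swap, rule sum.cong[OF refl], subst sum.swap, rule refl)
    moreover have "(\<Sum>i\<in>UNIV. \<Sum>j\<in>UNIV. \<Sum>I | length I = k. \<Sum>a\<in>UNIV. M x j a * partial i (\<lambda>y. t a y I) x * P (i # j # I)) =
        (\<Sum>i\<in>UNIV. \<Sum>j\<in>UNIV. \<Sum>I | length I = k. \<Sum>a\<in>UNIV. M x j a * partial i (\<lambda>y. t a y I) x * - P (j # i # I))"
      by (intro sum.cong refl arg_cong2[where f="(*)"] flip)
    ultimately show ?thesis by (simp add: sum_distrib_left mult.assoc)
  qed
  also have "\<dots> = (\<Sum>j\<in>UNIV. \<Sum>a\<in>UNIV. M x j a * (\<Sum>i\<in>UNIV. \<Sum>I | length I = k.
      transform (M x) (\<lambda>J. partial i (\<lambda>y. F y (a # J)) x) I * - P (j # i # I)))"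
    unfolding t_def by (simp only: Suc.IH[OF altP Suc.prems(2)])
  also have "\<dots> = (\<Sum>i\<in>UNIV. \<Sum>I | length I = Suc k. transform (M x) (\<lambda>J. partial i (\<lambda>y. F y J) x) I * P (i # I))"
  proof -
    have "(\<Sum>i\<in>UNIV. \<Sum>j\<in>UNIV. \<Sum>I | length I = k. \<Sum>a\<in>UNIV. h i j I a) =
        (\<Sum>j\<in>UNIV. \<Sum>a\<in>UNIV. \<Sum>i\<in>UNIV. \<Sum>I | length I = k. h i j I a)" for h :: "'n \<Rightarrow> 'n \<Rightarrow> 'n list \<Rightarrow> 'n \<Rightarrow> real"
      by (subst (3) sum.swap, subst sum.swap, rule sum.cong[OF refl], subst sum.swap, rule refl)
    note this[symmetric]
    moreover have "- P (j # i # I) = P (i # j # I)" for i j I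
      by (subst flip) simp
    ultimately show ?thesis
      unfolding sum_lists_Suc by (simp add: sum_distrib_left sum_distrib_right mult.assoc)
  qed
  finally show ?case by simp
qed

lemma local_d_eq_skew: "local_d \<omega> x = skew (\<lambda>i J. partial i (\<lambda>y. \<omega> y J) x)"
  unfolding local_d_def skew_eq_sum[symmetric] fun_eq_iff by blast

lemma local_formsD:
  assumes "\<omega> \<in> local_forms V k"
  shows "x \<notin> V \<Longrightarrow> \<omega> x I = 0" "length I \<noteq> k \<Longrightarrow> \<omega> x I = 0" "smooth_on V (\<lambda>x. \<omega> x I)"
    "alternating (\<omega> x)"
  using assms unfolding local_forms_def alternating_iff_swap by blast+

lemma local_formsI:
  assumes "\<And>x I. x \<notin> V \<Longrightarrow> \<omega> x I = 0" "\<And>x I. length I \<noteq> k \<Longrightarrow> \<omega> x I = 0"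
    "\<And>I. smooth_on V (\<lambda>x. \<omega> x I)" "\<And>x. alternating (\<omega> x)"
  shows "\<omega> \<in> local_forms V k"
  using assms unfolding local_forms_def alternating_iff_swap by blast

lemma alternating_partial:
  assumes "\<And>y. alternating (\<omega> y)" "\<And>I. (\<lambda>y. \<omega> y I) differentiable (at x)"
  shows "alternating (\<lambda>I. partial i (\<lambda>y. \<omega> y I) x)"
  unfolding alternating_def
proof (intro allI)
  fix xs u v zs
  have "(\<lambda>y. \<omega> y (xs @ u # v # zs)) = (\<lambda>y. - \<omega> y (xs @ v # u # zs))"
    using alternatingD[OF assms(1)] by blast
  then show "partial i (\<lambda>y. \<omega> y (xs @ u # v # zs)) x = - partial i (\<lambda>y. \<omega> y (xs @ v # u # zs)) x"
    by (simp only: partial_minus[OF assms(2)])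
qed

lemma smooth_on_local_d:
  assumes V: "open V" and sm: "\<And>I. smooth_on V (\<lambda>y. \<omega> y I)"
  shows "smooth_on V (\<lambda>x. local_d \<omega> x I)"
  unfolding local_d_def
  by (intro smooth_on_sum smooth_on_mult smooth_on_const V smooth_on_partial sm)

lemma local_d_local_forms:
  assumes V: "open V" and om: "\<omega> \<in> local_forms V k"
  shows "(\<lambda>x I. if x \<in> V then local_d \<omega> x I else 0) \<in> local_forms V (Suc k)"
proof (rule local_formsI)
  show "(if x \<in> V then local_d \<omega> x I else 0) = 0" if "length I \<noteq> Suc k" for x I
  proof -
    have "\<omega> y (take j I @ drop (Suc j) I) = 0" if "j < length I" for y j
      using \<open>length I \<noteq> Suc k\<close> that by (intro local_formsD(2)[OF om]) auto
    then show ?thesis by (simp add: local_d_def)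
  qed
  show "smooth_on V (\<lambda>x. if x \<in> V then local_d \<omega> x I else 0)" for I
    using smooth_on_local_d[OF V local_formsD(3)[OF om]]
    by (subst smooth_on_cong[OF V]) auto
  show "alternating (\<lambda>I. if x \<in> V then local_d \<omega> x I else 0)" for x
  proof (cases "x \<in> V")
    case True
    have "alternating (skew (\<lambda>i J. partial i (\<lambda>y. \<omega> y J) x))"
      by (intro alternating_skew alternating_partial local_formsD(4)[OF om]
          smooth_on_differentiable[OF local_formsD(3)[OF om] True])
    then show ?thesis using True by (simp add: local_d_eq_skew)
  qed (simp add: alternating_zero)
qed simp

lemma local_d_pairing:
  assumes "alternating P"
  shows "(\<Sum>I | length I = Suc k. local_d \<omega> x I * P I) =
    real (Suc k) * (\<Sum>i\<in>UNIV. \<Sum>I | length I = k. partial i (\<lambda>y. \<omega> y I) x * P (i # I))"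
  unfolding local_d_eq_skew by (rule skew_pairing[OF assms])

lemma local_d_transfer:
  assumes "open V" "x \<in> V" "\<And>y J. y \<in> V \<Longrightarrow> Suc (length J) = length I \<Longrightarrow> \<omega> y J = \<eta> y J"
  shows "local_d \<omega> x I = local_d \<eta> x I"
  unfolding local_d_eq_skew
  by (rule skew_cong) (rule partial_transfer(1)[OF assms(1,2)], rule assms(3), auto)

text \<open>Paired with an alternating \<open>P\<close>, the double derivative becomes a multiple of
  \<open>\<partial>\<^sub>i \<partial>\<^sub>j \<omega>\<^sub>I P\<^bsup>ijI\<^esup>\<close>, a
  symmetric matrix contracted with an alternating one.\<close>

lemma local_d_local_d:
  assumes V: "open V" and om: "\<omega> \<in> local_forms V k" and x: "x \<in> V"
  shows "local_d (\<lambda>x I. if x \<in> V then local_d \<omega> x I else 0) x I = 0"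
proof -
  let ?\<eta> = "\<lambda>x I. if x \<in> V then local_d \<omega> x I else 0"
  have eta: "?\<eta> \<in> local_forms V (Suc k)" by (rule local_d_local_forms[OF V om])
  have dd: "(\<lambda>x I. if x \<in> V then local_d ?\<eta> x I else 0) \<in> local_forms V (Suc (Suc k))"
    by (rule local_d_local_forms[OF V eta])
  have sm: "smooth_on V (\<lambda>y. \<omega> y I)" for I by (rule local_formsD(3)[OF om])
  have d1: "(\<lambda>y. local_d \<omega> y I) differentiable (at x)" for I
    by (rule smooth_on_differentiable[OF smooth_on_local_d[OF V sm] x])
  have d2: "partial j (\<lambda>y. \<omega> y I) differentiable (at x)" for j I
    by (rule smooth_on_differentiable[OF smooth_on_partial[OF sm] x])
  show ?thesis
  proof (cases "length I = Suc (Suc k)")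
    case False
    then show ?thesis using local_formsD(2)[OF dd False, of x] x by simp
  next
    case True
    have "local_d ?\<eta> x I = local_d (local_d \<omega>) x I"
      by (rule local_d_transfer[OF V x]) simp
    also have "\<dots> = 0"
    proof (rule alternating_eqI[of "local_d (local_d \<omega>) x" "\<lambda>_. 0" "Suc (Suc k)"])
      have "local_d ?\<eta> x J = local_d (local_d \<omega>) x J" for J
        by (rule local_d_transfer[OF V x]) simp
      then show "alternating (local_d (local_d \<omega>) x)"
        using local_formsD(4)[OF dd, of x] x by simp
      fix P :: "'a list \<Rightarrow> real" assume P: "alternating P"
      have "(\<Sum>I | length I = Suc k. partial i (\<lambda>y. local_d \<omega> y I) x * P (i # I)) =
          real (Suc k) * (\<Sum>j\<in>UNIV. \<Sum>I | length I = k. partial i (partial j (\<lambda>y. \<omega> y I)) x * P (i # j # I))" for i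
      proof -
        have "(\<Sum>I | length I = Suc k. partial i (\<lambda>y. local_d \<omega> y I) x * P (i # I)) =
            partial i (\<lambda>y. \<Sum>I | length I = Suc k. P (i # I) * local_d \<omega> y I) x"
          using d1 by (simp add: partial_sum partial_cmult differentiable_mult mult.commute[of _ "P _"])
        also have "(\<lambda>y. \<Sum>I | length I = Suc k. P (i # I) * local_d \<omega> y I) =
            (\<lambda>y. real (Suc k) * (\<Sum>j\<in>UNIV. \<Sum>I | length I = k. P (i # j # I) * partial j (\<lambda>y. \<omega> y I) y))"
          using local_d_pairing[OF alternating_Cons[OF P]] by (simp add: mult.commute fun_eq_iff del: of_nat_Suc)
        also have "partial i \<dots> x =
            real (Suc k) * (\<Sum>j\<in>UNIV. \<Sum>I | length I = k. P (i # j # I) * partial i (partial j (\<lambda>y. \<omega> y I)) x)"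
          using d2 by (simp add: partial_sum partial_cmult differentiable_mult differentiable_sum del: of_nat_Suc)
        finally show ?thesis by (simp add: mult.commute)
      qed
      moreover have "(\<Sum>i\<in>UNIV. \<Sum>j\<in>UNIV. \<Sum>I | length I = k. partial i (partial j (\<lambda>y. \<omega> y I)) x * P (i # j # I)) = 0"
      proof -
        have "(\<Sum>i\<in>UNIV. \<Sum>j\<in>UNIV. \<Sum>I | length I = k. partial i (partial j (\<lambda>y. \<omega> y I)) x * P (i # j # I)) =
          (\<Sum>I | length I = k. \<Sum>i\<in>UNIV. \<Sum>j\<in>UNIV. partial i (partial j (\<lambda>y. \<omega> y I)) x * P (i # j # I))"
          by (subst (2) sum.swap, subst sum.swap, rule refl)
        also have "\<dots> = 0"
          using sum_sym_alternating[OF P partial_commute[OF V sm x]] by simp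
        finally show ?thesis .
      qed
      ultimately show "(\<Sum>I | length I = Suc (Suc k). local_d (local_d \<omega>) x I * P I) = (\<Sum>I | length I = Suc (Suc k). 0 * P I)"
        unfolding local_d_pairing[OF P] by (simp flip: sum_distrib_left del: of_nat_Suc)
    qed (simp_all add: alternating_zero True)
    finally show ?thesis .
  qed
qed

text \<open>The first index belongs to the source coordinates, so that this matrix acts on covariant
  tensors by \<open>transform\<close>.\<close>

definition coord_jacobian :: "(real^'n::finite \<Rightarrow> real^'n) \<Rightarrow> real^'n \<Rightarrow> 'n \<Rightarrow> 'n \<Rightarrow> real" where
  "coord_jacobian T x i a = partial i (\<lambda>y. T y $ a) x"

lemma smooth_on_coord_jacobian: "smooth_on V (\<lambda>x. T x $ a) \<Longrightarrow> smooth_on V (\<lambda>x. coord_jacobian T x i a)"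
  unfolding coord_jacobian_def by (rule smooth_on_partial)

lemma coord_jacobian_symmetric:
  assumes "open V" "smooth_on V (\<lambda>x. T x $ a)" "x \<in> V"
  shows "partial i (\<lambda>y. coord_jacobian T y j a) x = partial j (\<lambda>y. coord_jacobian T y i a) x"
  unfolding coord_jacobian_def using partial_commute[OF assms] .

text \<open>Both sides are alternating, so it is enough to pair them with an alternating
  \<open>P\<close>. On the left \<open>pullback_pairing\<close> removes the second derivatives of
  \<open>T\<close> and the chain rule turns the remaining index of differentiation into one more index
  contracted with the Jacobian; transferring all Jacobians to \<open>P\<close> gives the right-hand
  side.\<close>

lemma local_d_pullback:
  fixes T :: "real^'n::finite \<Rightarrow> real^'n"
  assumes V: "open V" and W: "T ` V \<subseteq> W" and T: "\<And>a. smooth_on V (\<lambda>x. T x $ a)"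
    and om: "\<And>y. alternating (\<omega> y)" "\<And>I. smooth_on V (\<lambda>y. \<omega> y I)"
    and om': "\<And>y. alternating (\<omega>' y)" "\<And>I. smooth_on W (\<lambda>y. \<omega>' y I)"
    and pull: "\<And>y J. y \<in> V \<Longrightarrow> length J = k \<Longrightarrow> \<omega> y J = transform (coord_jacobian T y) (\<omega>' (T y)) J"
    and x: "x \<in> V" and I: "length I = Suc k"
  shows "local_d \<omega> x I = transform (coord_jacobian T x) (local_d \<omega>' (T x)) I"
proof -
  have Tx: "T x \<in> W" using x W by blast
  have dT: "(\<lambda>y. T y $ a) differentiable (at x)" for a by (rule smooth_on_differentiable[OF T x])
  have dJ: "(\<lambda>y. coord_jacobian T y i a) differentiable (at x)" for i a
    by (rule smooth_on_differentiable[OF smooth_on_coord_jacobian[OF T] x])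
  have d': "(\<lambda>y. \<omega>' y I) differentiable (at (T x))" for I
    by (rule smooth_on_differentiable[OF om'(2) Tx])
  define B where "B = (\<lambda>a J. partial a (\<lambda>y. \<omega>' y J) (T x))"
  show ?thesis
  proof (rule alternating_eqI[of "local_d \<omega> x" _ "Suc k"])
    show "alternating (local_d \<omega> x)"
      unfolding local_d_eq_skew
      by (intro alternating_skew alternating_partial om smooth_on_differentiable[OF om(2) x])
    have "alternating (skew B)"
      unfolding B_def by (intro alternating_skew alternating_partial om' d')
    then show "alternating (transform (coord_jacobian T x) (local_d \<omega>' (T x)))"
      by (intro alternating_transform) (simp add: B_def local_d_eq_skew)
    fix P :: "'n list \<Rightarrow> real" assume P: "alternating P"
    define Q where "Q = transform (\<lambda>a i. coord_jacobian T x i a) P"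
    have Q: "alternating Q" unfolding Q_def by (rule alternating_transform[OF P])
    have "(\<Sum>I | length I = Suc k. local_d \<omega> x I * P I) =
      real (Suc k) * (\<Sum>i\<in>UNIV. \<Sum>I | length I = k. partial i (\<lambda>y. \<omega> y I) x * P (i # I))"
      by (rule local_d_pairing[OF P])
    also have "(\<Sum>i\<in>UNIV. \<Sum>I | length I = k. partial i (\<lambda>y. \<omega> y I) x * P (i # I)) =
      (\<Sum>i\<in>UNIV. \<Sum>I | length I = k. partial i (\<lambda>y. transform (coord_jacobian T y) (\<omega>' (T y)) I) x * P (i # I))"
      using partial_transfer(1)[OF V x pull] by (intro sum.cong refl) auto
    also have "\<dots> = (\<Sum>i\<in>UNIV. \<Sum>I | length I = k.
        transform (coord_jacobian T x) (\<lambda>J. partial i (\<lambda>y. \<omega>' (T y) J) x) I * P (i # I))"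
      by (rule pullback_pairing[OF dJ coord_jacobian_symmetric[OF V T x] P partial_chain(2)[OF dT d']])
    also have "\<dots> = (\<Sum>i\<in>UNIV. \<Sum>I | length I = k.
        (\<Sum>a\<in>UNIV. coord_jacobian T x i a * transform (coord_jacobian T x) (B a) I) * P (i # I))"
      by (simp add: partial_chain(1)[OF dT d'] transform_sum transform_cmult B_def coord_jacobian_def)
    also have "\<dots> = (\<Sum>I | length I = Suc k. transform (coord_jacobian T x) (\<lambda>J. B (hd J) (tl J)) I * P I)"
      by (simp add: sum_lists_Suc)
    also have "\<dots> = (\<Sum>I | length I = Suc k. B (hd I) (tl I) * Q I)"
      unfolding Q_def by (rule transform_pairing)
    also have "\<dots> = (\<Sum>i\<in>UNIV. \<Sum>I | length I = k. B i I * Q (i # I))"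
      by (simp add: sum_lists_Suc)
    also have "real (Suc k) * \<dots> = (\<Sum>I | length I = Suc k. local_d \<omega>' (T x) I * Q I)"
      unfolding local_d_pairing[OF Q] B_def ..
    also have "\<dots> = (\<Sum>I | length I = Suc k. transform (coord_jacobian T x) (local_d \<omega>' (T x)) I * P I)"
      unfolding Q_def by (rule transform_pairing[symmetric])
    finally show "(\<Sum>I | length I = Suc k. local_d \<omega> x I * P I) =
      (\<Sum>I | length I = Suc k. transform (coord_jacobian T x) (local_d \<omega>' (T x)) I * P I)" .
  qed (rule I)
qed

section \<open>Determinants and inverses of smooth matrices\<close>

lemma matrix_inv_both:
  fixes A :: "real^'n::finite^'n"
  assumes "invertible A"
  shows "A ** matrix_inv A = mat 1" "matrix_inv A ** A = mat 1"
  using someI_ex[OF assms[unfolded invertible_def]] unfolding matrix_inv_def by blast+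

lemma matrix_inv_unique:
  fixes A :: "real^'n::finite^'n"
  assumes "A ** B = mat 1"
  shows "matrix_inv A = B"
proof -
  have "invertible A" using assms invertible_right_inverse by blast
  then show ?thesis
    using matrix_inv_both assms by (metis matrix_mul_assoc matrix_mul_lid matrix_mul_rid)
qed

lemma matrix_mult_entry: "(A ** B) $ i $ j = (\<Sum>k\<in>UNIV. A $ i $ k * B $ k $ j)"
  by (simp add: matrix_matrix_mult_def)

lemma smooth_on_det:
  fixes A :: "real^'m::finite \<Rightarrow> real^'n::finite^'n"
  assumes "open V" "\<And>i j. smooth_on V (\<lambda>x. A x $ i $ j)"
  shows "smooth_on V (\<lambda>x. det (A x))"
  unfolding det_def by (intro smooth_on_sum smooth_on_mult smooth_on_prod smooth_on_const assms)

text \<open>By Cramer's rule the entries are rational in those of \<open>A\<close>; this is what makes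
  the inverse metric smooth.\<close>

lemma matrix_inv_cramer:
  fixes A :: "real^'n::finite^'n"
  assumes "invertible A"
  shows "matrix_inv A $ k $ l =
    det (\<chi> i j. if j = k then axis l 1 $ i else A $ i $ j) * inverse (det A)"
proof -
  have "A *v (matrix_inv A *v axis l 1) = axis l 1"
    using matrix_inv_both(1)[OF assms] by (simp add: matrix_vector_mul_assoc)
  moreover have "det A \<noteq> 0" using assms invertible_det_nz by blast
  ultimately have "matrix_inv A *v axis l 1 =
      (\<chi> k. det (\<chi> i j. if j = k then axis l 1 $ i else A $ i $ j) / det A)"
    using cramer by blast
  moreover have "(matrix_inv A *v axis l 1) $ k = matrix_inv A $ k $ l"
    by (simp add: matrix_vector_mult_def axis_def if_distrib cong: if_cong)
  ultimately show ?thesis by (simp add: divide_inverse)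
qed

lemma smooth_on_matrix_inv:
  fixes A :: "real^'m::finite \<Rightarrow> real^'n::finite^'n"
  assumes V: "open V" and sm: "\<And>i j. smooth_on V (\<lambda>x. A x $ i $ j)"
    and inv: "\<And>x. x \<in> V \<Longrightarrow> invertible (A x)"
  shows "smooth_on V (\<lambda>x. matrix_inv (A x) $ k $ l)"
proof (subst smooth_on_cong[OF V matrix_inv_cramer[OF inv]], assumption)
  have "smooth_on V (\<lambda>x. (\<chi> i j. if j = k then axis l 1 $ i else A x $ i $ j) $ i $ j)" for i j
    using sm by (cases "j = k") (simp_all add: smooth_on_const)
  then show "smooth_on V (\<lambda>x. det (\<chi> i j. if j = k then axis l 1 $ i else A x $ i $ j) * inverse (det (A x)))"
    using inv invertible_det_nz by (intro smooth_on_mult smooth_on_inverse smooth_on_det V sm) auto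
qed

lemma partial_prod:
  assumes "finite S" "\<And>s. s \<in> S \<Longrightarrow> f s differentiable (at x)"
  shows "partial i (\<lambda>y. \<Prod>s\<in>S. f s y) x = (\<Sum>s\<in>S. partial i (f s) x * (\<Prod>r\<in>S - {s}. f r x))"
    and "(\<lambda>y. \<Prod>s\<in>S. f s y) differentiable (at x)"
proof -
  have "partial i (\<lambda>y. \<Prod>s\<in>S. f s y) x = (\<Sum>s\<in>S. partial i (f s) x * (\<Prod>r\<in>S - {s}. f r x)) \<and>
      (\<lambda>y. \<Prod>s\<in>S. f s y) differentiable (at x)"
    using assms
  proof (induction S rule: finite_induct)
    case (insert s S)
    have "(\<Sum>t\<in>S. partial i (f t) x * (\<Prod>r\<in>insert s S - {t}. f r x)) =
        f s x * (\<Sum>t\<in>S. partial i (f t) x * (\<Prod>r\<in>S - {t}. f r x))"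
      unfolding sum_distrib_left
    proof (rule sum.cong[OF refl])
      fix t assume "t \<in> S"
      then have "insert s S - {t} = insert s (S - {t})" using insert by auto
      then show "partial i (f t) x * (\<Prod>r\<in>insert s S - {t}. f r x) =
          f s x * (partial i (f t) x * (\<Prod>r\<in>S - {t}. f r x))"
        using insert by simp
    qed
    then show ?case using insert by (simp add: partial_mult differentiable_mult)
  qed simp
  then show "partial i (\<lambda>y. \<Prod>s\<in>S. f s y) x = (\<Sum>s\<in>S. partial i (f s) x * (\<Prod>r\<in>S - {s}. f r x))"
    "(\<lambda>y. \<Prod>s\<in>S. f s y) differentiable (at x)" by auto
qed

lemma differentiable_det:
  fixes A :: "real^'m::finite \<Rightarrow> real^'n::finite^'n"
  assumes "\<And>i j. (\<lambda>y. A y $ i $ j) differentiable (at x)"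
  shows "(\<lambda>y. det (A y)) differentiable (at x)"
proof -
  have "(\<lambda>y. \<Prod>i\<in>UNIV. A y $ i $ p i) differentiable (at x)" for p :: "'n \<Rightarrow> 'n"
    by (rule partial_prod(2)) (simp_all add: assms)
  then show ?thesis
    unfolding det_def by (intro differentiable_sum differentiable_mult differentiable_const) simp_all
qed

lemma partial_det:
  fixes A :: "real^'m::finite \<Rightarrow> real^'n::finite^'n"
  assumes d: "\<And>i j. (\<lambda>y. A y $ i $ j) differentiable (at x)"
  shows "partial i (\<lambda>y. det (A y)) x =
    (\<Sum>j\<in>UNIV. det (\<chi> r. if r = j then (\<chi> s. partial i (\<lambda>y. A y $ j $ s) x) else row r (A x)))"
proof -
  have fin: "finite {p. p permutes (UNIV :: 'n set)}" by simp
  have dp: "(\<lambda>y. \<Prod>i\<in>UNIV. A y $ i $ p i) differentiable (at x)" for p :: "'n \<Rightarrow> 'n"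
    by (rule partial_prod(2)) (simp_all add: d)
  have pp: "partial i (\<lambda>y. \<Prod>r\<in>UNIV. A y $ r $ p r) x =
      (\<Sum>j\<in>UNIV. partial i (\<lambda>y. A y $ j $ p j) x * (\<Prod>r\<in>UNIV - {j}. A x $ r $ p r))" for p :: "'n \<Rightarrow> 'n"
    by (rule partial_prod(1)) (simp_all add: d)
  have "partial i (\<lambda>y. det (A y)) x =
      (\<Sum>p | p permutes UNIV. of_int (sign p) *
        (\<Sum>j\<in>UNIV. partial i (\<lambda>y. A y $ j $ p j) x * (\<Prod>r\<in>UNIV - {j}. A x $ r $ p r)))"
    unfolding det_def
    by (simp add: partial_sum[OF fin] differentiable_mult partial_cmult dp pp)
  also have "\<dots> = (\<Sum>j\<in>UNIV. \<Sum>p | p permutes UNIV. of_int (sign p) *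
        (partial i (\<lambda>y. A y $ j $ p j) x * (\<Prod>r\<in>UNIV - {j}. A x $ r $ p r)))"
    unfolding sum_distrib_left by (rule sum.swap)
  also have "\<dots> = (\<Sum>j\<in>UNIV. det (\<chi> r. if r = j then (\<chi> s. partial i (\<lambda>y. A y $ j $ s) x) else row r (A x)))"
  proof (rule sum.cong[OF refl])
    fix j :: 'n
    let ?B = "\<chi> r. if r = j then (\<chi> s. partial i (\<lambda>y. A y $ j $ s) x) else row r (A x)"
    have "(\<Prod>r\<in>UNIV. ?B $ r $ p r) =
        partial i (\<lambda>y. A y $ j $ p j) x * (\<Prod>r\<in>UNIV - {j}. A x $ r $ p r)" for p
      by (subst prod.remove[of _ j]) (auto simp: row_def intro!: prod.cong)
    then show "(\<Sum>p | p permutes UNIV. of_int (sign p) *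
        (partial i (\<lambda>y. A y $ j $ p j) x * (\<Prod>r\<in>UNIV - {j}. A x $ r $ p r))) = det ?B"
      unfolding det_def by simp
  qed
  finally show ?thesis .
qed

text \<open>By multilinearity the derivative of the determinant is the sum over \<open>j\<close> of
  determinants in which row \<open>j\<close> is replaced by its derivative. Written as a linear
  combination of the rows of \<open>A\<close>, that derivative contributes only through its coefficient
  at row \<open>j\<close>, which is an entry of the derivative of \<open>A\<close> times
  \<open>A\<^sup>-\<^sup>1\<close>.\<close>

lemma jacobi_formula:
  fixes A :: "real^'m::finite \<Rightarrow> real^'n::finite^'n"
  assumes d: "\<And>i j. (\<lambda>y. A y $ i $ j) differentiable (at x)" and inv: "invertible (A x)"
  shows "partial i (\<lambda>y. det (A y)) x =
    (\<Sum>j\<in>UNIV. \<Sum>b\<in>UNIV. partial i (\<lambda>y. A y $ j $ b) x * matrix_inv (A x) $ b $ j) * det (A x)"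
  unfolding partial_det[OF d]
proof (subst sum_distrib_right, rule sum.cong[OF refl])
  fix j
  let ?N = "matrix_inv (A x)"
  define u where "u = (\<chi> s. partial i (\<lambda>y. A y $ j $ s) x)"
  have "u = (u v* ?N) v* A x"
    using matrix_inv_both(2)[OF inv] by (simp add: vector_matrix_mul_assoc)
  also have "\<dots> = (\<Sum>l\<in>UNIV. (u v* ?N) $ l *s row l (A x))"
    by (simp add: vector_matrix_mult_def vec_eq_iff row_def mult.commute)
  finally have "det (\<chi> r. if r = j then u else row r (A x)) =
      det (\<chi> r. if r = j then \<Sum>l\<in>UNIV. (u v* ?N) $ l *s row l (A x) else row r (A x))"
    by (rule arg_cong[where f="\<lambda>w. det (\<chi> r. if r = j then w else row r (A x))"])
  also have "\<dots> = (u v* ?N) $ j * det (A x)" by (rule cramer_lemma_transpose)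
  also have "(u v* ?N) $ j = (\<Sum>b\<in>UNIV. partial i (\<lambda>y. A y $ j $ b) x * ?N $ b $ j)"
    by (simp add: u_def vector_matrix_mult_def)
  finally show "det (\<chi> r. if r = j then \<chi> s. partial i (\<lambda>y. A y $ j $ s) x else row r (A x)) =
      (\<Sum>b\<in>UNIV. partial i (\<lambda>y. A y $ j $ b) x * ?N $ b $ j) * det (A x)"
    unfolding u_def .
qed

section \<open>Divergence of vector fields\<close>

text \<open>The logarithmic derivative of the volume density \<open>sqrt \<bar>det G\<bar>\<close>,
  written without the absolute value so that coordinate changes need no case distinction on
  signs.\<close>

definition log_density_deriv :: "(real^'n::finite \<Rightarrow> real^'n^'n) \<Rightarrow> 'n \<Rightarrow> real^'n \<Rightarrow> real" where
  "log_density_deriv G i x = partial i (\<lambda>y. det (G y)) x / (2 * det (G x))"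

definition divergence :: "(real^'n::finite \<Rightarrow> real^'n^'n) \<Rightarrow> (real^'n \<Rightarrow> 'n \<Rightarrow> real) \<Rightarrow> real^'n \<Rightarrow> real" where
  "divergence G X x = (\<Sum>i\<in>UNIV. partial i (\<lambda>y. X y i) x + log_density_deriv G i x * X x i)"

text \<open>Differentiating \<open>X' \<circ> T = \<Sum>\<^sub>i (\<partial>\<^sub>i T)
  X\<^sup>i\<close> expresses the derivatives of \<open>X'\<close> by those of \<open>X\<close> and
  second derivatives of \<open>T\<close>, and \<open>det G = (det \<partial>T)\<^sup>2 det G' \<circ>
  T\<close> relates the logarithmic derivatives of the densities. The second derivatives of
  \<open>T\<close> enter twice, once directly and once through the formula of Jacobi for \<open>det
  \<partial>T\<close>, and cancel because partial derivatives commute.\<close>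

lemma divergence_coordinate_change:
  fixes T :: "real^'n::finite \<Rightarrow> real^'n"
  assumes V: "open V" and T: "\<And>a. smooth_on V (\<lambda>x. T x $ a)" and x: "x \<in> V"
    and G: "\<And>y. y \<in> V \<Longrightarrow> G y = (\<chi> i a. coord_jacobian T y i a) ** G' (T y) ** transpose (\<chi> i a. coord_jacobian T y i a)"
    and Gx: "invertible (G x)"
    and dG': "\<And>i j. (\<lambda>y. G' y $ i $ j) differentiable (at (T x))"
    and dX: "\<And>i. (\<lambda>y. X y i) differentiable (at x)"
    and dX': "\<And>a. (\<lambda>y. X' y a) differentiable (at (T x))"
    and X: "\<And>y a. y \<in> V \<Longrightarrow> X' (T y) a = (\<Sum>i\<in>UNIV. coord_jacobian T y i a * X y i)"
  shows "divergence G X x = divergence G' X' (T x)"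
proof -
  define M where "M = coord_jacobian T"
  define Mm where "Mm = (\<lambda>y. \<chi> i a. M y i a)"
  define N where "N = matrix_inv (Mm x)"
  define tr where "tr = (\<lambda>i. \<Sum>j\<in>UNIV. \<Sum>b\<in>UNIV. partial i (\<lambda>y. M y j b) x * N $ b $ j)"
  define \<theta>' where "\<theta>' = (\<lambda>a. log_density_deriv G' a (T x))"
  have dT: "(\<lambda>y. T y $ a) differentiable (at x)" for a by (rule smooth_on_differentiable[OF T x])
  have dM: "(\<lambda>y. M y i a) differentiable (at x)" for i a
    unfolding M_def by (rule smooth_on_differentiable[OF smooth_on_coord_jacobian[OF T] x])
  have dMm: "(\<lambda>y. Mm y $ i $ a) differentiable (at x)" for i a using dM by (simp add: Mm_def)
  have detG: "det (G y) = det (Mm y) * det (Mm y) * det (G' (T y))" if "y \<in> V" for y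
    using G[OF that] by (simp add: det_mul Mm_def M_def)
  have "det (G x) \<noteq> 0" using Gx invertible_det_nz by blast
  then have nz: "det (Mm x) \<noteq> 0" "det (G' (T x)) \<noteq> 0" using detG[OF x] by auto
  then have inv: "invertible (Mm x)" using invertible_det_nz by blast
  have MN: "(\<Sum>a\<in>UNIV. M x i a * N $ a $ j) = (if i = j then 1 else 0)" for i j
    using arg_cong[OF matrix_inv_both(1)[OF inv], of "\<lambda>A. A $ i $ j"]
    by (simp add: matrix_mult_entry N_def Mm_def mat_def)
  have NM: "(\<Sum>j\<in>UNIV. N $ b $ j * M x j a) = (if b = a then 1 else 0)" for a b
    using arg_cong[OF matrix_inv_both(2)[OF inv], of "\<lambda>A. A $ b $ a"]
    by (simp add: matrix_mult_entry N_def Mm_def mat_def)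
  have pdetM: "partial i (\<lambda>y. det (Mm y)) x = tr i * det (Mm x)" for i
    using jacobi_formula[OF dMm inv, of i] by (simp add: tr_def N_def Mm_def)
  \<comment> \<open>\<open>tr i\<close> is the logarithmic derivative of the Jacobian determinant.\<close>
  have \<theta>: "log_density_deriv G i x = tr i + (\<Sum>a\<in>UNIV. M x i a * \<theta>' a)" for i
  proof -
    have dd: "(\<lambda>y. det (Mm y)) differentiable (at x)" by (rule differentiable_det[OF dMm])
    have dd': "(\<lambda>y. det (G' y)) differentiable (at (T x))" by (rule differentiable_det[OF dG'])
    have "partial i (\<lambda>y. det (G y)) x = partial i (\<lambda>y. det (Mm y) * det (Mm y) * det (G' (T y))) x"
      using partial_transfer(1)[OF V x detG] .
    also have "\<dots> = det (Mm x) * det (Mm x) * (\<Sum>a\<in>UNIV. M x i a * partial a (\<lambda>y. det (G' y)) (T x)) +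
        2 * tr i * det (Mm x) * det (Mm x) * det (G' (T x))"
      using partial_chain(1)[OF dT dd', of i]
      by (simp add: partial_mult differentiable_mult dd partial_chain(2)[OF dT dd'] pdetM M_def coord_jacobian_def)
    finally have p: "partial i (\<lambda>y. det (G y)) x = \<dots>" .
    show ?thesis
      unfolding log_density_deriv_def \<theta>'_def p detG[OF x] using nz
      by (simp add: field_simps sum_distrib_left sum_divide_distrib)
  qed
  have sym: "partial j (\<lambda>y. M y i a) x = partial i (\<lambda>y. M y j a) x" for i j a
    unfolding M_def by (rule coord_jacobian_symmetric[OF V T x])
  \<comment> \<open>The same trace with the two lower indices exchanged: this is where commuting derivatives enter.\<close>
  have tr_alt: "(\<Sum>j\<in>UNIV. \<Sum>a\<in>UNIV. partial j (\<lambda>y. M y i a) x * N $ a $ j) = tr i" for i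
    unfolding tr_def by (intro sum.cong refl arg_cong2[where f="(*)"] sym)
  have chain: "(\<Sum>b\<in>UNIV. M x j b * partial b (\<lambda>y. X' y a) (T x)) =
      (\<Sum>i\<in>UNIV. M x i a * partial j (\<lambda>y. X y i) x + partial j (\<lambda>y. M y i a) x * X x i)" for j a
  proof -
    have "(\<Sum>b\<in>UNIV. M x j b * partial b (\<lambda>y. X' y a) (T x)) = partial j (\<lambda>y. X' (T y) a) x"
      using partial_chain(1)[OF dT dX', of j a] by (simp add: M_def coord_jacobian_def)
    also have "\<dots> = partial j (\<lambda>y. \<Sum>i\<in>UNIV. M y i a * X y i) x"
      using partial_transfer(1)[OF V x X] by (simp add: M_def)
    finally show ?thesis by (simp add: partial_sum partial_mult differentiable_mult dM dX)
  qed
  have dX'_eq: "partial a (\<lambda>y. X' y a) (T x) =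
      (\<Sum>j\<in>UNIV. N $ a $ j * (\<Sum>i\<in>UNIV. M x i a * partial j (\<lambda>y. X y i) x + partial j (\<lambda>y. M y i a) x * X x i))" for a
  proof -
    have "(\<Sum>j\<in>UNIV. N $ a $ j * (\<Sum>b\<in>UNIV. M x j b * partial b (\<lambda>y. X' y a) (T x))) =
        (\<Sum>b\<in>UNIV. (\<Sum>j\<in>UNIV. N $ a $ j * M x j b) * partial b (\<lambda>y. X' y a) (T x))"
      by (simp add: sum_distrib_left sum_distrib_right mult.assoc) (rule sum.swap)
    also have "\<dots> = partial a (\<lambda>y. X' y a) (T x)"
      unfolding NM by (simp add: if_distrib[where f="\<lambda>u. u * _"] cong: if_cong)
    finally show ?thesis unfolding chain by simp
  qed
  have "(\<Sum>a\<in>UNIV. partial a (\<lambda>y. X' y a) (T x)) =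
      (\<Sum>i\<in>UNIV. \<Sum>j\<in>UNIV. (\<Sum>a\<in>UNIV. M x i a * N $ a $ j) * partial j (\<lambda>y. X y i) x) +
      (\<Sum>i\<in>UNIV. (\<Sum>j\<in>UNIV. \<Sum>a\<in>UNIV. partial j (\<lambda>y. M y i a) x * N $ a $ j) * X x i)"
  proof -
    have sw: "(\<Sum>a\<in>UNIV. \<Sum>j\<in>UNIV. \<Sum>i\<in>UNIV. h a j i) = (\<Sum>i\<in>UNIV. \<Sum>j\<in>UNIV. \<Sum>a\<in>UNIV. h a j i)"
      for h :: "'n \<Rightarrow> 'n \<Rightarrow> 'n \<Rightarrow> real"
      by (subst sum.swap, subst (2) sum.swap, rule sum.swap[THEN trans], rule sum.cong[OF refl], rule refl)
    have "(\<Sum>a\<in>UNIV. partial a (\<lambda>y. X' y a) (T x)) =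
      (\<Sum>a\<in>UNIV. \<Sum>j\<in>UNIV. \<Sum>i\<in>UNIV. M x i a * N $ a $ j * partial j (\<lambda>y. X y i) x) +
      (\<Sum>a\<in>UNIV. \<Sum>j\<in>UNIV. \<Sum>i\<in>UNIV. partial j (\<lambda>y. M y i a) x * N $ a $ j * X x i)"
      unfolding dX'_eq by (simp add: sum_distrib_left distrib_left sum.distrib ac_simps)
    then show ?thesis
      by (simp only: sw[of "\<lambda>a j i. M x i a * N $ a $ j * partial j (\<lambda>y. X y i) x"]
        sw[of "\<lambda>a j i. partial j (\<lambda>y. M y i a) x * N $ a $ j * X x i"] sum_distrib_right)
  qed
  also have "\<dots> = (\<Sum>i\<in>UNIV. partial i (\<lambda>y. X y i) x) + (\<Sum>i\<in>UNIV. tr i * X x i)"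
    unfolding MN tr_alt
    by (simp add: if_distrib[where f="\<lambda>u. u * _"] cong: if_cong)
  finally have 1: "(\<Sum>a\<in>UNIV. partial a (\<lambda>y. X' y a) (T x)) =
      (\<Sum>i\<in>UNIV. partial i (\<lambda>y. X y i) x) + (\<Sum>i\<in>UNIV. tr i * X x i)" .
  have "(\<Sum>a\<in>UNIV. \<theta>' a * X' (T x) a) = (\<Sum>i\<in>UNIV. (\<Sum>a\<in>UNIV. M x i a * \<theta>' a) * X x i)"
    unfolding X[OF x] by (simp add: sum_distrib_left sum_distrib_right M_def ac_simps) (rule sum.swap)
  with 1 show ?thesis
    unfolding divergence_def \<theta> by (simp add: sum.distrib distrib_right \<theta>'_def)
qed

section \<open>The codifferential in coordinates\<close>

definition raise :: "(real^'n::finite \<Rightarrow> real^'n^'n) \<Rightarrow> 'n lform \<Rightarrow> 'n lform" where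
  "raise G \<omega> x = transform (\<lambda>i j. matrix_inv (G x) $ i $ j) (\<omega> x)"

definition raised_divergence :: "(real^'n::finite \<Rightarrow> real^'n^'n) \<Rightarrow> 'n lform \<Rightarrow> 'n lform" where
  "raised_divergence G \<omega> x I = divergence G (\<lambda>y i. raise G \<omega> y (i # I)) x"

text \<open>This is \<open>- \<nabla>\<^sup>i \<omega>\<^bsub>iI\<^esub>\<close>: the covariant
  divergence of an alternating contravariant tensor involves no Christoffel symbols apart from their
  trace, the logarithmic derivative of the density, so partial derivatives suffice once the indices are
  raised.\<close>

definition local_codiff :: "(real^'n::finite \<Rightarrow> real^'n^'n) \<Rightarrow> 'n lform \<Rightarrow> 'n lform" where
  "local_codiff G \<omega> x I = - transform (\<lambda>i j. G x $ i $ j) (raised_divergence G \<omega> x) I"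

lemma raise_codiff:
  assumes "invertible (G x)"
  shows "transform (\<lambda>i j. matrix_inv (G x) $ i $ j) (local_codiff G \<omega> x) I = - raised_divergence G \<omega> x I"
proof -
  have "(\<lambda>i b. \<Sum>a\<in>UNIV. matrix_inv (G x) $ i $ a * G x $ a $ b) = (\<lambda>i b. if i = b then 1 else 0)"
    using matrix_inv_both(2)[OF assms] by (simp add: mat_def fun_eq_iff vec_eq_iff flip: matrix_mult_entry)
  then show ?thesis
    unfolding local_codiff_def transform_minus transform_compose by (simp add: transform_id)
qed

locale metric_coefficients =
  fixes V :: "(real^'n::finite) set" and G :: "real^'n \<Rightarrow> real^'n^'n"
  assumes V: "open V"
    and smooth_G: "\<And>i j. smooth_on V (\<lambda>x. G x $ i $ j)"
    and invertible_G: "\<And>x. x \<in> V \<Longrightarrow> invertible (G x)"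
begin

lemma det_nonzero: "x \<in> V \<Longrightarrow> det (G x) \<noteq> 0"
  using invertible_G invertible_det_nz by blast

lemma smooth_on_raise: "(\<And>I. smooth_on V (\<lambda>x. \<omega> x I)) \<Longrightarrow> smooth_on V (\<lambda>x. raise G \<omega> x I)"
  unfolding raise_def
  by (intro smooth_on_transform smooth_on_matrix_inv V smooth_G invertible_G)

lemma smooth_on_log_density_deriv: "smooth_on V (log_density_deriv G i)"
proof -
  have "smooth_on V (\<lambda>x. partial i (\<lambda>y. det (G y)) x * inverse (2 * det (G x)))"
    by (intro smooth_on_mult smooth_on_inverse smooth_on_partial smooth_on_det smooth_on_const V smooth_G)
       (simp add: det_nonzero)
  moreover have "log_density_deriv G i = (\<lambda>x. partial i (\<lambda>y. det (G y)) x * inverse (2 * det (G x)))"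
    unfolding log_density_deriv_def divide_inverse fun_eq_iff by blast
  ultimately show ?thesis by metis
qed

lemma smooth_on_raised_divergence:
  assumes "\<And>I. smooth_on V (\<lambda>x. \<omega> x I)"
  shows "smooth_on V (\<lambda>x. raised_divergence G \<omega> x I)"
  unfolding raised_divergence_def divergence_def
  by (intro smooth_on_sum smooth_on_add smooth_on_mult smooth_on_partial V smooth_on_raise assms
      smooth_on_log_density_deriv)

lemma alternating_raise: "alternating (\<omega> x) \<Longrightarrow> alternating (raise G \<omega> x)"
  unfolding raise_def by (rule alternating_transform)

lemma alternating_raised_divergence:
  assumes "\<And>x. alternating (\<omega> x)" "\<And>I. smooth_on V (\<lambda>x. \<omega> x I)" "x \<in> V"
  shows "alternating (raised_divergence G \<omega> x)"
proof -
  have a: "alternating (\<lambda>I. raise G \<omega> y (i # I))" for y i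
    by (intro alternating_Cons alternating_raise assms)
  have p: "alternating (\<lambda>I. partial i (\<lambda>y. raise G \<omega> y (i # I)) x)" for i
    by (intro alternating_partial a smooth_on_differentiable[OF smooth_on_raise[OF assms(2)] assms(3)])
  show ?thesis
    unfolding alternating_def
  proof (intro allI)
    show "raised_divergence G \<omega> x (xs @ u # v # zs) = - raised_divergence G \<omega> x (xs @ v # u # zs)" for xs u v zs
      unfolding raised_divergence_def divergence_def sum_negf[symmetric]
    proof (rule sum.cong[OF refl])
      fix i
      show "partial i (\<lambda>y. raise G \<omega> y (i # xs @ u # v # zs)) x + log_density_deriv G i x * raise G \<omega> x (i # xs @ u # v # zs) =
        - (partial i (\<lambda>y. raise G \<omega> y (i # xs @ v # u # zs)) x + log_density_deriv G i x * raise G \<omega> x (i # xs @ v # u # zs))"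
        using alternatingD[OF p[of i], of xs u v zs] alternatingD[OF a[of x i], of xs u v zs]
        by (simp add: algebra_simps)
    qed
  qed
qed

lemma smooth_on_local_codiff:
  "(\<And>I. smooth_on V (\<lambda>x. \<omega> x I)) \<Longrightarrow> smooth_on V (\<lambda>x. local_codiff G \<omega> x I)"
  unfolding local_codiff_def
  by (intro smooth_on_minus smooth_on_transform V smooth_G smooth_on_raised_divergence)

lemma raise_wrong_length:
  assumes "\<eta> \<in> local_forms V k" "length I \<noteq> k"
  shows "raise G \<eta> x I = 0"
proof -
  have "raise G \<eta> x I = transform (\<lambda>i j. matrix_inv (G x) $ i $ j) (\<lambda>J. 0) I"
    unfolding raise_def by (rule transform_cong) (simp add: local_formsD(2)[OF assms(1)] assms(2))
  then show ?thesis by (simp add: transform_zero)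
qed

lemma local_codiff_local_forms:
  assumes om: "\<omega> \<in> local_forms V (Suc k)"
  shows "(\<lambda>x I. if x \<in> V then local_codiff G \<omega> x I else 0) \<in> local_forms V k"
proof (rule local_formsI)
  show "(if x \<in> V then local_codiff G \<omega> x I else 0) = 0" if I: "length I \<noteq> k" for x I
  proof -
    have "local_codiff G \<omega> x I = - transform (\<lambda>i j. G x $ i $ j) (\<lambda>_. 0) I"
      unfolding local_codiff_def
      by (rule arg_cong[where f=uminus], rule transform_cong)
         (simp add: raised_divergence_def divergence_def raise_wrong_length[OF om] I)
    then show ?thesis by (simp add: transform_zero)
  qed
  show "smooth_on V (\<lambda>x. if x \<in> V then local_codiff G \<omega> x I else 0)" for I
  proof (subst smooth_on_cong[OF V])
    show "smooth_on V (\<lambda>x. local_codiff G \<omega> x I)"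
      by (rule smooth_on_local_codiff[OF local_formsD(3)[OF om]])
  qed simp
  show "alternating (\<lambda>I. if x \<in> V then local_codiff G \<omega> x I else 0)" for x
  proof (cases "x \<in> V")
    case True
    have "alternating (transform (\<lambda>i j. G x $ i $ j) (raised_divergence G \<omega> x))"
      by (intro alternating_transform alternating_raised_divergence local_formsD(4)[OF om] local_formsD(3)[OF om] True)
    from alternating_minus[OF this] show ?thesis using True by (simp add: local_codiff_def)
  qed (simp add: alternating_zero)
qed simp

lemma local_codiff_add_cmult:
  assumes "\<And>I. smooth_on V (\<lambda>x. \<omega> x I)" "\<And>I. smooth_on V (\<lambda>x. \<eta> x I)" "x \<in> V"
  shows "local_codiff G (\<lambda>x I. \<omega> x I + c * \<eta> x I) x I = local_codiff G \<omega> x I + c * local_codiff G \<eta> x I"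
proof -
  have r: "raise G (\<lambda>x I. \<omega> x I + c * \<eta> x I) y J = raise G \<omega> y J + c * raise G \<eta> y J" for y J
    unfolding raise_def transform_add transform_cmult ..
  have "raised_divergence G (\<lambda>x I. \<omega> x I + c * \<eta> x I) x =
      (\<lambda>J. raised_divergence G \<omega> x J + c * raised_divergence G \<eta> x J)"
    using smooth_on_differentiable[OF smooth_on_raise[OF assms(1)] assms(3)]
      smooth_on_differentiable[OF smooth_on_raise[OF assms(2)] assms(3)]
    unfolding raised_divergence_def divergence_def r fun_eq_iff
    by (simp add: partial_add partial_cmult differentiable_mult sum.distrib algebra_simps sum_distrib_left)
  then show ?thesis
    unfolding local_codiff_def by (simp add: transform_add transform_cmult)
qed

end

text \<open>After raising indices the claim is that the divergence of an alternating contravariant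
  tensor \<open>P\<close> is again a tensor. Fix a constant form \<open>\<phi>'\<close> in the target
  coordinates, here the indicator of one index list \<open>L\<close>, and let \<open>\<phi>\<close> be
  its pullback. By the Leibniz rule the contraction of \<open>div P\<close> with \<open>\<phi>\<close>
  is the divergence of the vector field \<open>P\<^bsup>iK\<^esup> \<phi>\<^sub>K\<close> minus
  \<open>P\<^bsup>iK\<^esup> \<partial>\<^sub>i \<phi>\<^sub>K\<close>. The last term vanishes by
  \<open>pullback_pairing\<close>, as a constant form is closed, and the divergence of a vector field
  does not depend on the coordinates.\<close>

lemma local_codiff_coordinate_change:
  fixes T :: "real^'n::finite \<Rightarrow> real^'n"
  assumes "metric_coefficients V G" "metric_coefficients W G'"
    and W: "T ` V \<subseteq> W" and T: "\<And>a. smooth_on V (\<lambda>x. T x $ a)"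
    and G: "\<And>y i j. y \<in> V \<Longrightarrow> G y $ i $ j =
      (\<Sum>a\<in>UNIV. \<Sum>b\<in>UNIV. coord_jacobian T y i a * coord_jacobian T y j b * G' (T y) $ a $ b)"
    and om: "\<And>y. alternating (\<omega> y)" "\<And>I. smooth_on V (\<lambda>y. \<omega> y I)"
    and om': "\<And>I. smooth_on W (\<lambda>y. \<omega>' y I)"
    and pull: "\<And>y J. y \<in> V \<Longrightarrow> length J = Suc k \<Longrightarrow> \<omega> y J = transform (coord_jacobian T y) (\<omega>' (T y)) J"
    and x: "x \<in> V" and I: "length I = k"
  shows "local_codiff G \<omega> x I = transform (coord_jacobian T x) (local_codiff G' \<omega>' (T x)) I"
proof -
  interpret V: metric_coefficients V G by fact
  interpret W: metric_coefficients W G' by fact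
  define M where "M = coord_jacobian T"
  define Mm where "Mm = (\<lambda>y. \<chi> i a. M y i a)"
  define P where "P = raise G \<omega>"
  define P' where "P' = raise G' \<omega>'"
  have Tx: "T x \<in> W" using x W by blast
  have GM: "G y = Mm y ** G' (T y) ** transpose (Mm y)" if "y \<in> V" for y
    unfolding vec_eq_iff matrix_mult_entry using G[OF that]
    by (simp add: Mm_def M_def transpose_def sum_distrib_left sum_distrib_right ac_simps)
       (subst sum.swap, simp)
  have inv': "matrix_inv (G' (T y)) $ a $ b =
      (\<Sum>j\<in>UNIV. (\<Sum>i\<in>UNIV. M y i a * matrix_inv (G y) $ i $ j) * M y j b)" if y: "y \<in> V" for y a b
  proof -
    define Gi where "Gi = matrix_inv (G y)"
    have "Mm y ** (G' (T y) ** transpose (Mm y) ** Gi) = mat 1"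
      using matrix_inv_both(1)[OF V.invertible_G[OF y]] GM[OF y] by (simp add: Gi_def matrix_mul_assoc)
    then have "(G' (T y) ** transpose (Mm y) ** Gi) ** Mm y = mat 1"
      using matrix_left_right_inverse by blast
    then have "matrix_inv (G' (T y)) = (transpose (Mm y) ** Gi) ** Mm y"
      by (intro matrix_inv_unique) (simp add: matrix_mul_assoc)
    then show ?thesis
      by (simp add: matrix_mult_entry transpose_def Mm_def Gi_def)
  qed
  have P': "P' (T y) L = transform (\<lambda>a i. M y i a) (P y) L" if y: "y \<in> V" and L: "length L = Suc k" for y L
  proof -
    have "P' (T y) L = transform (\<lambda>a i. M y i a)
        (transform (\<lambda>i j. matrix_inv (G y) $ i $ j) (transform (M y) (\<omega>' (T y)))) L"
      unfolding P'_def raise_def transform_compose inv'[OF y] ..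
    also have "\<dots> = transform (\<lambda>a i. M y i a) (P y) L"
      unfolding P_def raise_def
      by (intro transform_cong) (simp add: pull[OF y] L M_def)
    finally show ?thesis .
  qed
  have smP: "smooth_on V (\<lambda>y. P y J)" for J unfolding P_def by (rule V.smooth_on_raise[OF om(2)])
  have smP': "smooth_on W (\<lambda>y. P' y J)" for J unfolding P'_def by (rule W.smooth_on_raise[OF om'])
  have dP: "(\<lambda>y. P y J) differentiable (at x)" for J by (rule smooth_on_differentiable[OF smP x])
  have altP: "alternating (P x)" unfolding P_def by (rule V.alternating_raise[OF om(1)])
  have dM: "(\<lambda>y. M y i a) differentiable (at x)" for i a
    unfolding M_def by (rule smooth_on_differentiable[OF smooth_on_coord_jacobian[OF T] x])
  have div: "raised_divergence G' \<omega>' (T x) L = transform (\<lambda>a i. M x i a) (raised_divergence G \<omega> x) L"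
    if L: "length L = k" for L
  proof -
    define \<phi> where "\<phi> = (\<lambda>y. transform (M y) (\<lambda>J. if J = L then 1 else 0))"
    define X where "X = (\<lambda>y i. \<Sum>K | length K = k. P y (i # K) * \<phi> y K)"
    \<comment> \<open>Contraction with \<open>\<phi>\<close> extracts the component \<open>L\<close> of the transformed tensor.\<close>
    have pick: "transform (\<lambda>a i. M y i a) F L = (\<Sum>K | length K = k. F K * \<phi> y K)" for F y
    proof -
      have "transform (\<lambda>a i. M y i a) F L =
          (\<Sum>K | length K = k. transform (\<lambda>a i. M y i a) F K * (if K = L then 1 else 0))"
        using L by (simp add: if_distrib[where f="\<lambda>u. _ * u"] cong: if_cong)
      also have "\<dots> = (\<Sum>K | length K = k. F K * \<phi> y K)"
        unfolding \<phi>_def by (rule transform_pairing)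
      finally show ?thesis .
    qed
    have d\<phi>: "(\<lambda>y. \<phi> y K) differentiable (at x)" for K
      unfolding \<phi>_def by (intro differentiable_transform dM differentiable_const)
    have dX: "(\<lambda>y. X y i) differentiable (at x)" for i
      unfolding X_def by (intro differentiable_sum ballI differentiable_mult dP d\<phi>) simp
    \<comment> \<open>The pullback of a constant form is closed.\<close>
    have closed: "(\<Sum>i\<in>UNIV. \<Sum>K | length K = k. partial i (\<lambda>y. \<phi> y K) x * P x (i # K)) = 0"
      using pullback_pairing[OF dM coord_jacobian_symmetric[OF V.V T x, folded M_def] altP, where F="\<lambda>y J. if J = L then 1 else 0" and k=k]
      by (simp add: \<phi>_def transform_zero)
    have "transform (\<lambda>a i. M x i a) (raised_divergence G \<omega> x) L = divergence G X x"
    proof -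
      have "divergence G X x = (\<Sum>i\<in>UNIV. \<Sum>K | length K = k.
            (partial i (\<lambda>y. P y (i # K)) x + log_density_deriv G i x * P x (i # K)) * \<phi> x K) +
          (\<Sum>i\<in>UNIV. \<Sum>K | length K = k. partial i (\<lambda>y. \<phi> y K) x * P x (i # K))"
        unfolding divergence_def X_def
        by (simp add: partial_sum partial_mult differentiable_mult dP d\<phi> sum_distrib_left
            sum.distrib distrib_right distrib_left ac_simps)
      then show ?thesis
        unfolding pick closed raised_divergence_def divergence_def P_def[symmetric]
        by (simp add: sum_distrib_right) (rule sum.swap)
    qed
    also have "\<dots> = divergence G' (\<lambda>y a. P' y (a # L)) (T x)"
    proof (rule divergence_coordinate_change[OF V.V T x])
      show "G y = (\<chi> i a. coord_jacobian T y i a) ** G' (T y) ** transpose (\<chi> i a. coord_jacobian T y i a)" if "y \<in> V" for y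
        using GM[OF that] by (simp add: Mm_def M_def)
      show "invertible (G x)" by (rule V.invertible_G[OF x])
      show "(\<lambda>y. G' y $ i $ j) differentiable (at (T x))" for i j
        by (rule smooth_on_differentiable[OF W.smooth_G Tx])
      show "(\<lambda>y. X y i) differentiable (at x)" for i by (rule dX)
      show "(\<lambda>y. P' y (a # L)) differentiable (at (T x))" for a
        by (rule smooth_on_differentiable[OF smP' Tx])
      show "P' (T y) (a # L) = (\<Sum>i\<in>UNIV. coord_jacobian T y i a * X y i)" if "y \<in> V" for y a
        using P'[OF that, of "a # L"] L by (simp add: pick[unfolded M_def] X_def M_def)
    qed
    finally show ?thesis unfolding raised_divergence_def P'_def by simp
  qed
  have "transform (M x) (local_codiff G' \<omega>' (T x)) I =
      - transform (M x) (transform (\<lambda>i j. G' (T x) $ i $ j) (raised_divergence G' \<omega>' (T x))) I"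
    unfolding local_codiff_def transform_minus ..
  also have "transform (M x) (transform (\<lambda>i j. G' (T x) $ i $ j) (raised_divergence G' \<omega>' (T x))) I =
      transform (M x) (transform (\<lambda>i j. G' (T x) $ i $ j) (transform (\<lambda>a i. M x i a) (raised_divergence G \<omega> x))) I"
    by (intro transform_cong div) (simp add: I)
  also have "\<dots> = transform (\<lambda>i j. G x $ i $ j) (raised_divergence G \<omega> x) I"
  proof -
    have "(\<Sum>c\<in>UNIV. (\<Sum>a\<in>UNIV. M x i a * G' (T x) $ a $ c) * M x j c) = G x $ i $ j" for i j
      unfolding G[OF x] M_def
      by (simp add: sum_distrib_left sum_distrib_right ac_simps) (rule sum.swap)
    then show ?thesis unfolding transform_compose by simp
  qed
  finally show ?thesis unfolding local_codiff_def M_def by simp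
qed

section \<open>Integrals of functions with compact support\<close>

lemma continuous_on_extend_by_zero:
  assumes "open V" "compact K" "K \<subseteq> V" "continuous_on V f" "\<And>x. x \<notin> K \<Longrightarrow> f x = (0::real)"
  shows "continuous_on UNIV (f :: real^'n::finite \<Rightarrow> real)"
proof -
  have "continuous_on (- K) f"
    by (rule continuous_on_eq[where f="\<lambda>_. 0"]) (use assms(5) in auto)
  moreover have "open (- K)" using assms(2) compact_imp_closed by blast
  ultimately have "continuous_on (V \<union> - K) f"
    using assms(1,4) continuous_on_open_Un by blast
  moreover have "V \<union> - K = UNIV" using assms(3) by blast
  ultimately show ?thesis by simp
qed

lemma integrable_compact_support:
  fixes f :: "real^'n::finite \<Rightarrow> real"
  assumes "continuous_on UNIV f" "compact K" "\<And>x. x \<notin> K \<Longrightarrow> f x = 0"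
  shows "integrable lborel f"
proof -
  have "integrable lborel (\<lambda>x. indicator K x *\<^sub>R f x)"
    using assms borel_integrable_compact continuous_on_subset by blast
  moreover have "(\<lambda>x. indicator K x *\<^sub>R f x) = f"
    using assms(3) by (auto simp: fun_eq_iff indicator_def)
  ultimately show ?thesis by simp
qed

lemma integrable_on_compact_support:
  fixes f :: "real^'n::finite \<Rightarrow> real"
  assumes "open V" "compact K" "K \<subseteq> V" "continuous_on V f" "\<And>x. x \<notin> K \<Longrightarrow> f x = 0"
  shows "f integrable_on V"
proof -
  have "f integrable_on UNIV"
    using has_integral_integral_lborel[OF integrable_compact_support[OF continuous_on_extend_by_zero[OF assms] assms(2,5)]]
    by blast
  moreover have "f = (\<lambda>x. if x \<in> V then f x else 0)" using assms(3,5) by (auto simp: fun_eq_iff)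
  ultimately show ?thesis by (metis integrable_restrict_UNIV)
qed

lemma partial_outside_support:
  assumes "compact K" "\<And>x. x \<notin> K \<Longrightarrow> u x = 0" "x \<notin> K"
  shows "partial i u x = 0" "u differentiable (at x)"
  using partial_transfer[of "- K" x u "\<lambda>_. 0"] assms compact_imp_closed by auto

text \<open>The difference quotients \<open>(u (x + h e\<^sub>i) - u x) / h\<close> have integral zero
  by translation invariance of Lebesgue measure. By the mean value theorem they are bounded by the
  maximum of \<open>\<bar>\<partial>\<^sub>i u\<bar>\<close> and, for \<open>h \<le> 1\<close>,
  supported in a fixed ball, so dominated convergence gives the integral of their limit
  \<open>\<partial>\<^sub>i u\<close>.\<close>

lemma has_integral_partial_UNIV:
  fixes u :: "real^'n::finite \<Rightarrow> real"
  assumes K: "compact K" and d: "\<And>x. u differentiable (at x)"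
    and c: "continuous_on UNIV (partial i u)" and z: "\<And>x. x \<notin> K \<Longrightarrow> u x = 0"
  shows "(partial i u has_integral 0) UNIV"
proof -
  define e :: "real^'n" where "e = axis i 1"
  define h where "h = (\<lambda>n. inverse (real (Suc n)))"
  define s where "s = (\<lambda>n x. (u (x + h n *\<^sub>R e) - u x) / h n)"
  have h: "0 < h n" "h n \<le> 1" for n by (auto simp: h_def inverse_le_1_iff)
  have cu: "continuous_on UNIV u"
    using d differentiable_imp_continuous_within continuous_at_imp_continuous_on by blast
  have pz: "partial i u x = 0" if "x \<notin> K" for x by (rule partial_outside_support(1)[OF K z that])
  have "bounded (partial i u ` K)"
    by (rule compact_imp_bounded[OF compact_continuous_image[OF continuous_on_subset[OF c] K]]) simp
  then obtain B where B: "0 < B" "\<And>x. x \<in> K \<Longrightarrow> \<bar>partial i u x\<bar> \<le> B"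
    unfolding bounded_pos by auto
  have B': "\<bar>partial i u x\<bar> \<le> B" for x using B pz by (cases "x \<in> K") auto
  obtain R where R: "\<And>x. x \<in> K \<Longrightarrow> norm x \<le> R" using K compact_imp_bounded bounded_iff by metis
  have mvt: "\<exists>t. 0 < t \<and> t < h n \<and> s n x = partial i u (x + t *\<^sub>R e)" for n x
  proof -
    obtain t where "0 < t" "t < h n" "u (x + h n *\<^sub>R e) - u x = h n * partial i u (x + t *\<^sub>R e)"
      using axis_mvt[OF h(1)[of n], of u x i] d unfolding e_def by blast
    then show ?thesis using h(1)[of n] by (intro exI[of _ t]) (simp add: s_def)
  qed
  have iu: "integrable lborel u" by (rule integrable_compact_support[OF cu K z])
  have ishift: "integrable lborel (\<lambda>x. u (c + x))" "integral\<^sup>L lborel (\<lambda>x. u (c + x)) = integral\<^sup>L lborel u" for c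
  proof -
    have m: "u \<in> borel_measurable borel" using cu borel_measurable_continuous_onI by blast
    show "integral\<^sup>L lborel (\<lambda>x. u (c + x)) = integral\<^sup>L lborel u"
      using integral_distr[of "(+) c" lborel borel u] m by (simp add: lborel_distr_plus)
    show "integrable lborel (\<lambda>x. u (c + x))"
      using integrable_distr_eq[of "(+) c" lborel borel u] m iu by (simp add: lborel_distr_plus)
  qed
  have int_s: "integral\<^sup>L lborel (s n) = 0" for n
    using ishift[of "h n *\<^sub>R e"] iu unfolding s_def by (simp add: add.commute)
  have "(\<lambda>n. integral\<^sup>L lborel (s n)) \<longlonglongrightarrow> integral\<^sup>L lborel (partial i u)"
  proof (rule integral_dominated_convergence[where w="\<lambda>x. indicator (cball 0 (R + 1)) x *\<^sub>R B"])
    show "partial i u \<in> borel_measurable lborel"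
      using c borel_measurable_continuous_onI by simp
    have "continuous_on UNIV (s n)" for n
      unfolding s_def using h(1)[of n]
      by (intro continuous_intros continuous_on_compose2[OF cu]) auto
    then show "s n \<in> borel_measurable lborel" for n
      by (simp add: borel_measurable_continuous_onI)
    show "integrable lborel (\<lambda>x::real^'n. indicator (cball 0 (R + 1)) x *\<^sub>R B)"
      by (rule borel_integrable_compact) auto
    show "AE x in lborel. norm (s n x) \<le> indicator (cball 0 (R + 1)) x *\<^sub>R B" for n
    proof (rule AE_I2)
      fix x
      show "norm (s n x) \<le> indicator (cball 0 (R + 1)) x *\<^sub>R B"
      proof (cases "x \<in> cball 0 (R + 1)")
        case True
        then show ?thesis using mvt[of n x] B' by auto
      next
        case False
        then have far: "norm x > R + 1" by simp
        have "norm x \<le> norm (x + h n *\<^sub>R e) + norm (h n *\<^sub>R e)"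
          using norm_triangle_ineq4[of "x + h n *\<^sub>R e" "h n *\<^sub>R e"] by simp
        then have "norm x \<le> norm (x + h n *\<^sub>R e) + h n"
          using h[of n] by (simp add: e_def)
        then have "x + h n *\<^sub>R e \<notin> K" "x \<notin> K" using R far h(2)[of n] by force+
        then show ?thesis using z B by (simp add: s_def)
      qed
    qed
    show "AE x in lborel. (\<lambda>n. s n x) \<longlonglongrightarrow> partial i u x"
    proof (rule AE_I2)
      fix x
      obtain t where t: "\<And>n. 0 < t n" "\<And>n. t n < h n" "\<And>n. s n x = partial i u (x + t n *\<^sub>R e)"
        using mvt[of _ x] by metis
      have h0: "h \<longlonglongrightarrow> 0" unfolding h_def by (rule LIMSEQ_inverse_real_of_nat)
      have "t \<longlonglongrightarrow> 0"
        by (rule tendsto_sandwich[OF _ _ tendsto_const h0])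
           (use t in \<open>auto intro!: always_eventually less_imp_le\<close>)
      then have "(\<lambda>n. x + t n *\<^sub>R e) \<longlonglongrightarrow> x + 0 *\<^sub>R e" by (intro tendsto_intros)
      moreover have "isCont (partial i u) x" using c continuous_on_eq_continuous_at by blast
      ultimately show "(\<lambda>n. s n x) \<longlonglongrightarrow> partial i u x"
        unfolding t(3) using isCont_tendsto_compose by fastforce
    qed
  qed
  then have "integral\<^sup>L lborel (partial i u) = 0"
    unfolding int_s by (simp add: LIMSEQ_const_iff)
  with has_integral_integral_lborel[OF integrable_compact_support[OF c K pz]]
  show ?thesis by simp
qed

lemma has_integral_partial:
  fixes u :: "real^'n::finite \<Rightarrow> real"
  assumes V: "open V" and K: "compact K" "K \<subseteq> V"
    and d: "\<And>x. x \<in> V \<Longrightarrow> u differentiable (at x)"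
    and c: "continuous_on V (partial i u)" and z: "\<And>x. x \<notin> K \<Longrightarrow> u x = 0"
  shows "(partial i u has_integral 0) V"
proof -
  have pz: "partial i u x = 0" if "x \<notin> K" for x by (rule partial_outside_support(1)[OF K(1) z that])
  have "(partial i u has_integral 0) UNIV"
  proof (rule has_integral_partial_UNIV[OF K(1) _ _ z])
    show "u differentiable (at x)" for x
    proof (cases "x \<in> V")
      case False
      then have "x \<notin> K" using K(2) by blast
      show ?thesis by (rule partial_outside_support(2)[OF K(1) z \<open>x \<notin> K\<close>])
    qed (rule d)
    show "continuous_on UNIV (partial i u)"
      by (rule continuous_on_extend_by_zero[OF V K c pz])
  qed
  moreover have "partial i u = (\<lambda>x. if x \<in> V then partial i u x else 0)" using K(2) pz by (auto simp: fun_eq_iff)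
  ultimately show ?thesis by (metis has_integral_restrict_UNIV)
qed

section \<open>Smooth bump functions\<close>

text \<open>For \<open>k = 0\<close> the standard smooth function that is flat at \<open>0\<close>. The
  powers of \<open>inverse t\<close> make the family closed under differentiation up to linear
  combinations, which is what the induction on the order of differentiability uses.\<close>

definition flat_exp :: "nat \<Rightarrow> real \<Rightarrow> real" where
  "flat_exp k t = (if 0 < t then inverse t ^ k * exp (- inverse t) else 0)"

lemma flat_exp_limit: "((\<lambda>t. inverse t ^ k * exp (- inverse t)) \<longlongrightarrow> (0::real)) (at_right 0)"
proof -
  have "((\<lambda>y. y ^ k / exp y) \<longlongrightarrow> (0::real)) at_top" by (rule tendsto_power_div_exp_0)
  from filterlim_compose[OF this filterlim_inverse_at_top_right]
  show ?thesis by (simp add: exp_minus divide_inverse)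
qed

lemma flat_exp_derivative:
  "(flat_exp k has_real_derivative flat_exp (k + 2) t - real k * flat_exp (k + 1) t) (at t)"
proof -
  consider "t > 0" | "t < 0" | "t = 0" by linarith
  then show ?thesis
  proof cases
    case 1
    have "((\<lambda>t. inverse t ^ k * exp (- inverse t)) has_real_derivative
        flat_exp (k + 2) t - real k * flat_exp (k + 1) t) (at t)"
    proof -
      have "t * t ^ (m - Suc 0) = t ^ m" if "m \<noteq> 0" for m
        using that by (cases m) auto
      then show ?thesis
        using 1 by (cases k)
          (auto intro!: derivative_eq_intros simp: flat_exp_def field_simps power2_eq_square, metis neq0_conv)
    qed
    then show ?thesis
      by (rule has_field_derivative_transform_within_open[where S="{0<..}"])
         (use 1 in \<open>auto simp: flat_exp_def\<close>)
  next
    case 2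
    have "((\<lambda>t. 0) has_real_derivative flat_exp (k + 2) t - real k * flat_exp (k + 1) t) (at t)"
      using 2 by (auto simp: flat_exp_def)
    then show ?thesis
      by (rule has_field_derivative_transform_within_open[where S="{..<0}"])
         (use 2 in \<open>auto simp: flat_exp_def\<close>)
  next
    case 3
    have "((\<lambda>h. flat_exp k h / h) \<longlongrightarrow> 0) (at_right 0)"
      by (rule Lim_transform_eventually[OF flat_exp_limit[of "Suc k"]])
         (auto simp: eventually_at_right_field flat_exp_def divide_inverse intro!: exI[of _ 1])
    moreover have "((\<lambda>h. flat_exp k h / h) \<longlongrightarrow> 0) (at_left 0)"
      by (rule Lim_transform_eventually[OF tendsto_const])
         (auto simp: eventually_at_left_field flat_exp_def intro!: exI[of _ "-1"])
    ultimately have "((\<lambda>h. flat_exp k h / h) \<longlongrightarrow> 0) (at 0)"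
      by (simp add: filterlim_split_at)
    then show ?thesis using 3 by (simp add: DERIV_def flat_exp_def)
  qed
qed

lemma Ck_on_flat_exp:
  assumes V: "open V" and q: "smooth_on V q"
  shows "Ck_on m V (\<lambda>x. flat_exp k (q x))"
proof (induction m arbitrary: k)
  case 0
  have "isCont (flat_exp k) t" for t using DERIV_isCont[OF flat_exp_derivative] .
  then have "continuous_on UNIV (flat_exp k)" by (simp add: continuous_at_imp_continuous_on)
  then show ?case
    using smooth_on_continuous[OF q] by (auto intro: continuous_on_compose2)
next
  case (Suc m)
  note ch = partial_real_chain[OF flat_exp_derivative smooth_on_differentiable[OF q]]
  have "Ck_on m V (partial i (\<lambda>x. flat_exp k (q x)))" for i
  proof (subst Ck_on_cong[OF V ch(1)], assumption)
    have "Ck_on m V (\<lambda>x. (flat_exp (k + 2) (q x) + (- real k) * flat_exp (k + 1) (q x)) * partial i q x)"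
      using smooth_on_partial[OF q] unfolding smooth_on_def
      by (intro Ck_on_mult Ck_on_add Ck_on_const V Suc.IH) auto
    then show "Ck_on m V (\<lambda>x. (flat_exp (k + 2) (q x) - real k * flat_exp (k + 1) (q x)) * partial i q x)"
      by simp
  qed
  then show ?case using ch(2) by simp
qed

lemma smooth_bump:
  fixes x0 :: "real^'n::finite"
  assumes "open V" "x0 \<in> V"
  obtains \<rho> K where "compact K" "K \<subseteq> V" "\<And>W. open W \<Longrightarrow> smooth_on W \<rho>" "\<And>x. x \<notin> K \<Longrightarrow> \<rho> x = 0"
    "\<And>x. 0 \<le> \<rho> x" "0 < \<rho> x0"
proof -
  obtain r where r: "0 < r" "cball x0 r \<subseteq> V" using assms open_contains_cball by blast
  \<comment> \<open>\<open>r\<^sup>2\<close> minus the squared distance from \<open>x0\<close>, written as a polynomial so that it is visibly smooth.\<close>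
  define q where "q = (\<lambda>x::real^'n. r\<^sup>2 + (\<Sum>j\<in>UNIV. - ((x $ j + - (x0 $ j)) * (x $ j + - (x0 $ j)))))"
  have q: "q x = r\<^sup>2 - (dist x x0)\<^sup>2" for x
  proof -
    have "(dist x x0)\<^sup>2 = (\<Sum>j\<in>UNIV. (x $ j - x0 $ j)\<^sup>2)"
      by (simp add: dist_norm norm_vec_def L2_set_def sum_nonneg)
    then show ?thesis by (simp add: q_def sum_negf power2_eq_square)
  qed
  have smq: "smooth_on W q" if "open W" for W
    unfolding q_def
    by (intro smooth_on_add smooth_on_sum smooth_on_minus smooth_on_mult smooth_on_const smooth_on_coordinate that)
  show ?thesis
  proof (rule that[of "cball x0 r" "\<lambda>x. flat_exp 0 (q x)"])
    show "smooth_on W (\<lambda>x. flat_exp 0 (q x))" if "open W" for W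
      unfolding smooth_on_def using Ck_on_flat_exp[OF that smq[OF that]] by blast
    show "flat_exp 0 (q x) = 0" if "x \<notin> cball x0 r" for x
    proof -
      have "r < dist x x0" using that by (simp add: dist_commute)
      then have "r\<^sup>2 < (dist x x0)\<^sup>2" using r by (intro power_strict_mono) auto
      then show ?thesis by (simp add: flat_exp_def q)
    qed
    show "0 \<le> flat_exp 0 (q x)" for x by (simp add: flat_exp_def)
    show "0 < flat_exp 0 (q x0)" using r by (simp add: flat_exp_def q)
  qed (use r in auto)
qed

section \<open>The codifferential as formal adjoint\<close>

lemma test_formsE:
  assumes "\<phi> \<in> test_forms V k"
  obtains K where "compact K" "K \<subseteq> V" "\<And>x I. x \<notin> K \<Longrightarrow> \<phi> x I = 0" "\<phi> \<in> local_forms V k"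
  using assms unfolding test_forms_def by auto

lemma form_pairing_eq:
  "form_pairing (G x) k \<alpha> (\<omega> x) = (\<Sum>I | length I = k. \<alpha> I * raise G \<omega> x I) / fact k"
proof -
  have "(\<Sum>J | length J = k. (\<Prod>m<k. matrix_inv (G x) $ (I ! m) $ (J ! m)) * \<alpha> I * \<omega> x J) =
      \<alpha> I * raise G \<omega> x I" if "length I = k" for I
    unfolding raise_def transform_eq_sum[OF that, symmetric] by (simp add: sum_distrib_left ac_simps)
  then show ?thesis unfolding form_pairing_def by simp
qed

lemma sqrt_abs_derivative:
  assumes "t \<noteq> 0"
  shows "((\<lambda>t. sqrt \<bar>t\<bar>) has_real_derivative sqrt \<bar>t\<bar> / (2 * t)) (at t)"
proof (cases "t > 0")
  case True
  have "(sqrt has_real_derivative sqrt \<bar>t\<bar> / (2 * t)) (at t)"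
    using True by (auto intro!: derivative_eq_intros simp: field_simps)
  then show ?thesis
    by (rule has_field_derivative_transform_within_open[where S="{0<..}"]) (use True in auto)
next
  case False
  have "((\<lambda>t. sqrt (- t)) has_real_derivative sqrt \<bar>t\<bar> / (2 * t)) (at t)"
    using False assms by (auto intro!: derivative_eq_intros simp: field_simps)
  then show ?thesis
    by (rule has_field_derivative_transform_within_open[where S="{..<0}"]) (use False assms in auto)
qed

context metric_coefficients
begin

definition volume_density :: "real^'n \<Rightarrow> real" where "volume_density x = sqrt \<bar>det (G x)\<bar>"

lemma volume_density_pos: "x \<in> V \<Longrightarrow> 0 < volume_density x"
  using det_nonzero by (simp add: volume_density_def)

lemma volume_density_derivative:
  assumes "x \<in> V"
  shows "volume_density differentiable (at x)" "partial i volume_density x = volume_density x * log_density_deriv G i x"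
proof -
  have d: "(\<lambda>y. det (G y)) differentiable (at x)"
    by (rule smooth_on_differentiable[OF smooth_on_det[OF V smooth_G] assms])
  note ch = partial_real_chain[where q="\<lambda>y. det (G y)", OF sqrt_abs_derivative[OF det_nonzero[OF assms]] d]
  show "volume_density differentiable (at x)" unfolding volume_density_def[abs_def] by (rule ch(2))
  show "partial i volume_density x = volume_density x * log_density_deriv G i x"
    unfolding volume_density_def[abs_def] ch(1) log_density_deriv_def by simp
qed

lemma continuous_on_volume_density: "continuous_on V volume_density"
  by (intro continuous_at_imp_continuous_on ballI differentiable_imp_continuous_within volume_density_derivative)

lemma continuous_on_pairing:
  assumes "\<And>I. smooth_on V (\<lambda>x. \<phi> x I)" "\<And>I. smooth_on V (\<lambda>x. \<eta> x I)"
  shows "continuous_on V (\<lambda>x. form_pairing (G x) k (\<phi> x) (\<eta> x) * volume_density x)"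
  unfolding form_pairing_eq
  by (intro continuous_intros continuous_on_volume_density smooth_on_continuous[OF smooth_on_raise]
      smooth_on_continuous[OF assms(1)] assms(2)) simp

lemma integrable_pairing:
  assumes "\<phi> \<in> test_forms V k" "\<And>I. smooth_on V (\<lambda>x. \<eta> x I)"
  shows "(\<lambda>x. form_pairing (G x) k (\<phi> x) (\<eta> x) * volume_density x) integrable_on V"
proof -
  obtain K where K: "compact K" "K \<subseteq> V" "\<And>x I. x \<notin> K \<Longrightarrow> \<phi> x I = 0" "\<phi> \<in> local_forms V k"
    using test_formsE[OF assms(1)] by blast
  show ?thesis
    by (rule integrable_on_compact_support[OF V K(1,2) continuous_on_pairing[OF local_formsD(3)[OF K(4)] assms(2)]])
       (simp add: form_pairing_eq K(3))
qed

text \<open>The difference of the two integrands is, up to the factor \<open>k!\<close>, the sum over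
  \<open>i\<close> of the partial derivatives of \<open>sqrt \<bar>det G\<bar> \<Sum>\<^sub>I
  \<phi>\<^sub>I R\<^bsup>iI\<^esup>\<close>, where \<open>R\<close> is the raised form
  \<open>\<omega>\<close>. These functions have compact support, so their derivatives integrate to
  zero.\<close>

lemma local_codiff_adjoint:
  assumes test: "\<phi> \<in> test_forms V k" and om: "\<omega> \<in> local_forms V (Suc k)"
  shows "integral V (\<lambda>x. form_pairing (G x) (Suc k) (local_d \<phi> x) (\<omega> x) * volume_density x) =
    integral V (\<lambda>x. form_pairing (G x) k (\<phi> x) (local_codiff G \<omega> x) * volume_density x)"
proof -
  obtain K where K: "compact K" "K \<subseteq> V" and \<phi>0: "\<And>x I. x \<notin> K \<Longrightarrow> \<phi> x I = 0" and \<phi>: "\<phi> \<in> local_forms V k"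
    using test_formsE[OF test] by blast
  define R where "R = raise G \<omega>"
  define D where "D = raised_divergence G \<omega>"
  define u where "u = (\<lambda>i x. volume_density x * (\<Sum>I | length I = k. \<phi> x I * R x (i # I)))"
  define du where "du = (\<lambda>i x. volume_density x * (log_density_deriv G i x * (\<Sum>I | length I = k. \<phi> x I * R x (i # I)) +
     (\<Sum>I | length I = k. partial i (\<lambda>y. \<phi> y I) x * R x (i # I) + \<phi> x I * partial i (\<lambda>y. R y (i # I)) x)))"
  define A where "A = (\<lambda>x. form_pairing (G x) (Suc k) (local_d \<phi> x) (\<omega> x) * volume_density x)"
  define B where "B = (\<lambda>x. form_pairing (G x) k (\<phi> x) (local_codiff G \<omega> x) * volume_density x)"
  have sm\<phi>: "smooth_on V (\<lambda>x. \<phi> x I)" for I by (rule local_formsD(3)[OF \<phi>])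
  have smR: "smooth_on V (\<lambda>x. R x I)" for I
    unfolding R_def by (rule smooth_on_raise[OF local_formsD(3)[OF om]])
  have smh: "smooth_on V (\<lambda>x. local_codiff G \<omega> x I)" for I
    by (rule smooth_on_local_codiff[OF local_formsD(3)[OF om]])
  have d\<phi>: "(\<lambda>x. \<phi> x I) differentiable (at x)" if "x \<in> V" for x I by (rule smooth_on_differentiable[OF sm\<phi> that])
  have dR: "(\<lambda>x. R x I) differentiable (at x)" if "x \<in> V" for x I by (rule smooth_on_differentiable[OF smR that])
  have du: "partial i (u i) x = du i x" "u i differentiable (at x)" if "x \<in> V" for i x
    unfolding u_def du_def using volume_density_derivative[OF that] d\<phi>[OF that] dR[OF that]
    by (simp_all add: partial_mult partial_sum differentiable_mult differentiable_sum algebra_simps sum.distrib)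
  have "(partial i (u i) has_integral 0) V" for i
  proof (rule has_integral_partial[OF V K])
    have "continuous_on V (du i)"
      unfolding du_def
      by (intro continuous_intros continuous_on_volume_density smooth_on_continuous smooth_on_log_density_deriv sm\<phi> smR smooth_on_partial)
    then show "continuous_on V (partial i (u i))"
      using du(1) by (simp cong: continuous_on_cong)
  qed (use du(2) \<phi>0 in \<open>auto simp: u_def\<close>)
  then have "((\<lambda>x. (\<Sum>i\<in>UNIV. partial i (u i) x) / fact k) has_integral (\<Sum>i\<in>(UNIV::'n set). 0) / fact k) V"
    by (intro has_integral_divide has_integral_sum) auto
  then have C: "((\<lambda>x. (\<Sum>i\<in>UNIV. partial i (u i) x) / fact k) has_integral 0) V" by simp
  have AB: "A x = B x + (\<Sum>i\<in>UNIV. partial i (u i) x) / fact k" if x: "x \<in> V" for x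
  proof -
    have altR: "alternating (R x)" unfolding R_def by (rule alternating_raise[OF local_formsD(4)[OF om]])
    have "A x = (\<Sum>i\<in>UNIV. \<Sum>I | length I = k. partial i (\<lambda>y. \<phi> y I) x * R x (i # I)) / fact k * volume_density x"
      unfolding A_def form_pairing_eq R_def[symmetric] local_d_pairing[OF altR]
      by (simp add: field_simps del: of_nat_Suc)
    moreover have "B x = - (\<Sum>I | length I = k. \<phi> x I * D x I) / fact k * volume_density x"
      unfolding B_def form_pairing_eq raise_def raise_codiff[where G=G, OF invertible_G[OF x]] D_def by (simp add: sum_negf)
    moreover have "(\<Sum>i\<in>UNIV. partial i (u i) x) =
        volume_density x * ((\<Sum>i\<in>UNIV. \<Sum>I | length I = k. partial i (\<lambda>y. \<phi> y I) x * R x (i # I)) +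
          (\<Sum>I | length I = k. \<phi> x I * D x I))"
    proof -
      have "(\<Sum>I | length I = k. \<phi> x I * D x I) =
          (\<Sum>i\<in>UNIV. \<Sum>I | length I = k. \<phi> x I * partial i (\<lambda>y. R y (i # I)) x + log_density_deriv G i x * (\<phi> x I * R x (i # I)))"
        unfolding D_def raised_divergence_def divergence_def R_def[symmetric] sum_distrib_left
        by (subst sum.swap) (simp add: algebra_simps)
      then show ?thesis
        unfolding du(1)[OF x] du_def by (simp add: sum_distrib_left sum.distrib algebra_simps)
    qed
    ultimately show ?thesis by (simp add: field_simps)
  qed
  have "integral V A = integral V (\<lambda>x. B x + (\<Sum>i\<in>UNIV. partial i (u i) x) / fact k)"
    by (rule integral_cong[OF AB])
  also have "\<dots> = integral V B + integral V (\<lambda>x. (\<Sum>i\<in>UNIV. partial i (u i) x) / fact k)"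
    using integrable_pairing[OF test smh] C unfolding B_def by (intro integral_add) (auto simp: has_integral_integrable)
  also have "\<dots> = integral V B" unfolding integral_unique[OF C] by simp
  finally show ?thesis unfolding A_def B_def .
qed

text \<open>The metric may be indefinite, so the pairing of \<open>\<eta>\<close> with itself may
  vanish. Testing with \<open>\<rho> R\<close>, where \<open>\<rho>\<close> is a bump function and the
  components \<open>R\<close> of the raised form are used as those of a form in this chart, makes the
  pairing, up to a positive factor, \<open>\<rho>\<close> times the sum of the squares of these components.\<close>

lemma test_forms_separate:
  assumes eta: "\<eta> \<in> local_forms V k"
    and zero: "\<And>\<phi>. \<phi> \<in> test_forms V k \<Longrightarrow>
      integral V (\<lambda>x. form_pairing (G x) k (\<phi> x) (\<eta> x) * volume_density x) = 0"
  shows "\<eta> x I = 0"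
proof (cases "x \<in> V")
  case x: True
  define R where "R = raise G \<eta>"
  obtain \<rho> K where K: "compact K" "K \<subseteq> V" and sm: "\<And>W. open W \<Longrightarrow> smooth_on W \<rho>"
    and \<rho>0: "\<And>x. x \<notin> K \<Longrightarrow> \<rho> x = 0" and \<rho>: "\<And>x. 0 \<le> \<rho> x" "0 < \<rho> x"
    by (rule smooth_bump[OF V x], rule that)
  define \<phi> where "\<phi> = (\<lambda>x I. \<rho> x * R x I)"
  define f where "f = (\<lambda>x. form_pairing (G x) k (\<phi> x) (\<eta> x) * volume_density x)"
  have smR: "smooth_on V (\<lambda>x. R x I)" for I unfolding R_def by (rule smooth_on_raise[OF local_formsD(3)[OF eta]])
  have sm\<phi>: "smooth_on V (\<lambda>x. \<phi> x I)" for I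
    unfolding \<phi>_def by (intro smooth_on_mult V sm smR)
  have "\<phi> \<in> local_forms V k"
  proof (rule local_formsI[OF _ _ sm\<phi>])
    show "\<phi> y I = 0" if "y \<notin> V" for y I using that \<rho>0 K by (auto simp: \<phi>_def)
    show "\<phi> y I = 0" if "length I \<noteq> k" for y I
      using raise_wrong_length[OF eta that] by (simp add: \<phi>_def R_def)
    show "alternating (\<phi> y)" for y
      unfolding \<phi>_def R_def
      by (intro alternating_cmult alternating_raise[where \<omega>=\<eta>] local_formsD(4)[OF eta])
  qed
  then have test: "\<phi> \<in> test_forms V k"
    unfolding test_forms_def using K \<rho>0 by (auto simp: \<phi>_def fun_eq_iff)
  have f: "f y = \<rho> y * (\<Sum>I | length I = k. (R y I)\<^sup>2) / fact k * volume_density y" for y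
    unfolding f_def form_pairing_eq R_def[symmetric] \<phi>_def
    by (simp add: sum_distrib_left power2_eq_square mult.assoc)
  have f0: "f y = 0" if "y \<notin> K" for y using \<rho>0[OF that] by (simp add: f)
  have f_nonneg: "0 \<le> f y" for y
    unfolding f volume_density_def using \<rho>(1) by (intro mult_nonneg_nonneg divide_nonneg_nonneg sum_nonneg) auto
  have cf: "continuous_on V f"
    unfolding f_def by (rule continuous_on_pairing[OF sm\<phi> local_formsD(3)[OF eta]])
  have cU: "continuous_on UNIV f" by (rule continuous_on_extend_by_zero[OF V K cf f0])
  have "(f has_integral 0) V"
    using integrable_pairing[OF test local_formsD(3)[OF eta]] zero[OF test]
    unfolding f_def by (simp add: has_integral_iff)
  obtain a where a: "K \<subseteq> cbox (- a) a" using bounded_subset_cbox_symmetric compact_imp_bounded[OF K(1)] by metis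
  have xK: "x \<in> K" using \<rho>(2) \<rho>0 by force
  obtain c d where cd: "cbox (- a) a \<subseteq> box c d" using bounded_subset_box_symmetric bounded_cbox by metis
  have Kcd: "K \<subseteq> cbox c d" "box c d \<noteq> {}" using a cd xK box_subset_cbox by blast+
  have "((\<lambda>x. if x \<in> V then f x else 0) has_integral 0) UNIV"
    using \<open>(f has_integral 0) V\<close> by (simp add: has_integral_restrict_UNIV)
  also have "(\<lambda>x. if x \<in> V then f x else 0) = (\<lambda>x. if x \<in> cbox c d then f x else 0)"
    using f0 K(2) Kcd(1) by (auto simp: fun_eq_iff)
  finally have "(f has_integral 0) (cbox c d)"
    unfolding has_integral_restrict_UNIV .
  then have "f x = 0"
    using has_integral_0_cbox_imp_0[OF continuous_on_subset[OF cU] f_nonneg _ Kcd(2)] Kcd(1) xK by blast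
  then have "(\<Sum>I | length I = k. (R x I)\<^sup>2) = 0"
    using \<rho>(2) volume_density_pos[OF x] by (simp add: f)
  then have "\<forall>I\<in>{I. length I = k}. (R x I)\<^sup>2 = 0" by (subst (asm) sum_nonneg_eq_0_iff) auto
  then have R0: "R x I = 0" for I using raise_wrong_length[OF eta, of I x] by (cases "length I = k") (auto simp: R_def)
  have "(\<lambda>i b. \<Sum>a\<in>UNIV. G x $ i $ a * matrix_inv (G x) $ a $ b) = (\<lambda>i b. if i = b then 1 else 0)"
    using matrix_inv_both(1)[OF invertible_G[OF x]] by (simp add: mat_def fun_eq_iff vec_eq_iff flip: matrix_mult_entry)
  then have "\<eta> x I = transform (\<lambda>i j. G x $ i $ j) (R x) I"
    unfolding R_def raise_def transform_compose by (simp add: transform_id)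
  also have "\<dots> = transform (\<lambda>i j. G x $ i $ j) (\<lambda>J. 0) I" by (rule transform_cong) (rule R0)
  finally show ?thesis by (simp add: transform_zero)
next
  case False
  then show ?thesis by (rule local_formsD(1)[OF eta])
qed

lemma adjoint_unique:
  assumes h: "h \<in> local_forms V k" and h': "h' \<in> local_forms V k"
    and eq: "\<And>\<phi>. \<phi> \<in> test_forms V k \<Longrightarrow>
      integral V (\<lambda>x. form_pairing (G x) k (\<phi> x) (h x) * volume_density x) =
      integral V (\<lambda>x. form_pairing (G x) k (\<phi> x) (h' x) * volume_density x)"
  shows "h = h'"
proof -
  define \<eta> where "\<eta> = (\<lambda>x I. h x I + (-1) * h' x I)"
  have "\<eta> \<in> local_forms V k"
    unfolding \<eta>_def
  proof (rule local_formsI)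
    show "smooth_on V (\<lambda>x. h x I + (-1) * h' x I)" for I
      by (intro smooth_on_add smooth_on_mult smooth_on_const V local_formsD(3)[OF h] local_formsD(3)[OF h'])
    show "alternating (\<lambda>I. h x I + (-1) * h' x I)" for x
      by (rule alternating_add_cmult[OF local_formsD(4)[OF h] local_formsD(4)[OF h']])
  qed (simp_all add: local_formsD(1,2)[OF h] local_formsD(1,2)[OF h'])
  moreover have "integral V (\<lambda>x. form_pairing (G x) k (\<phi> x) (\<eta> x) * volume_density x) = 0" if test: "\<phi> \<in> test_forms V k" for \<phi>
  proof -
    have "form_pairing (G x) k (\<phi> x) (\<eta> x) * volume_density x =
        form_pairing (G x) k (\<phi> x) (h x) * volume_density x - form_pairing (G x) k (\<phi> x) (h' x) * volume_density x" for x
      unfolding form_pairing_eq raise_def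
      unfolding \<eta>_def transform_add transform_cmult
      by (simp add: algebra_simps sum.distrib sum_subtractf diff_divide_distrib)
    then show ?thesis
      using integral_diff[OF integrable_pairing[OF test local_formsD(3)[OF h]] integrable_pairing[OF test local_formsD(3)[OF h']]]
        eq[OF test] by simp
  qed
  ultimately have "\<eta> x I = 0" for x I by (rule test_forms_separate)
  then show ?thesis by (simp add: \<eta>_def fun_eq_iff)
qed

end

section \<open>Products of shifts of a linear operator\<close>

lemma prod_list_difference_zero:
  fixes \<mu> :: "'i \<Rightarrow> 'f::field"
  shows "i \<in> set js \<Longrightarrow> (\<Prod>j\<leftarrow>js. \<mu> i - \<mu> j) = 0"
  by (induction js) auto

text \<open>\<open>D\<close> is linear only on \<open>F\<close>: for the application \<open>F\<close>
  consists of the smooth forms, and partial derivatives of functions that are not differentiable do not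
  add up.\<close>

locale operator_on_subspace = vector_space scale
  for scale :: "'f::field \<Rightarrow> 'v::ab_group_add \<Rightarrow> 'v" (infixr "\<odot>" 75) +
  fixes F :: "'v set" and D :: "'v \<Rightarrow> 'v"
  assumes subspace_F: "subspace F"
    and D_closed: "x \<in> F \<Longrightarrow> D x \<in> F"
    and D_add: "x \<in> F \<Longrightarrow> y \<in> F \<Longrightarrow> D (x + y) = D x + D y"
    and D_scale: "x \<in> F \<Longrightarrow> D (r \<odot> x) = r \<odot> D x"
begin

lemmas F_closed = subspace_0[OF subspace_F] subspace_add[OF subspace_F] subspace_scale[OF subspace_F]
  subspace_sum[OF subspace_F] subspace_diff[OF subspace_F]

definition shift :: "'f \<Rightarrow> 'v \<Rightarrow> 'v" where "shift m x = D x + (- m) \<odot> x"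

lemma shift_closed: "x \<in> F \<Longrightarrow> shift m x \<in> F"
  unfolding shift_def by (intro F_closed D_closed)

lemma shift_add: "x \<in> F \<Longrightarrow> y \<in> F \<Longrightarrow> shift m (x + y) = shift m x + shift m y"
  unfolding shift_def by (simp add: D_add scale_right_distrib scale_right_diff_distrib algebra_simps)

lemma shift_scale: "x \<in> F \<Longrightarrow> shift m (r \<odot> x) = r \<odot> shift m x"
  unfolding shift_def by (simp add: D_scale scale_right_distrib scale_right_diff_distrib mult.commute)

lemma shifts_closed: "x \<in> F \<Longrightarrow> foldr (\<lambda>j. shift (\<mu> j)) js x \<in> F"
  by (induction js) (auto intro: shift_closed)

lemma shifts_add: "x \<in> F \<Longrightarrow> y \<in> F \<Longrightarrow>
  foldr (\<lambda>j. shift (\<mu> j)) js (x + y) = foldr (\<lambda>j. shift (\<mu> j)) js x + foldr (\<lambda>j. shift (\<mu> j)) js y"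
  by (induction js) (auto simp: shift_add shifts_closed)

lemma shifts_scale: "x \<in> F \<Longrightarrow> foldr (\<lambda>j. shift (\<mu> j)) js (r \<odot> x) = r \<odot> foldr (\<lambda>j. shift (\<mu> j)) js x"
  by (induction js) (auto simp: shift_scale shifts_closed)

lemma shifts_sum:
  assumes "finite S" "\<And>s. s \<in> S \<Longrightarrow> u s \<in> F"
  shows "foldr (\<lambda>j. shift (\<mu> j)) js (\<Sum>s\<in>S. u s) = (\<Sum>s\<in>S. foldr (\<lambda>j. shift (\<mu> j)) js (u s))"
  using assms
proof (induction S rule: finite_induct)
  case empty
  then show ?case using shifts_scale[OF F_closed(1), of \<mu> js 0] by simp
next
  case (insert s S)
  then show ?case by (simp add: shifts_add F_closed)
qed

lemma shifts_eigenvector: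
  assumes "x \<in> F" "D x = m \<odot> x"
  shows "foldr (\<lambda>j. shift (\<mu> j)) js x = (\<Prod>j\<leftarrow>js. m - \<mu> j) \<odot> x"
proof (induction js)
  case (Cons j js)
  have "shift (\<mu> j) x = (m - \<mu> j) \<odot> x"
    unfolding shift_def assms(2) by (simp add: scale_left_diff_distrib)
  then show ?case using Cons assms(1) by (simp add: shift_scale mult.commute)
qed simp

text \<open>The product of the shifts by all other eigenvalues kills every summand but one, and
  multiplies that one by a nonzero scalar.\<close>

lemma eigenvectors_independent:
  assumes "finite S" "inj_on \<mu> S"
    and "\<And>s. s \<in> S \<Longrightarrow> u s \<in> F" "\<And>s. s \<in> S \<Longrightarrow> D (u s) = \<mu> s \<odot> u s" "(\<Sum>s\<in>S. u s) = 0" "s \<in> S"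
  shows "u s = 0"
proof -
  obtain js where js: "set js = S - {s}" using finite_list[OF finite_Diff[OF assms(1)]] ..
  have "foldr (\<lambda>j. shift (\<mu> j)) js (u t) = 0" if "t \<in> S - {s}" for t
  proof -
    have "(\<Prod>j\<leftarrow>js. \<mu> t - \<mu> j) = 0" by (rule prod_list_difference_zero) (use that js in blast)
    then show ?thesis using shifts_eigenvector[where x="u t" and m="\<mu> t" and \<mu>=\<mu> and js=js] assms(3,4)[of t] that by simp
  qed
  then have "(\<Sum>t\<in>S. foldr (\<lambda>j. shift (\<mu> j)) js (u t)) = foldr (\<lambda>j. shift (\<mu> j)) js (u s)"
    using assms(1,6) by (subst sum.remove[of _ s]) auto
  moreover have "(\<Sum>t\<in>S. foldr (\<lambda>j. shift (\<mu> j)) js (u t)) = 0"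
    using shifts_sum[where u=u and \<mu>=\<mu> and js=js, OF assms(1,3)] shifts_scale[OF F_closed(1), of \<mu> js 0] assms(5) by simp
  ultimately have "(\<Prod>j\<leftarrow>js. \<mu> s - \<mu> j) \<odot> u s = 0"
    using shifts_eigenvector[where x="u s" and m="\<mu> s" and \<mu>=\<mu> and js=js] assms(3,4)[OF assms(6)] by simp
  moreover have "(\<Prod>j\<leftarrow>js. \<mu> s - \<mu> j) \<noteq> 0"
  proof -
    have "\<mu> s \<noteq> \<mu> j" if "j \<in> set js" for j
    proof -
      have "j \<in> S" "j \<noteq> s" using that js by auto
      then show ?thesis using inj_onD[OF assms(2)] assms(6) by metis
    qed
    then show ?thesis by (auto simp: prod_list_zero_iff)
  qed
  ultimately show ?thesis by (simp add: scale_eq_0_iff)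
qed

text \<open>If \<open>Q x\<close> is an eigenvector of \<open>D\<close> for an eigenvalue that is not
  among the shifts in \<open>Q\<close>, then \<open>Q (Q x) = c Q x\<close> with \<open>c \<noteq>
  0\<close>, so subtracting \<open>Q x / c\<close> from \<open>x\<close> produces an element of the null
  space of \<open>Q\<close>.\<close>

lemma split_off_eigenvector:
  assumes "x \<in> F" "D (foldr (\<lambda>j. shift (\<mu> j)) js x) = m \<odot> foldr (\<lambda>j. shift (\<mu> j)) js x"
    and "\<And>j. j \<in> set js \<Longrightarrow> \<mu> j \<noteq> m"
  obtains r where "foldr (\<lambda>j. shift (\<mu> j)) js (x - r \<odot> foldr (\<lambda>j. shift (\<mu> j)) js x) = 0"
proof -
  let ?Q = "foldr (\<lambda>j. shift (\<mu> j)) js"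
  define c where "c = (\<Prod>j\<leftarrow>js. m - \<mu> j)"
  have "c \<noteq> 0" unfolding c_def using assms(3) by (force simp: prod_list_zero_iff)
  have h: "?Q x \<in> F" by (rule shifts_closed[OF assms(1)])
  have "?Q (x + (- (1 / c)) \<odot> ?Q x) = ?Q x + (- (1 / c)) \<odot> ?Q (?Q x)"
    using h assms(1) by (subst shifts_add) (auto intro: F_closed simp: shifts_scale simp del: scale_minus_left)
  also have "?Q (?Q x) = c \<odot> ?Q x" unfolding c_def by (rule shifts_eigenvector[OF h assms(2)])
  finally have "?Q (x - (1 / c) \<odot> ?Q x) = 0" using \<open>c \<noteq> 0\<close> by simp
  then show ?thesis by (rule that)
qed

text \<open>The leading shift of the product says that the remaining product maps \<open>x\<close> to an
  eigenvector; splitting it off leaves an element killed by one shift less.\<close>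

lemma eigenvector_decomposition:
  assumes "distinct js" "inj_on \<mu> (set js)"
  shows "x \<in> F \<Longrightarrow> foldr (\<lambda>j. shift (\<mu> j)) js x = 0 \<Longrightarrow>
    \<exists>u. (\<forall>j\<in>set js. u j \<in> F \<and> D (u j) = \<mu> j \<odot> u j) \<and> x = (\<Sum>j\<in>set js. u j)"
  using assms
proof (induction js arbitrary: x)
  case (Cons j js)
  define h where "h = foldr (\<lambda>j. shift (\<mu> j)) js x"
  have h: "h \<in> F" unfolding h_def by (rule shifts_closed[OF Cons.prems(1)])
  have "shift (\<mu> j) h = 0" using Cons.prems(2) by (simp add: h_def)
  then have Dh: "D h = \<mu> j \<odot> h" by (simp add: shift_def)
  have ne: "\<mu> i \<noteq> \<mu> j" if "i \<in> set js" for i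
    using inj_onD[OF Cons.prems(4), of i j] Cons.prems(3) that by auto
  obtain r where r: "foldr (\<lambda>j. shift (\<mu> j)) js (x - r \<odot> h) = 0"
    using split_off_eigenvector[OF Cons.prems(1) Dh[unfolded h_def] ne] unfolding h_def by blast
  have "x - r \<odot> h \<in> F" using Cons.prems(1) h by (intro F_closed)
  then obtain u where u: "\<forall>i\<in>set js. u i \<in> F \<and> D (u i) = \<mu> i \<odot> u i" "x - r \<odot> h = (\<Sum>i\<in>set js. u i)"
    using Cons.IH[OF _ r] Cons.prems(3,4) by auto
  define v where "v = u(j := r \<odot> h)"
  have "j \<notin> set js" using Cons.prems(3) by simp
  then have "(\<Sum>i\<in>set (j # js). v i) = r \<odot> h + (\<Sum>i\<in>set js. u i)"
    by (auto simp: v_def intro!: sum.cong)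
  then have "x = (\<Sum>i\<in>set (j # js). v i)" using u(2) by (metis add.commute diff_add_cancel)
  moreover have "\<forall>i\<in>set (j # js). v i \<in> F \<and> D (v i) = \<mu> i \<odot> v i"
    using u(1) h Dh by (auto simp: v_def D_scale F_closed mult.commute)
  ultimately show ?case by blast
qed simp

end

section \<open>Differential operators on the forms of a manifold\<close>

locale pseudo_riemannian_manifold =
  fixes X :: "'a topology" and A :: "('a, 'n::finite) chart set" and g :: "('a, 'n) metric"
  assumes manifold: "smooth_manifold X A" and metric: "pseudo_riemannian A g"
begin

lemma chart:
  assumes "c \<in> A"
  shows "open (chart_ran c)" "openin X (chart_dom c)" "inj_on (chart_map c) (chart_dom c)"
    "homeomorphic_map (subtopology X (chart_dom c)) (top_of_set (chart_ran c)) (chart_map c)"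
proof -
  have c: "is_chart X c" using manifold assms unfolding smooth_manifold_def by blast
  then show "open (chart_ran c)" and o: "openin X (chart_dom c)"
    and h: "homeomorphic_map (subtopology X (chart_dom c)) (top_of_set (chart_ran c)) (chart_map c)"
    unfolding is_chart_def by blast+
  have "topspace (subtopology X (chart_dom c)) = chart_dom c"
    using openin_subset[OF o] by auto
  then show "inj_on (chart_map c) (chart_dom c)"
    using homeomorphic_imp_injective_map[OF h] by simp
qed

lemma overlap_subset: "overlap c c' \<subseteq> chart_ran c"
  unfolding overlap_def chart_ran_def by blast

lemma open_overlap:
  assumes "c \<in> A" "c' \<in> A" shows "open (overlap c c')"
proof -
  have "openin (subtopology X (chart_dom c)) (chart_dom c \<inter> chart_dom c')"
    using chart(2)[OF assms(2)] by (simp add: openin_subtopology_Int2)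
  then have "openin (top_of_set (chart_ran c)) (overlap c c')"
    unfolding overlap_def
    using homeomorphic_imp_open_map[OF chart(4)[OF assms(1)]] unfolding open_map_def by blast
  then show ?thesis using chart(1)[OF assms(1)] openin_open_trans by blast
qed

lemma transition_in_range:
  assumes "c \<in> A" shows "transition c c' ` overlap c c' \<subseteq> chart_ran c'"
  using chart(3)[OF assms] by (auto simp: transition_def overlap_def chart_ran_def inv_into_f_f)

lemma smooth_transition:
  assumes "c \<in> A" "c' \<in> A" shows "smooth_on (overlap c c') (\<lambda>x. transition c c' x $ a)"
  using manifold assms unfolding smooth_manifold_def by blast

lemma jac_eq: "jac c c' x a i = coord_jacobian (transition c c') x i a"
  unfolding jac_def coord_jacobian_def ..

lemma metric_on_chart: "c \<in> A \<Longrightarrow> metric_coefficients (chart_ran c) (g c)"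
  using metric chart(1) unfolding pseudo_riemannian_def by unfold_locales blast+

lemma metric_on_overlap: "c \<in> A \<Longrightarrow> c' \<in> A \<Longrightarrow> metric_coefficients (overlap c c') (g c)"
  using metric_on_chart[of c] open_overlap[of c c'] overlap_subset[of c c']
  unfolding metric_coefficients_def by (meson smooth_on_subset subsetD)

lemma metric_coordinate_change:
  "c \<in> A \<Longrightarrow> c' \<in> A \<Longrightarrow> x \<in> overlap c c' \<Longrightarrow> g c x $ i $ j =
    (\<Sum>a\<in>UNIV. \<Sum>b\<in>UNIV. coord_jacobian (transition c c') x i a * coord_jacobian (transition c c') x j b *
      g c' (transition c c' x) $ a $ b)"
  using metric unfolding pseudo_riemannian_def jac_eq by blast

lemma forms_iff:
  "\<omega> \<in> forms A k \<longleftrightarrow> (\<forall>c. c \<notin> A \<longrightarrow> \<omega> c = (\<lambda>x I. 0)) \<and>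
     (\<forall>c\<in>A. \<omega> c \<in> local_forms (chart_ran c) k) \<and>
     (\<forall>c\<in>A. \<forall>c'\<in>A. \<forall>x\<in>overlap c c'. \<forall>I. length I = k \<longrightarrow>
        \<omega> c x I = transform (coord_jacobian (transition c c') x) (\<omega> c' (transition c c' x)) I)"
  unfolding forms_def jac_eq mem_Collect_eq by (simp add: transform_eq_sum cong: conj_cong)

lemma formsD:
  assumes "\<omega> \<in> forms A k"
  shows "c \<notin> A \<Longrightarrow> \<omega> c x I = 0" "c \<in> A \<Longrightarrow> \<omega> c \<in> local_forms (chart_ran c) k"
    "c \<in> A \<Longrightarrow> c' \<in> A \<Longrightarrow> x \<in> overlap c c' \<Longrightarrow> length I = k \<Longrightarrow>
        \<omega> c x I = transform (coord_jacobian (transition c c') x) (\<omega> c' (transition c c' x)) I"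
proof -
  note f = assms[unfolded forms_iff]
  show "\<omega> c x I = 0" if "c \<notin> A"
  proof -
    have "\<omega> c = (\<lambda>x I. 0)" using f that by blast
    then show ?thesis by simp
  qed
qed (use assms[unfolded forms_iff] in blast)+

lemma forms_smooth: "\<omega> \<in> forms A k \<Longrightarrow> c \<in> A \<Longrightarrow> smooth_on (chart_ran c) (\<lambda>x. \<omega> c x I)"
  by (rule local_formsD(3)[OF formsD(2)])

lemma forms_smooth_overlap: "\<omega> \<in> forms A k \<Longrightarrow> c \<in> A \<Longrightarrow> smooth_on (overlap c c') (\<lambda>x. \<omega> c x I)"
  by (rule smooth_on_subset[OF forms_smooth overlap_subset])

lemma forms_alternating: "\<omega> \<in> forms A k \<Longrightarrow> c \<in> A \<Longrightarrow> alternating (\<omega> c x)"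
  by (rule local_formsD(4)[OF formsD(2)])

lemma forms_differentiable: "\<omega> \<in> forms A k \<Longrightarrow> c \<in> A \<Longrightarrow> x \<in> chart_ran c \<Longrightarrow> (\<lambda>x. \<omega> c x I) differentiable (at x)"
  by (rule smooth_on_differentiable[OF forms_smooth])

sublocale mform: vector_space "scale_form :: real \<Rightarrow> ('a, 'n) mform \<Rightarrow> ('a, 'n) mform"
  by unfold_locales (auto simp: scale_form_def fun_eq_iff algebra_simps)

lemma forms_add_scale:
  assumes w: "\<omega> \<in> forms A k" and e: "\<eta> \<in> forms A k"
  shows "\<omega> + scale_form r \<eta> \<in> forms A k"
  unfolding forms_iff
proof (intro conjI allI impI ballI)
  show "(\<omega> + scale_form r \<eta>) c = (\<lambda>x I. 0)" if "c \<notin> A" for c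
    using formsD(1)[OF w that] formsD(1)[OF e that] by (simp add: scale_form_def fun_eq_iff)
  show "(\<omega> + scale_form r \<eta>) c \<in> local_forms (chart_ran c) k" if c: "c \<in> A" for c
  proof (rule local_formsI)
    show "smooth_on (chart_ran c) (\<lambda>x. (\<omega> + scale_form r \<eta>) c x I)" for I
      using chart(1)[OF c] forms_smooth[OF w c] forms_smooth[OF e c]
      by (auto simp: scale_form_def intro!: smooth_on_add smooth_on_mult smooth_on_const)
    show "alternating ((\<omega> + scale_form r \<eta>) c x)" for x
      using alternating_add_cmult[OF forms_alternating[OF w c, of x] forms_alternating[OF e c, of x], of r]
      by (simp add: scale_form_def plus_fun_def)
  qed (simp_all add: scale_form_def local_formsD(1,2)[OF formsD(2)[OF w c]] local_formsD(1,2)[OF formsD(2)[OF e c]])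
  fix c c' x and I :: "'n list"
  assume *: "c \<in> A" "c' \<in> A" "x \<in> overlap c c'" "length I = k"
  have "(\<omega> + scale_form r \<eta>) c' y = (\<lambda>J. \<omega> c' y J + r * \<eta> c' y J)" for y
    by (simp add: scale_form_def fun_eq_iff)
  then show "(\<omega> + scale_form r \<eta>) c x I =
      transform (coord_jacobian (transition c c') x) ((\<omega> + scale_form r \<eta>) c' (transition c c' x)) I"
    using formsD(3)[OF w *] formsD(3)[OF e *] by (simp add: transform_add transform_cmult scale_form_def)
qed

lemma zero_form: "0 \<in> forms A k"
  unfolding forms_iff
  by (auto simp: fun_eq_iff transform_zero zero_fun_def alternating_zero smooth_on_const intro!: local_formsI)

lemma subspace_forms: "mform.subspace (forms A k)"
  unfolding mform.subspace_def
proof (intro conjI ballI allI zero_form)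
  show "x + y \<in> forms A k" if "x \<in> forms A k" "y \<in> forms A k" for x y
    using forms_add_scale[OF that, of 1] by simp
  show "scale_form r x \<in> forms A k" if "x \<in> forms A k" for r x
    using forms_add_scale[OF zero_form that, of r] by simp
qed

text \<open>The only point beyond the computation in a single chart is compatibility on overlaps, which
  is naturality of the exterior derivative.\<close>

lemma ext_d_forms:
  assumes w: "\<omega> \<in> forms A k"
  shows "ext_d \<omega> \<in> forms A (Suc k)"
  unfolding forms_iff
proof (intro conjI allI impI ballI)
  show "ext_d \<omega> c = (\<lambda>x I. 0)" if "c \<notin> A" for c
    using formsD(1)[OF w that] by (simp add: ext_d_def local_d_def fun_eq_iff)
  show "ext_d \<omega> c \<in> local_forms (chart_ran c) (Suc k)" if c: "c \<in> A" for c
    unfolding ext_d_def by (rule local_d_local_forms[OF chart(1)[OF c] formsD(2)[OF w c]])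
  fix c c' x and I :: "'n list"
  assume *: "c \<in> A" "c' \<in> A" "x \<in> overlap c c'" "length I = Suc k"
  have Tx: "transition c c' x \<in> chart_ran c'" using transition_in_range[OF *(1)] *(3) by blast
  have "local_d (\<omega> c) x I = transform (coord_jacobian (transition c c') x) (local_d (\<omega> c') (transition c c' x)) I"
    by (rule local_d_pullback[OF open_overlap[OF *(1,2)] transition_in_range[OF *(1)] smooth_transition[OF *(1,2)]
        forms_alternating[OF w *(1)] forms_smooth_overlap[OF w *(1)] forms_alternating[OF w *(2)]
        forms_smooth[OF w *(2)] formsD(3)[OF w *(1,2)] *(3,4)])
  then show "ext_d \<omega> c x I = transform (coord_jacobian (transition c c') x) (ext_d \<omega> c' (transition c c' x)) I"
    using *(3) overlap_subset[of c c'] Tx by (auto simp: ext_d_def)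
qed

lemma ext_d_ext_d:
  assumes w: "\<omega> \<in> forms A k"
  shows "ext_d (ext_d \<omega>) = 0"
proof -
  have "ext_d (ext_d \<omega>) c x I = 0" for c x I
  proof (cases "c \<in> A \<and> x \<in> chart_ran c")
    case True
    then show ?thesis
      using local_d_local_d[OF chart(1) formsD(2)[OF w], of c x I] by (simp add: ext_d_def)
  next
    case False
    show ?thesis
    proof (cases "c \<in> A")
      case True
      with False show ?thesis by (simp add: ext_d_def)
    qed (rule formsD(1)[OF ext_d_forms[OF ext_d_forms[OF w]]])
  qed
  then show ?thesis by (simp add: fun_eq_iff)
qed

lemma ext_d_add_scale:
  assumes w: "\<omega> \<in> forms A k" and e: "\<eta> \<in> forms A k"
  shows "ext_d (\<omega> + scale_form r \<eta>) = ext_d \<omega> + scale_form r (ext_d \<eta>)"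
proof -
  have "ext_d (\<omega> + scale_form r \<eta>) c x I = ext_d \<omega> c x I + r * ext_d \<eta> c x I" for c x I
  proof (cases "c \<in> A \<and> x \<in> chart_ran c")
    case True
    then have "partial i (\<lambda>y. (\<omega> + scale_form r \<eta>) c y J) x = partial i (\<lambda>y. \<omega> c y J) x + r * partial i (\<lambda>y. \<eta> c y J) x" for i J
      using forms_differentiable[OF w] forms_differentiable[OF e]
      by (simp add: scale_form_def partial_add partial_cmult differentiable_mult)
    then show ?thesis using True by (simp add: ext_d_def local_d_eq_skew skew_add skew_cmult)
  next
    case False
    show ?thesis
    proof (cases "c \<in> A")
      case True
      with False show ?thesis by (simp add: ext_d_def)
    next
      case False
      show ?thesis
        unfolding formsD(1)[OF ext_d_forms[OF forms_add_scale[OF w e]] False]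
          formsD(1)[OF ext_d_forms[OF w] False] formsD(1)[OF ext_d_forms[OF e] False] by simp
    qed
  qed
  then show ?thesis by (simp add: fun_eq_iff scale_form_def)
qed

definition coord_codiff :: "('a, 'n) mform \<Rightarrow> ('a, 'n) mform" where
  "coord_codiff \<omega> = (\<lambda>c x I. if c \<in> A \<and> x \<in> chart_ran c then local_codiff (g c) (\<omega> c) x I else 0)"

lemma coord_codiff_local:
  assumes "\<omega> \<in> forms A (Suc k)" "c \<in> A"
  shows "coord_codiff \<omega> c \<in> local_forms (chart_ran c) k"
  using metric_coefficients.local_codiff_local_forms[OF metric_on_chart[OF assms(2)] formsD(2)[OF assms]] assms(2)
  by (simp add: coord_codiff_def)

text \<open>The charts fit together because the coordinate formula is invariant under changes of
  coordinates.\<close>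

lemma coord_codiff_forms:
  assumes w: "\<omega> \<in> forms A (Suc k)"
  shows "coord_codiff \<omega> \<in> forms A k"
  unfolding forms_iff
proof (intro conjI allI impI ballI)
  show "coord_codiff \<omega> c = (\<lambda>x I. 0)" if "c \<notin> A" for c
    using that by (simp add: coord_codiff_def fun_eq_iff)
  show "coord_codiff \<omega> c \<in> local_forms (chart_ran c) k" if "c \<in> A" for c
    by (rule coord_codiff_local[OF w that])
  fix c c' x and I :: "'n list"
  assume *: "c \<in> A" "c' \<in> A" "x \<in> overlap c c'" "length I = k"
  have Tx: "transition c c' x \<in> chart_ran c'" using transition_in_range[OF *(1)] *(3) by blast
  have "local_codiff (g c) (\<omega> c) x I =
      transform (coord_jacobian (transition c c') x) (local_codiff (g c') (\<omega> c') (transition c c' x)) I"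
    by (rule local_codiff_coordinate_change[OF metric_on_overlap[OF *(1,2)] metric_on_chart[OF *(2)]
        transition_in_range[OF *(1)] smooth_transition[OF *(1,2)] metric_coordinate_change[OF *(1,2)]
        forms_alternating[OF w *(1)] forms_smooth_overlap[OF w *(1)] forms_smooth[OF w *(2)]
        formsD(3)[OF w *(1,2)] *(3,4)])
  then show "coord_codiff \<omega> c x I = transform (coord_jacobian (transition c c') x) (coord_codiff \<omega> c' (transition c c' x)) I"
    using *(1,2,3) overlap_subset[of c c'] Tx by (auto simp: coord_codiff_def)
qed

text \<open>Integration by parts in each chart shows that the coordinate formula is adjoint to
  \<open>d\<close>, and two forms with the same pairings with all test forms agree. Hence the
  description of \<open>codiff\<close> as the unique adjoint form denotes the coordinate
  formula.\<close>

lemma adjoint_pair_iff: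
  assumes w: "\<omega> \<in> forms A (Suc k)" and h: "h \<in> forms A k"
  shows "adjoint_pair A g k \<omega> h \<longleftrightarrow> h = coord_codiff \<omega>"
proof -
  let ?I = "\<lambda>c \<phi> h. integral (chart_ran c) (\<lambda>x. form_pairing (g c x) k (\<phi> x) (h c x) * sqrt \<bar>det (g c x)\<bar>)"
  have adj: "integral (chart_ran c) (\<lambda>x. form_pairing (g c x) (Suc k) (local_d \<phi> x) (\<omega> c x) * sqrt \<bar>det (g c x)\<bar>) =
      ?I c \<phi> (coord_codiff \<omega>)" if c: "c \<in> A" and \<phi>: "\<phi> \<in> test_forms (chart_ran c) k" for c \<phi>
  proof -
    interpret metric_coefficients "chart_ran c" "g c" by (rule metric_on_chart[OF c])
    have "?I c \<phi> (coord_codiff \<omega>) =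
        integral (chart_ran c) (\<lambda>x. form_pairing (g c x) k (\<phi> x) (local_codiff (g c) (\<omega> c) x) * sqrt \<bar>det (g c x)\<bar>)"
      by (rule integral_cong) (simp add: coord_codiff_def c)
    then show ?thesis
      using local_codiff_adjoint[OF \<phi> formsD(2)[OF w c]] by (simp add: volume_density_def)
  qed
  show ?thesis
  proof
    assume "h = coord_codiff \<omega>"
    then show "adjoint_pair A g k \<omega> h" unfolding adjoint_pair_def using adj by simp
  next
    assume pair: "adjoint_pair A g k \<omega> h"
    show "h = coord_codiff \<omega>"
    proof
      fix c
      show "h c = coord_codiff \<omega> c"
      proof (cases "c \<in> A")
        case c: True
        show ?thesis
        proof (rule metric_coefficients.adjoint_unique[OF metric_on_chart[OF c] formsD(2)[OF h c] coord_codiff_local[OF w c]])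
          fix \<phi> assume \<phi>: "\<phi> \<in> test_forms (chart_ran c) k"
          interpret metric_coefficients "chart_ran c" "g c" by (rule metric_on_chart[OF c])
          show "integral (chart_ran c) (\<lambda>x. form_pairing (g c x) k (\<phi> x) (h c x) * volume_density x) =
            integral (chart_ran c) (\<lambda>x. form_pairing (g c x) k (\<phi> x) (coord_codiff \<omega> c x) * volume_density x)"
            using pair c \<phi> adj[OF c \<phi>] unfolding adjoint_pair_def volume_density_def by simp
        qed
      next
        case False
        then show ?thesis using formsD(1)[OF h False] by (simp add: coord_codiff_def fun_eq_iff)
      qed
    qed
  qed
qed

lemma codiff_Suc:
  assumes w: "\<omega> \<in> forms A (Suc k)"
  shows "codiff A g (Suc k) \<omega> = coord_codiff \<omega>"
  unfolding codiff_def nat.case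
  by (rule the_equality) (use adjoint_pair_iff[OF w] coord_codiff_forms[OF w] in auto)

lemma codiff_forms: "\<omega> \<in> forms A (Suc k) \<Longrightarrow> codiff A g (Suc k) \<omega> \<in> forms A k"
  by (simp add: codiff_Suc coord_codiff_forms)

lemma codiff_add_scale:
  assumes w: "\<omega> \<in> forms A k" and e: "\<eta> \<in> forms A k"
  shows "codiff A g k (\<omega> + scale_form r \<eta>) = codiff A g k \<omega> + scale_form r (codiff A g k \<eta>)"
proof (cases k)
  case 0
  then show ?thesis by (simp add: codiff_def)
next
  case (Suc l)
  have "coord_codiff (\<omega> + scale_form r \<eta>) c x I = coord_codiff \<omega> c x I + r * coord_codiff \<eta> c x I" for c x I
  proof (cases "c \<in> A \<and> x \<in> chart_ran c")
    case True
    have "(\<omega> + scale_form r \<eta>) c = (\<lambda>x I. \<omega> c x I + r * \<eta> c x I)"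
      by (simp add: scale_form_def fun_eq_iff)
    then show ?thesis
      using True metric_coefficients.local_codiff_add_cmult[where x=x and I=I and c=r,
          OF metric_on_chart[of c] forms_smooth[OF w, of c] forms_smooth[OF e, of c]]
      by (simp add: coord_codiff_def)
  qed (auto simp: coord_codiff_def)
  then show ?thesis
    using w e forms_add_scale[OF w e] unfolding Suc by (simp add: codiff_Suc fun_eq_iff scale_form_def)
qed

text \<open>In degree \<open>0\<close> the codifferential is zero, and so is the operator.\<close>

lemma ext_d_codiff_forms:
  assumes w: "\<omega> \<in> forms A k"
  shows "ext_d (codiff A g k \<omega>) \<in> forms A k" "ext_d (ext_d (codiff A g k \<omega>)) = 0"
proof -
  have "ext_d (codiff A g k \<omega>) \<in> forms A k \<and> ext_d (ext_d (codiff A g k \<omega>)) = 0"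
  proof (cases k)
    case 0
    have "ext_d 0 = (0 :: ('a, 'n) mform)"
      by (simp add: ext_d_def local_d_def fun_eq_iff)
    then show ?thesis using 0 zero_form by (simp add: codiff_def)
  next
    case (Suc l)
    then show ?thesis using w codiff_forms ext_d_forms ext_d_ext_d by metis
  qed
  then show "ext_d (codiff A g k \<omega>) \<in> forms A k" "ext_d (ext_d (codiff A g k \<omega>)) = 0" by auto
qed

text \<open>For \<open>k = 0\<close> truncated subtraction gives degree \<open>0\<close>, where the zero
  form, the value of the codifferential on functions, lives.\<close>

lemma codiff_forms_pred:
  assumes w: "\<omega> \<in> forms A k"
  shows "codiff A g k \<omega> \<in> forms A (k - 1)"
  using codiff_forms w zero_form by (cases k) (auto simp: codiff_def)

lemma ext_d_codiff_operator: "operator_on_subspace scale_form (forms A k) (\<lambda>f. ext_d (codiff A g k f))"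
proof unfold_locales
  show "mform.subspace (forms A k)" by (rule subspace_forms)
  have lin: "ext_d (codiff A g k (x + scale_form r y)) = ext_d (codiff A g k x) + scale_form r (ext_d (codiff A g k y))"
    if "x \<in> forms A k" "y \<in> forms A k" for x y r
    unfolding codiff_add_scale[OF that]
    by (rule ext_d_add_scale[OF codiff_forms_pred[OF that(1)] codiff_forms_pred[OF that(2)]])
  show "ext_d (codiff A g k x) \<in> forms A k" if "x \<in> forms A k" for x by (rule ext_d_codiff_forms(1)[OF that])
  show "ext_d (codiff A g k (x + y)) = ext_d (codiff A g k x) + ext_d (codiff A g k y)"
    if "x \<in> forms A k" "y \<in> forms A k" for x y
    using lin[OF that, of 1] by simp
  have z: "ext_d (codiff A g k 0) = 0"
    using lin[OF zero_form zero_form, of "-1"] by simp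
  show "ext_d (codiff A g k (scale_form r x)) = scale_form r (ext_d (codiff A g k x))" if "x \<in> forms A k" for r x
    using lin[OF zero_form that, of r] z by simp
qed

end

section \<open>The decomposition\<close>

lemma foldr_comp_apply: "foldr (\<circ>) (map h js) id x = foldr h js x"
  by (induction js) auto

text \<open>As \<open>n - 2 k = 2 p\<close>, the numbers are multiples of \<open>i (2 p - i +
  1)\<close>, and the difference of two such values is \<open>(i - j) (2 p + 1 - (i + j))\<close>, whose
  second factor is positive for \<open>i, j \<le> p\<close>. The index \<open>0\<close> gives the
  eigenvalue \<open>0\<close>, so in particular all the others are nonzero.\<close>

lemma eigval_inj:
  assumes "J \<noteq> 0" "0 < n" "n = 2 * k + 2 * p"
  shows "inj_on (eigval n k J) {0..p}"
proof (rule inj_onI)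
  fix i j assume ij: "i \<in> {0..p}" "j \<in> {0..p}" "eigval n k J i = eigval n k J j"
  have r: "real n - 2 * real k = 2 * real p" using assms(3) by simp
  have "real i * (2 * real p - real i + 1) = real j * (2 * real p - real j + 1)"
    using ij(3) assms(1,2) unfolding eigval_def r by (simp add: divide_simps)
  then have "(real i - real j) * (2 * real p + 1 - (real i + real j)) = 0"
    by (simp add: algebra_simps)
  moreover have "2 * real p + 1 - (real i + real j) \<noteq> 0" using ij(1,2) by auto
  ultimately show "i = j" by simp
qed

context pseudo_riemannian_manifold
begin

text \<open>The scalar curvature is the trace of \<open>Ric = r g\<close>, that is \<open>r n\<close>,
  and \<open>r \<noteq> 0\<close> as the Ricci tensor does not vanish.\<close>

lemma schouten_trace_nonzero:
  assumes "einstein A g" "\<not> ricci_flat A g" "2 \<le> CARD('n)"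
    and "\<forall>c\<in>A. \<forall>x\<in>chart_ran c. schouten_trace (g c) x = J"
  shows "J \<noteq> 0"
proof -
  obtain r where r: "\<And>c x k j. c \<in> A \<Longrightarrow> x \<in> chart_ran c \<Longrightarrow> ricci (g c) k j x = r * g c x $ k $ j"
    using assms(1) unfolding einstein_def by blast
  obtain c x k j where c: "c \<in> A" "x \<in> chart_ran c" and ne: "ricci (g c) k j x \<noteq> 0"
    using assms(2) unfolding ricci_flat_def by blast
  have "r \<noteq> 0" using r[OF c] ne by auto
  have inv: "invertible (g c x)" and sym: "transpose (g c x) = g c x"
    using metric c unfolding pseudo_riemannian_def by blast+
  have s: "g c x $ k $ j = g c x $ j $ k" for j k
    using arg_cong[OF sym, of "\<lambda>G. G $ j $ k"] by (simp add: transpose_def)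
  have "scalar_curvature (g c) x = (\<Sum>k\<in>UNIV. \<Sum>j\<in>UNIV. r * (matrix_inv (g c x) $ k $ j * g c x $ j $ k))"
    unfolding scalar_curvature_def r[OF c] by (intro sum.cong refl, subst s) simp
  also have "\<dots> = r * (\<Sum>k\<in>UNIV. (matrix_inv (g c x) ** g c x) $ k $ k)"
    by (simp add: matrix_mult_entry sum_distrib_left)
  also have "\<dots> = r * real CARD('n)"
    unfolding matrix_inv_both(2)[OF inv] by (simp add: mat_def)
  finally have scal: "scalar_curvature (g c) x = r * real CARD('n)" .
  have "J = r * real CARD('n) / (2 * (real CARD('n) - 1))"
    using assms(4)[rule_format, OF c] unfolding schouten_trace_def scal by (rule HOL.sym)
  then show ?thesis using \<open>r \<noteq> 0\<close> assms(3) by auto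
qed

end

theorem theorem5p5:
  fixes X :: "'a topology"
    and A :: "('a, 'n::finite) chart set"
    and g :: "('a, 'n) metric"
    and J :: real
    and n k p :: nat
  assumes "n = CARD('n)" and "4 \<le> n" and "even n"
    and "smooth_manifold X A"
    and "pseudo_riemannian A g"
    and "einstein A g"
    and "\<not> ricci_flat A g"
    and "\<forall>c\<in>A. \<forall>x\<in>chart_ran c. schouten_trace (g c) x = J"
    and "k \<le> n div 2"
    and "p = (n - 2 * k) div 2"
  shows "internal_direct_sum {0..p}
           (\<lambda>i. if i = 0 then H_sigma A g k else H_bar A g k (eigval n k J i))
           (H_G A g J k)"
proof -
  interpret pseudo_riemannian_manifold X A g using assms by unfold_locales
  let ?D = "\<lambda>f. ext_d (codiff A g k f)"
  let ?\<mu> = "eigval n k J"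
  let ?W = "\<lambda>i. if i = 0 then H_sigma A g k else H_bar A g k (?\<mu> i)"
  define js where "js = [1..<Suc p]"
  interpret dd: operator_on_subspace scale_form "forms A k" ?D by (rule ext_d_codiff_operator)
  \<comment> \<open>The product of second order factors in \<open>G\<close>; as \<open>\<mu>\<^sub>0 = 0\<close>, the elements of \<open>H_sigma\<close> are eigenforms like those of the other summands.\<close>
  let ?Q = "foldr (\<lambda>j. dd.shift (?\<mu> j)) js"

  have "J \<noteq> 0" using schouten_trace_nonzero assms by simp
  have np: "n = 2 * k + 2 * p" using assms(3,9,10) by auto
  have inj: "inj_on ?\<mu> {0..p}" using eigval_inj[OF \<open>J \<noteq> 0\<close> _ np] assms(2) by simp
  have \<mu>0: "?\<mu> 0 = 0" by (simp add: eigval_def)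
  have \<mu>_nz: "?\<mu> i \<noteq> 0" if "i \<in> {1..p}" for i
    using inj_onD[OF inj, of i 0] that \<mu>0 by auto
  have set_js: "set js = {1..p}" unfolding js_def by auto
  have factor: "G_factor A g J k i = dd.shift (?\<mu> i)" for i
    by (rule ext) (simp add: G_factor_def dd.shift_def eigval_def assms(1))
  have G_op: "G_op A g J k f = codiff A g k (?Q f)" for f
  proof -
    have "(CARD('n) - 2 * k) div 2 = p" using assms(1,10) by simp
    then show ?thesis
      unfolding G_op_def o_apply foldr_comp_apply factor js_def by simp
  qed

  have codiff_scale: "codiff A g k (scale_form r f) = scale_form r (codiff A g k f)" if "f \<in> forms A k" for r f
  proof -
    have z: "codiff A g k 0 = 0"
      using codiff_add_scale[OF zero_form zero_form, of k "-1"] by simp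
    show ?thesis using codiff_add_scale[OF zero_form that, of r] z by simp
  qed
  have ext_d_scale: "ext_d (scale_form r f) = scale_form r (ext_d f)" if "f \<in> forms A l" for r f l
  proof -
    have z: "ext_d (0 :: ('a, 'n) mform) = 0"
      using ext_d_add_scale[OF zero_form zero_form, of "-1"] by simp
    show ?thesis using ext_d_add_scale[OF zero_form that, of r] z by simp
  qed
  have closed_subspace: "mform.subspace (closed_forms A k)"
    unfolding mform.subspace_def closed_forms_def
    using ext_d_add_scale[of _ k _ 1] ext_d_scale[of _ k] ext_d_scale[OF zero_form, of 0] dd.F_closed
    by auto
  \<comment> \<open>An eigenform for a nonzero eigenvalue is a multiple of an exact form, hence closed.\<close>
  have W_eigen: "u \<in> forms A k \<and> ?D u = scale_form (?\<mu> i) u \<and> ext_d u = 0"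
    if u: "u \<in> ?W i" and i: "i \<in> {0..p}" for u i
  proof (cases "i = 0")
    case True
    have "?D u = 0"
      using u True ext_d_scale[OF zero_form, of 0] by (simp add: H_sigma_def)
    then show ?thesis using u True \<mu>0 by (simp add: H_sigma_def)
  next
    case False
    then have u': "u \<in> forms A k" "?D u = scale_form (?\<mu> i) u" using u by (auto simp: H_bar_def)
    have "scale_form (?\<mu> i) (ext_d u) = 0"
      using ext_d_codiff_forms(2)[OF u'(1)] ext_d_scale[OF u'(1)] u'(2) by simp
    then have "ext_d u = 0" using \<mu>_nz[of i] i False by (simp add: mform.scale_eq_0_iff)
    then show ?thesis using u' by simp
  qed
  have W_I: "u \<in> ?W i" if "u \<in> forms A k" "?D u = scale_form (?\<mu> i) u" "i \<noteq> 0" for u i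
    using that by (simp add: H_bar_def)

  have subspaces: "mform.subspace (?W i)" for i
  proof (cases "i = 0")
    case True
    have "H_sigma A g k = {f \<in> forms A k. ext_d f = 0 \<and> codiff A g k f = 0}"
      by (simp add: H_sigma_def)
    then show ?thesis
      unfolding mform.subspace_def
      using True ext_d_add_scale[of _ k _ 1] ext_d_scale[of _ k] ext_d_scale[OF zero_form, of 0] dd.F_closed
        codiff_add_scale[of _ k _ 1] codiff_scale codiff_scale[OF zero_form, of 0]
      by auto
  next
    case False
    then show ?thesis
      unfolding mform.subspace_def H_bar_def
      using dd.D_add dd.D_scale dd.D_scale[OF zero_form, of 0] dd.F_closed
      by (auto simp: mform.scale_right_distrib mult.commute)
  qed

  \<comment> \<open>\<open>Q\<close> kills all components but the one in \<open>H_sigma\<close>, and \<open>\<delta>\<close> kills that one.\<close>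
  have sum_in: "(\<Sum>i\<in>{0..p}. u i) \<in> H_G A g J k" if u: "u \<in> Pi\<^sub>E {0..p} ?W" for u
  proof -
    have ui: "u i \<in> ?W i" if "i \<in> {0..p}" for i using u that by (rule PiE_mem)
    have uF: "u i \<in> forms A k" "?D (u i) = scale_form (?\<mu> i) (u i)" "ext_d (u i) = 0" if "i \<in> {0..p}" for i
      using W_eigen[OF ui[OF that] that] by auto
    have "(\<Sum>i\<in>{0..p}. u i) \<in> closed_forms A k"
      using mform.subspace_sum[OF closed_subspace, of "{0..p}" u] uF by (auto simp: closed_forms_def)
    moreover have "codiff A g k (?Q (\<Sum>i\<in>{0..p}. u i)) = 0"
    proof -
      have Q: "?Q (u i) = scale_form (\<Prod>j\<leftarrow>js. ?\<mu> i - ?\<mu> j) (u i)" if "i \<in> {0..p}" for i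
        by (rule dd.shifts_eigenvector[OF uF(1,2)[OF that]])
      have "?Q (u i) = 0" if "i \<in> {1..p}" for i
      proof -
        have "i \<in> set js" using that set_js by blast
        then have "(\<Prod>j\<leftarrow>js. ?\<mu> i - ?\<mu> j) = 0" by (rule prod_list_difference_zero)
        then show ?thesis using Q[of i] that by simp
      qed
      then have "(\<Sum>i\<in>{0..p}. ?Q (u i)) = ?Q (u 0)"
        by (subst sum.remove[of _ 0]) (auto intro!: sum.neutral)
      then have "?Q (\<Sum>i\<in>{0..p}. u i) = scale_form (\<Prod>j\<leftarrow>js. ?\<mu> 0 - ?\<mu> j) (u 0)"
        using dd.shifts_sum[where S="{0..p}" and u=u and \<mu>="?\<mu>" and js=js] uF(1) Q[of 0] by simp
      moreover have "codiff A g k (u 0) = 0" using ui[of 0] by (simp add: H_sigma_def)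
      ultimately show ?thesis using codiff_scale uF(1)[of 0] by simp
    qed
    ultimately show ?thesis by (simp add: H_G_def G_op)
  qed

  have sum_onto: "\<exists>u\<in>Pi\<^sub>E {0..p} ?W. f = (\<Sum>i\<in>{0..p}. u i)" if f: "f \<in> H_G A g J k" for f
  proof -
    have fF: "f \<in> forms A k" and df: "ext_d f = 0" and Gf: "codiff A g k (?Q f) = 0"
      using f by (auto simp: H_G_def closed_forms_def G_op)
    \<comment> \<open>The component of \<open>f\<close> in \<open>H_sigma\<close> is a multiple of \<open>h\<close>, which is coclosed because \<open>f\<close> is in the null space of \<open>G\<close>.\<close>
  define h where "h = ?Q f"
    have hF: "h \<in> forms A k" unfolding h_def by (rule dd.shifts_closed[OF fF])
    \<comment> \<open>All factors preserve closed forms.\<close>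
    have dQ: "ext_d (foldr (\<lambda>j. dd.shift (?\<mu> j)) js f) = 0" for js
    proof (induction js)
      case (Cons j js)
      have F: "foldr (\<lambda>j. dd.shift (?\<mu> j)) js f \<in> forms A k" by (rule dd.shifts_closed[OF fF])
      have "foldr (\<lambda>j. dd.shift (?\<mu> j)) (j # js) f =
          ?D (foldr (\<lambda>j. dd.shift (?\<mu> j)) js f) + scale_form (- ?\<mu> j) (foldr (\<lambda>j. dd.shift (?\<mu> j)) js f)"
        by (simp only: foldr.simps o_apply dd.shift_def)
      then show ?case
        by (simp only: ext_d_add_scale[OF ext_d_codiff_forms(1)[OF F] F] ext_d_codiff_forms(2)[OF F] Cons
            mform.scale_zero_right add_0_right)
    qed (simp add: df)
    have Dh: "?D h = scale_form 0 h"
      using Gf ext_d_scale[OF zero_form, of 0] by (simp add: h_def)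
    obtain r where r: "?Q (f - scale_form r h) = 0"
      unfolding h_def
    proof (rule dd.split_off_eigenvector[OF fF Dh[unfolded h_def]])
      show "?\<mu> j \<noteq> 0" if "j \<in> set js" for j using \<mu>_nz that set_js by simp
    qed
    have rF: "f - scale_form r h \<in> forms A k" by (intro dd.F_closed fF hF)
    have "inj_on ?\<mu> (set js)" using inj_on_subset[OF inj] set_js by auto
    then obtain v where v: "\<forall>j\<in>set js. v j \<in> forms A k \<and> ?D (v j) = scale_form (?\<mu> j) (v j)"
      "f - scale_form r h = (\<Sum>j\<in>set js. v j)"
      using dd.eigenvector_decomposition[OF _ _ rF r] distinct_upt unfolding js_def by blast
    define u where "u = (\<lambda>i\<in>{0..p}. if i = 0 then scale_form r h else v i)"
    have "scale_form r h \<in> H_sigma A g k"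
      using hF dd.F_closed(3)[OF hF] dQ[of js] Gf codiff_scale[OF hF] ext_d_scale[OF hF]
      by (simp add: H_sigma_def h_def)
    then have "u \<in> Pi\<^sub>E {0..p} ?W"
      using v(1) W_I set_js by (auto simp: u_def)
    moreover have "f = (\<Sum>i\<in>{0..p}. u i)"
    proof -
      have "(\<Sum>i\<in>{0..p}. u i) = u 0 + (\<Sum>i\<in>{1..p}. u i)"
        by (simp add: sum.atLeast_Suc_atMost)
      also have "\<dots> = scale_form r h + (\<Sum>i\<in>set js. v i)"
        unfolding set_js by (auto simp: u_def intro!: sum.cong)
      also have "\<dots> = f" unfolding v(2)[symmetric] by simp
      finally show ?thesis ..
    qed
    ultimately show ?thesis by blast
  qed

  have "inj_on (\<lambda>u. \<Sum>i\<in>{0..p}. u i) (Pi\<^sub>E {0..p} ?W)"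
  proof (rule inj_onI)
    fix u v assume u: "u \<in> Pi\<^sub>E {0..p} ?W" and v: "v \<in> Pi\<^sub>E {0..p} ?W"
      and eq: "(\<Sum>i\<in>{0..p}. u i) = (\<Sum>i\<in>{0..p}. v i)"
    have d: "u i - v i \<in> ?W i" if "i \<in> {0..p}" for i
      using mform.subspace_diff[OF subspaces PiE_mem[OF u that] PiE_mem[OF v that]] .
    have "u i - v i = 0" if i: "i \<in> {0..p}" for i
      using dd.eigenvectors_independent[OF _ inj _ _ _ i, of "\<lambda>i. u i - v i"] W_eigen[OF d] eq
      by (simp add: sum_subtractf)
    then show "u = v" using PiE_ext[OF u v] by simp
  qed
  moreover have "(\<lambda>u. \<Sum>i\<in>{0..p}. u i) ` Pi\<^sub>E {0..p} ?W = H_G A g J k"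
    using sum_in sum_onto by (auto simp: image_iff)
  ultimately show ?thesis
    unfolding internal_direct_sum_def bij_betw_def using subspaces by blast
qed

end
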